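(* Let $T$ be an ergodic endomorphism of a probability space $(X,\mathcal{B},m)$. Let $\mathcal{F}\subset\mathcal{B}$ be a $\sigma$-algebra such that $\mathcal{F}\subset T\mathcal{F}$. Consider a square-integrable function $f:X\to\mathbb{R}$ such that $\int f\,dm=0$ and $$\sum_{n\ge0}\|E(f|T^n\mathcal{F})-f\|_{L^2}<\infty\quad\text{and}\quad\sum_{n\ge0}\|E(f|T^{-n}\mathcal{F})\|_{L^2}<\infty .$$ Then there exists $\sigma^2\ge0$ such that $S_nf/\sqrt n$ converges with tight maxima to $\mathcal{N}(0,\sigma^2)$, and moreover $S_nf/\sqrt n$ also satisfies an almost sure limit theorem towards $\mathcal{N}(0,\sigma^2)$.
   Context: An ergodic endomorphism is an ergodic measure-preserving map. $S_nf=\sum_{k=0}^{n-1}f\circ T^k$. For $n\ge0$, $T^n\mathcal{F}=\{T^nA: A\in\mathcal{F}\}$ and $T^{-n}\mathcal{F}=\{(T^n)^{-1}A: A\in\mathcal{F}\}$; the families $T^n\mathcal{F}$ are understood to be sub-$\sigma$-algebras of $\mathcal{B}$, so that the conditional expectations make sense. Convergence with tight maxima: $S_n/B_n$ converges with tight maxima to $\mathcal{W}$ if $S_n/B_n$ converges in law to $\mathcal{W}$ and the sequence $(\max_{1\le k\le n}|S_k|)/B_n$, $n\ge1$, is tight. Almost sure limit theorem: $S_n/B_n$ satisfies an almost sure limit theorem towards $\mathcal{W}$ if, for almost all $\omega$, the measures $\frac{1}{\log N}\sum_{k=1}^N\frac1k\delta_{S_k(\omega)/B_k}$ converge weakly as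 $N\to\infty$ to the law of $\mathcal{W}$ ($\delta_x$ is the Dirac mass at $x$). $\mathcal{N}(0,0)$ is the Dirac mass at $0$.
   Formalization: The formal theorem also assumes that T^{-n}(T^n F) is contained in F for all n (automatic when T is bijective or F = B); without it, a null set with large image makes the claim false for non-invertible T. *)

theory Defs
  imports "HOL-Probability.Probability"
begin

definition ergodic_endomorphism :: "'a measure \<Rightarrow> ('a \<Rightarrow> 'a) \<Rightarrow> bool" where
  "ergodic_endomorphism M T \<longleftrightarrow>
     prob_space M \<and> T \<in> measurable M M \<and> distr M M T = M \<and>
     (\<forall>A\<in>sets M. T -` A \<inter> space M = A \<longrightarrow> measure M A = 0 \<or> measure M A = 1)"

definition birkhoff_sum :: "('a \<Rightarrow> 'a) \<Rightarrow> ('a \<Rightarrow> real) \<Rightarrow> nat \<Rightarrow> 'a \<Rightarrow> real" where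
  "birkhoff_sum T f n x = (\<Sum>k<n. f ((T ^^ k) x))"

definition image_family :: "('a \<Rightarrow> 'a) \<Rightarrow> nat \<Rightarrow> 'a set set \<Rightarrow> 'a set set" where
  "image_family T n F = {(T ^^ n) ` A | A. A \<in> F}"

definition preimage_family :: "'a measure \<Rightarrow> ('a \<Rightarrow> 'a) \<Rightarrow> nat \<Rightarrow> 'a set set \<Rightarrow> 'a set set" where
  "preimage_family M T n F = {(T ^^ n) -` A \<inter> space M | A. A \<in> F}"

text \<open>The library conditions on a measure, of which only the \<open>\<sigma>\<close>-algebra matters; below, \<open>F\<close> is
  always a \<open>\<sigma>\<close>-algebra on the space of \<open>M\<close>, so that it is exactly the family of sets of
  \<open>sigma (space M) F\<close>.\<close>

definition cond_exp_on :: "'a measure \<Rightarrow> 'a set set \<Rightarrow> ('a \<Rightarrow> real) \<Rightarrow> 'a \<Rightarrow> real" where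
  "cond_exp_on M F f = real_cond_exp M (sigma (space M) F) f"

definition L2_norm :: "'a measure \<Rightarrow> ('a \<Rightarrow> real) \<Rightarrow> real" where
  "L2_norm M g = sqrt (\<integral>x. (g x)\<^sup>2 \<partial>M)"

text \<open>The image measurability condition \<open>T\<^sup>-\<^sup>n(T\<^sup>nF) \<subseteq> F\<close> says that \<open>T\<^sup>n\<close> is measurable from
  \<open>(X, F)\<close> to \<open>(X, T\<^sup>nF)\<close>, which is what makes conditional expectations given \<open>T\<^sup>nF\<close> transport
  along \<open>T\<close>. The two lemmas show that it is automatic for invertible \<open>T\<close>, and for the full
  \<open>\<sigma>\<close>-algebra. Without it, null sets with large image can make \<open>T\<^sup>nF\<close> much finer than \<open>F\<close>, with
  no relation to the dynamics of \<open>T\<close>.\<close>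

lemma preimage_image_family_bij:
  assumes "bij_betw T (space M) (space M)" "F \<subseteq> Pow (space M)"
  shows "preimage_family M T n (image_family T n F) = F"
proof -
  have inj: "inj_on (T ^^ n) (space M)"
    using bij_betw_funpow[OF assms(1)] by (rule bij_betw_imp_inj_on)
  have "(T ^^ n) -` ((T ^^ n) ` A) \<inter> space M = A" if "A \<in> F" for A
    using that assms(2) inj by (auto dest!: inj_onD)
  then show ?thesis
    unfolding preimage_family_def image_family_def by (auto; metis)
qed

lemma preimage_image_family_full:
  assumes "T \<in> measurable M M" "image_family T n (sets M) \<subseteq> sets M"
  shows "preimage_family M T n (image_family T n (sets M)) \<subseteq> sets M"
proof -
  have "T ^^ n \<in> measurable M M"
    using measurable_compose_n[OF assms(1)] .
  then show ?thesis
    using assms(2) unfolding preimage_family_def by (auto intro: measurable_sets)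
qed

definition centred_normal_law :: "real \<Rightarrow> real measure" where
  "centred_normal_law v =
     (if v = 0 then return borel 0 else density lborel (normal_density 0 (sqrt v)))"

text \<open>The library predicate \<open>tight\<close> speaks about a sequence starting at index \<open>0\<close>, hence the shift.\<close>

definition converges_with_tight_maxima ::
    "'a measure \<Rightarrow> (nat \<Rightarrow> 'a \<Rightarrow> real) \<Rightarrow> (nat \<Rightarrow> real) \<Rightarrow> real measure \<Rightarrow> bool" where
  "converges_with_tight_maxima M S B W \<longleftrightarrow>
     weak_conv_m (\<lambda>n. distr M borel (\<lambda>\<omega>. S n \<omega> / B n)) W \<and>
     tight (\<lambda>n. distr M borel (\<lambda>\<omega>. Max ((\<lambda>k. \<bar>S k \<omega>\<bar>) ` {1..Suc n}) / B (Suc n)))"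

definition log_average_measure :: "(nat \<Rightarrow> real) \<Rightarrow> nat \<Rightarrow> real measure" where
  "log_average_measure u N =
     distr (point_measure {1..N} (\<lambda>k. ennreal (1 / (ln (real N) * real k)))) borel u"

text \<open>Logarithmic averages are finite measures, but in general not probability measures. Therefore
  weak convergence is tested on bounded continuous functions here, and not on distribution functions
  as in \<open>weak_conv_m\<close>.\<close>

definition weakly_converges :: "(nat \<Rightarrow> real measure) \<Rightarrow> real measure \<Rightarrow> bool" where
  "weakly_converges \<mu> \<nu> \<longleftrightarrow>
     (\<forall>\<phi> :: real \<Rightarrow> real. continuous_on UNIV \<phi> \<and> bounded (range \<phi>) \<longrightarrow>
        (\<lambda>N. \<integral>x. \<phi> x \<partial>\<mu> N) \<longlonglongrightarrow> (\<integral>x. \<phi> x \<partial>\<nu>))"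

definition almost_sure_limit_theorem ::
    "'a measure \<Rightarrow> (nat \<Rightarrow> 'a \<Rightarrow> real) \<Rightarrow> (nat \<Rightarrow> real) \<Rightarrow> real measure \<Rightarrow> bool" where
  "almost_sure_limit_theorem M S B W \<longleftrightarrow>
     (AE \<omega> in M. weakly_converges (log_average_measure (\<lambda>k. S k \<omega> / B k)) W)"

end

(*
  Gordin's method in a form that needs neither invertibility of T nor the natural extension.

  With u = sum_i (f o T^i - E(f o T^i | F)) and w = sum_{k>=1} r_k, where E(f | T^-k F) = r_k o T^k
  with r_k measurable for F, both series converge in L2 and f = m + v - v o T for v = u - w, where m
  is measurable for F and orthogonal to L2(T^-1 F). So S_n m is a sum of reverse martingale
  differences, and v o T^n / sqrt n -> 0 almost surely by Birkhoff's theorem.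

  For m, McLeish's product Pi_n(t) = prod_{j<n} (1 + i t m(T^j) / sqrt n), stopped when sum m^2 gets too
  large, has mean 1, is bounded in L2, and exp(i t S_n m / sqrt n) - exp(-t^2 s^2 / 2) Pi_n(t) -> 0 almost
  surely. This gives the central limit theorem. Moreover the covariance of Pi_k and Pi_l is O(sqrt(k/l)) for
  k <= l, so that the logarithmic averages of Pi_n - 1 tend to 0 almost surely, which gives the almost sure
  limit theorem. Tightness of the maxima is Kolmogorov's inequality.
*)
theory Submission
  imports Defs
begin

section \<open>Birkhoff's ergodic theorem\<close>

text \<open>The sigma-algebras T^-k F decrease with k, so martingale time runs against the orbit:
  the far end is known first, and the newest term is m(x). Hence the recursions that define stopped
  products and stopped sums lead from T x back to x, and every stopping decision is a function of T
  x.

  Stopping is forced by the moments: m is only square integrable, and the natural bound exp (t^2 sum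
  m^2 / n) for the squared product need not be integrable. With stopping, each increment of the
  product is m times a bounded function of T x.

  F is not assumed complete, so measurability of m for F cannot be recovered from an almost sure
  identity. The factors r_k are therefore obtained pointwise, from the surjectivity of T, and m is
  summed from differences that are measurable for F by construction.

  The almost sure limit theorem needs one null set for all t, whereas second moments give one null
  set for each t. Fubini leaves almost every t on almost every orbit, and positive definiteness of
  characteristic functions supplies the remaining t.\<close>

lemma birkhoff_sum_simps [simp]:
  "birkhoff_sum T f 0 x = 0"
  "birkhoff_sum T f (Suc 0) x = f x"
  by (simp_all add: birkhoff_sum_def)

lemma birkhoff_sum_Suc: "birkhoff_sum T f (Suc n) x = birkhoff_sum T f n x + f ((T ^^ n) x)"
  by (simp add: birkhoff_sum_def)

lemma birkhoff_sum_Suc': "birkhoff_sum T f (Suc n) x = f x + birkhoff_sum T f n (T x)"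
  by (simp add: birkhoff_sum_def sum.lessThan_Suc_shift funpow_swap1 del: sum.lessThan_Suc)

lemma AE_summable_of_integral_norm:
  fixes g :: "nat \<Rightarrow> 'a \<Rightarrow> 'b::{banach, second_countable_topology}"
  assumes int: "\<And>i. integrable M (g i)" and summ: "summable (\<lambda>i. \<integral>x. norm (g i x) \<partial>M)"
  shows "AE x in M. summable (\<lambda>i. norm (g i x))"
proof -
  have [measurable]: "g i \<in> borel_measurable M" for i
    using int by auto
  have "(\<integral>\<^sup>+x. (\<Sum>i. ennreal (norm (g i x))) \<partial>M) = (\<Sum>i. \<integral>\<^sup>+x. ennreal (norm (g i x)) \<partial>M)"
    by (intro nn_integral_suminf) auto
  also have "\<dots> = (\<Sum>i. ennreal (\<integral>x. norm (g i x) \<partial>M))"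
    by (intro arg_cong[where f=suminf] ext nn_integral_eq_integral integrable_norm int) auto
  also have "\<dots> \<noteq> \<infinity>"
    using summ by (simp add: ennreal_suminf_neq_top integral_nonneg_AE)
  finally have "AE x in M. (\<Sum>i. ennreal (norm (g i x))) \<noteq> \<infinity>"
    by (intro nn_integral_PInf_AE) auto
  then show ?thesis
    by eventually_elim (auto intro: summable_suminf_not_top)
qed

locale measure_preserving = prob_space M for M :: "'a measure" +
  fixes T :: "'a \<Rightarrow> 'a"
  assumes T_meas [measurable]: "T \<in> measurable M M" and distr_T: "distr M M T = M"
begin

lemma T_pow_meas [measurable]: "T ^^ n \<in> measurable M M"
  using measurable_compose_n[OF T_meas] .

lemma distr_T_pow: "distr M M (T ^^ n) = M"
proof (induction n)
  case 0
  show ?case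
    by (simp add: distr_id2[OF refl, unfolded id_def[symmetric]] id_def)
next
  case (Suc n)
  have "distr M M (T ^^ Suc n) = distr (distr M M (T ^^ n)) M T"
    by (subst distr_distr) (auto simp: comp_def)
  then show ?case
    by (simp add: Suc distr_T comp_def)
qed

lemma T_pow_space [simp]: "x \<in> space M \<Longrightarrow> (T ^^ n) x \<in> space M"
  using measurable_space[OF T_pow_meas] by blast

lemma T_space [simp]: "x \<in> space M \<Longrightarrow> T x \<in> space M"
  using measurable_space[OF T_meas] by blast

lemma integrable_T_pow:
  fixes g :: "'a \<Rightarrow> 'b::{banach, second_countable_topology}"
  assumes "integrable M g"
  shows "integrable M (\<lambda>x. g ((T ^^ n) x))"
  using integrable_distr[OF T_pow_meas[of n], of g] assms by (simp add: distr_T_pow)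

lemma integral_T_pow:
  fixes g :: "'a \<Rightarrow> 'b::{banach, second_countable_topology}"
  assumes "g \<in> borel_measurable M"
  shows "(\<integral>x. g ((T ^^ n) x) \<partial>M) = (\<integral>x. g x \<partial>M)"
  using integral_distr[OF T_pow_meas[of n], of g] assms by (simp add: distr_T_pow)

lemmas integrable_T = integrable_T_pow[of _ 1, simplified]
lemmas integral_T = integral_T_pow[of _ 1, simplified]

lemma AE_T_pow:
  assumes "AE x in M. P x"
  shows "AE x in M. P ((T ^^ n) x)"
proof -
  have "AE x in distr M M (T ^^ n). P x"
    unfolding distr_T_pow by (rule assms)
  then show ?thesis
    by (rule AE_distrD[OF T_pow_meas])
qed

lemma birkhoff_sum_measurable [measurable]:
  assumes [measurable]: "f \<in> borel_measurable M"
  shows "birkhoff_sum T f n \<in> borel_measurable M"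
  unfolding birkhoff_sum_def by measurable

lemma integrable_birkhoff_sum:
  "integrable M f \<Longrightarrow> integrable M (birkhoff_sum T f n)"
  unfolding birkhoff_sum_def by (auto intro!: integrable_T_pow)

end

locale ergodic_system = measure_preserving M T for M :: "'a measure" and T +
  assumes ergodic: "\<And>A. A \<in> sets M \<Longrightarrow> T -` A \<inter> space M = A \<Longrightarrow> measure M A = 0 \<or> measure M A = 1"
begin

text \<open>The telescoping behind the maximal ergodic theorem, taken to the limit:
  \<open>Mx (Suc n) - Mx n o T\<close> has nonnegative integral, and where the sums are unbounded it
  converges to \<open>g\<close>. By ergodicity this set is null or full; a full set would make the
  integral of \<open>g\<close> nonnegative.\<close>

lemma AE_birkhoff_sum_bounded_above:
  assumes int: "integrable M g" and neg: "(\<integral>x. g x \<partial>M) < 0"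
  shows "AE x in M. bdd_above (range (\<lambda>n. birkhoff_sum T g n x))"
proof -
  have [measurable]: "g \<in> borel_measurable M" using int by auto
  let ?S = "birkhoff_sum T g"
  define E where "E = {x \<in> space M. \<not> bdd_above (range (\<lambda>n. ?S n x))}"
  have E_eq: "E = {x \<in> space M. \<forall>K::nat. \<exists>n. ?S n x > real K}"
    unfolding E_def bdd_above_def
    by (auto simp: not_le) (metis less_le_trans linorder_not_less nle_le order_trans real_arch_simple)
  have [measurable]: "E \<in> sets M" unfolding E_eq by measurable
  have unb_T: "bdd_above (range (\<lambda>n. ?S n (T x))) \<longleftrightarrow> bdd_above (range (\<lambda>n. ?S n x))" for x
  proof
    assume "bdd_above (range (\<lambda>n. ?S n (T x)))"
    then obtain B where B: "\<And>n. ?S n (T x) \<le> B" by (auto simp: bdd_above_def)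
    have "?S n x \<le> max 0 (g x + B)" for n
      using B by (cases n) (auto simp: birkhoff_sum_Suc' le_max_iff_disj)
    then show "bdd_above (range (\<lambda>n. ?S n x))" by (auto simp: bdd_above_def)
  next
    assume "bdd_above (range (\<lambda>n. ?S n x))"
    then obtain B where B: "\<And>n. ?S n x \<le> B" by (auto simp: bdd_above_def)
    have "?S n (T x) \<le> B - g x" for n
      using B[of "Suc n"] by (simp add: birkhoff_sum_Suc')
    then show "bdd_above (range (\<lambda>n. ?S n (T x)))" by (auto simp: bdd_above_def)
  qed
  have inv: "T -` E \<inter> space M = E"
    unfolding E_def using unb_T by auto
  have "measure M E \<noteq> 1"
  proof
    assume "measure M E = 1"
    then have AE_E: "AE x in M. x \<in> E"
      using prob_eq_1[of E] by simp
    \<comment> \<open>Index 0 belongs to the maximum, so \<open>Mx n\<close> is nonnegative. This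
      gives the \<open>max 0\<close> in the recursion and the domination of \<open>h n\<close> by
      the absolute value of \<open>g\<close>.\<close>
    define Mx where "Mx n x = Max ((\<lambda>k. ?S k x) ` {..n})" for n x
    have Mx_Suc: "Mx (Suc n) x = max 0 (g x + Mx n (T x))" for n x
    proof -
      have "(\<lambda>k. ?S k x) ` {..Suc n} = insert 0 ((\<lambda>y. g x + y) ` (\<lambda>k. ?S k (T x)) ` {..n})"
        by (auto simp: atMost_Suc_eq_insert_0 image_image birkhoff_sum_Suc')
      moreover have "Max ((\<lambda>y. g x + y) ` (\<lambda>k. ?S k (T x)) ` {..n}) = g x + Mx n (T x)"
        unfolding Mx_def by (subst mono_Max_commute[symmetric, where f="\<lambda>y. g x + y"]) (auto simp: mono_def)
      ultimately show ?thesis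
        unfolding Mx_def[of "Suc n"] by (subst \<open>_ ` {..Suc n} = _\<close>, subst Max_insert) auto
    qed
    have Mx_ge: "k \<le> n \<Longrightarrow> ?S k x \<le> Mx n x" for k n x
      unfolding Mx_def by (intro Max_ge) auto
    have Mx_nonneg: "0 \<le> Mx n x" for n x
      using Mx_ge[of 0 n x] by simp
    have Mx_meas [measurable]: "Mx n \<in> borel_measurable M" for n
      unfolding Mx_def by measurable
    have Mx_le: "Mx n x \<le> (\<Sum>k\<le>n. \<bar>?S k x\<bar>)" for n x
      unfolding Mx_def
      by (intro Max.boundedI) (auto intro!: order_trans[OF abs_ge_self member_le_sum[of _ "{..n}" "\<lambda>k. \<bar>?S k x\<bar>"]])
    have Mx_int: "integrable M (Mx n)" for n
      by (rule Bochner_Integration.integrable_bound[of _ "\<lambda>x. \<Sum>k\<le>n. \<bar>?S k x\<bar>"])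
         (use Mx_le Mx_nonneg int in \<open>auto intro!: integrable_birkhoff_sum sum_nonneg\<close>)
    define h where "h n x = Mx (Suc n) x - Mx n (T x)" for n x
    have h_eq: "h n x = max (- Mx n (T x)) (g x)" for n x
      unfolding h_def Mx_Suc by auto
    \<comment> \<open>On \<open>E\<close> the maximum along the orbit of \<open>T x\<close> grows
      beyond every bound, so the \<open>max\<close> in \<open>h_eq\<close> is eventually attained at
      \<open>g x\<close>.\<close>
    have h_lim: "(\<lambda>n. \<integral>x. h n x \<partial>M) \<longlonglongrightarrow> (\<integral>x. g x \<partial>M)"
    proof (rule integral_dominated_convergence[of _ _ _ "\<lambda>x. \<bar>g x\<bar>"])
      show "AE x in M. (\<lambda>n. h n x) \<longlonglongrightarrow> g x"
        using AE_E
      proof eventually_elim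
        case (elim x)
        then have "T x \<in> E" using inv by auto
        then have "\<not> bdd_above (range (\<lambda>n. ?S n (T x)))" by (auto simp: E_def)
        then obtain n0 where n0: "?S n0 (T x) > - g x"
          by (auto simp: bdd_above_def not_le)
        have "h n x = g x" if "n \<ge> n0" for n
          using Mx_ge[OF that, of "T x"] n0 unfolding h_eq by auto
        then show ?case
          by (intro tendsto_eventually) (auto simp: eventually_sequentially)
      qed
    next
      show "AE x in M. norm (h n x) \<le> \<bar>g x\<bar>" for n
        unfolding h_eq using Mx_nonneg by (auto simp: max_def abs_real_def intro!: AE_I2) 
          (smt (verit) Mx_nonneg)+
    qed (use int in \<open>auto simp: h_def\<close>)
    have "(\<integral>x. h n x \<partial>M) \<ge> 0" for n
    proof -
      have "(\<integral>x. h n x \<partial>M) = (\<integral>x. Mx (Suc n) x \<partial>M) - (\<integral>x. Mx n (T x) \<partial>M)"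
        unfolding h_def by (intro Bochner_Integration.integral_diff Mx_int integrable_T)
      also have "\<dots> = (\<integral>x. Mx (Suc n) x \<partial>M) - (\<integral>x. Mx n x \<partial>M)"
        by (simp add: integral_T)
      also have "\<dots> \<ge> 0"
      proof -
        have "(\<integral>x. Mx n x \<partial>M) \<le> (\<integral>x. Mx (Suc n) x \<partial>M)"
          by (intro integral_mono Mx_int) (auto simp: Mx_def intro!: Max_mono)
        then show ?thesis by simp
      qed
      finally show ?thesis .
    qed
    then have "0 \<le> (\<integral>x. g x \<partial>M)"
      using h_lim by (intro LIMSEQ_le_const) auto
    then show False using neg by simp
  qed
  then have "measure M E = 0" using ergodic[OF _ inv] by auto
  then have "AE x in M. x \<notin> E"
    using prob_eq_0[of E] by simp
  with AE_space show ?thesis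
    by eventually_elim (auto simp: E_def)
qed

text \<open>Subtracting a constant \<open>d\<close> strictly between the integral and
  \<open>c\<close> makes the integral negative; sums bounded by \<open>B\<close> are then beaten by
  the room \<open>n * (c - d)\<close>.\<close>

lemma AE_birkhoff_average_eventually_less:
  assumes int: "integrable M g" and less: "(\<integral>x. g x \<partial>M) < c"
  shows "AE x in M. eventually (\<lambda>n. birkhoff_sum T g n x / n < c) sequentially"
proof -
  obtain d where d: "(\<integral>x. g x \<partial>M) < d" "d < c" using dense[OF less] by auto
  have "AE x in M. bdd_above (range (\<lambda>n. birkhoff_sum T (\<lambda>x. g x - d) n x))"
    by (rule AE_birkhoff_sum_bounded_above) (use int d in \<open>auto simp: prob_space\<close>)
  then show ?thesis
  proof eventually_elim
    case (elim x)
    then obtain B where B: "\<And>n. birkhoff_sum T (\<lambda>x. g x - d) n x \<le> B"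
      by (auto simp: bdd_above_def)
    have *: "birkhoff_sum T g n x \<le> B + n * d" for n
      using B[of n] by (simp add: birkhoff_sum_def sum_subtractf)
    obtain N :: nat where N: "real N > B / (c - d)" using reals_Archimedean2 by blast
    have "birkhoff_sum T g n x / n < c" if "n \<ge> Suc N" for n
    proof -
      have "B / (c - d) < n" using N that by linarith
      then have "B < n * (c - d)" using d by (simp add: field_simps)
      then have "birkhoff_sum T g n x < n * c" using *[of n] by (simp add: algebra_simps)
      then show ?thesis using that by (simp add: field_simps)
    qed
    then show ?case unfolding eventually_sequentially by blast
  qed
qed

theorem birkhoff:
  assumes int: "integrable M g"
  shows "AE x in M. (\<lambda>n. birkhoff_sum T g n x / n) \<longlonglongrightarrow> (\<integral>x. g x \<partial>M)"
proof -
  let ?I = "\<integral>x. g x \<partial>M"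
  have "AE x in M. \<forall>k::nat. eventually (\<lambda>n. birkhoff_sum T g n x / n < ?I + 1 / Suc k) sequentially"
    unfolding AE_all_countable using int by (auto intro!: AE_birkhoff_average_eventually_less)
  moreover have "AE x in M. \<forall>k::nat. eventually (\<lambda>n. birkhoff_sum T (\<lambda>x. - g x) n x / n < - ?I + 1 / Suc k) sequentially"
    unfolding AE_all_countable using int by (auto intro!: AE_birkhoff_average_eventually_less)
  ultimately show ?thesis
  proof eventually_elim
    case (elim x)
    show ?case
    proof (rule tendstoI)
      fix e :: real assume "e > 0"
      then obtain k where k: "1 / Suc k < e" using nat_approx_posE by blast
      show "eventually (\<lambda>n. dist (birkhoff_sum T g n x / n) ?I < e) sequentially"
        using elim[THEN spec, of k]
        by eventually_elim (use k in \<open>auto simp: dist_real_def birkhoff_sum_def sum_negf abs_less_iff\<close>)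
    qed
  qed
qed

text \<open>The last term is the difference of two consecutive Birkhoff sums, whose averages have
  the same limit.\<close>

lemma AE_orbit_div_tendsto_0:
  assumes int: "integrable M g"
  shows "AE x in M. (\<lambda>n. g ((T ^^ n) x) / n) \<longlonglongrightarrow> 0"
  using birkhoff[OF int]
proof eventually_elim
  case (elim x)
  let ?a = "\<lambda>n. birkhoff_sum T g n x / n"
  have "(\<lambda>n. ?a (Suc n) * (real (Suc n) / real n) - ?a n) \<longlonglongrightarrow> (\<integral>x. g x \<partial>M) * 1 - (\<integral>x. g x \<partial>M)"
    by (intro tendsto_intros LIMSEQ_Suc elim LIMSEQ_Suc_n_over_n)
  moreover have "eventually (\<lambda>n. ?a (Suc n) * (real (Suc n) / real n) - ?a n = g ((T ^^ n) x) / n) sequentially"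
    using eventually_gt_at_top[of 0]
  proof eventually_elim
    case (elim n)
    have "?a (Suc n) * (real (Suc n) / real n) = birkhoff_sum T g (Suc n) x / n"
      using elim by (simp del: of_nat_Suc)
    then show ?case by (simp add: birkhoff_sum_Suc add_divide_distrib)
  qed
  ultimately show ?case
    using Lim_transform_eventually by fastforce
qed

lemma AE_sqrt_orbit_tendsto_0:
  assumes int: "integrable M (\<lambda>x. (v x)\<^sup>2)"
  shows "AE x in M. (\<lambda>n. v ((T ^^ n) x) / sqrt n) \<longlonglongrightarrow> 0"
  using AE_orbit_div_tendsto_0[OF int]
proof eventually_elim
  case (elim x)
  have "(\<lambda>n. sqrt ((v ((T ^^ n) x))\<^sup>2 / n)) \<longlonglongrightarrow> sqrt 0"
    by (intro tendsto_intros elim)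
  then have "(\<lambda>n. \<bar>v ((T ^^ n) x) / sqrt n\<bar>) \<longlonglongrightarrow> 0"
    by (simp add: real_sqrt_divide)
  then show ?case by (rule tendsto_rabs_zero_cancel)
qed

end

section \<open>Logarithmic averages of weakly correlated variables\<close>

lemma integrable_mult_of_squares:
  fixes f g :: "'a \<Rightarrow> 'b::{real_normed_algebra, banach, second_countable_topology}"
  assumes [measurable]: "f \<in> borel_measurable M" "g \<in> borel_measurable M"
    and "integrable M (\<lambda>x. (norm (f x))\<^sup>2)" "integrable M (\<lambda>x. (norm (g x))\<^sup>2)"
  shows "integrable M (\<lambda>x. f x * g x)"
proof (rule Bochner_Integration.integrable_bound)
  show "integrable M (\<lambda>x. (norm (f x))\<^sup>2 + (norm (g x))\<^sup>2)" using assms by auto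
  have "norm (f x * g x) \<le> (norm (f x))\<^sup>2 + (norm (g x))\<^sup>2" for x
  proof -
    have "norm (f x * g x) \<le> norm (f x) * norm (g x)" by (rule norm_mult_ineq)
    also have "\<dots> \<le> (norm (f x))\<^sup>2 + (norm (g x))\<^sup>2"
      using sum_squares_bound[of "norm (f x)" "norm (g x)"]
        mult_nonneg_nonneg[OF norm_ge_zero[of "f x"] norm_ge_zero[of "g x"]] by linarith
    finally show ?thesis .
  qed
  then show "AE x in M. norm (f x * g x) \<le> norm ((norm (f x))\<^sup>2 + (norm (g x))\<^sup>2)" by auto
qed measurable

lemma norm_integral_le:
  fixes f :: "'a \<Rightarrow> 'b::{banach, second_countable_topology}"
  assumes "integrable M f" "integrable M g" "\<And>x. x \<in> space M \<Longrightarrow> norm (f x) \<le> g x"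
  shows "norm (\<integral>x. f x \<partial>M) \<le> (\<integral>x. g x \<partial>M)"
  using integral_mono[OF integrable_norm[OF assms(1)] assms(2,3)]
  by (rule order_trans[OF integral_norm_bound])

lemma integrable_square_add:
  fixes f g :: "'a \<Rightarrow> 'b::{real_normed_vector, second_countable_topology}"
  assumes [measurable]: "f \<in> borel_measurable M" "g \<in> borel_measurable M"
    and "integrable M (\<lambda>x. (norm (f x))\<^sup>2)" "integrable M (\<lambda>x. (norm (g x))\<^sup>2)"
  shows "integrable M (\<lambda>x. (norm (f x + g x))\<^sup>2)"
proof (rule Bochner_Integration.integrable_bound)
  show "integrable M (\<lambda>x. 2 * (norm (f x))\<^sup>2 + 2 * (norm (g x))\<^sup>2)" using assms by auto
  have "(norm (f x + g x))\<^sup>2 \<le> 2 * (norm (f x))\<^sup>2 + 2 * (norm (g x))\<^sup>2" for x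
  proof -
    have "(norm (f x + g x))\<^sup>2 \<le> (norm (f x) + norm (g x))\<^sup>2"
      by (intro power_mono norm_triangle_ineq) auto
    also have "\<dots> \<le> 2 * (norm (f x))\<^sup>2 + 2 * (norm (g x))\<^sup>2"
      using sum_squares_bound[of "norm (f x)" "norm (g x)"] by (simp add: power2_sum)
    finally show ?thesis .
  qed
  then show "AE x in M. norm ((norm (f x + g x))\<^sup>2) \<le> norm (2 * (norm (f x))\<^sup>2 + 2 * (norm (g x))\<^sup>2)" by auto
qed measurable

lemma integrable_square_sum:
  fixes f :: "'i \<Rightarrow> 'a \<Rightarrow> 'b::{real_normed_vector, second_countable_topology}"
  assumes "\<And>i. i \<in> I \<Longrightarrow> f i \<in> borel_measurable M" "\<And>i. i \<in> I \<Longrightarrow> integrable M (\<lambda>x. (norm (f i x))\<^sup>2)"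
  shows "integrable M (\<lambda>x. (norm (\<Sum>i\<in>I. f i x))\<^sup>2)"
  using assms
proof (induction I rule: infinite_finite_induct)
  case (insert i I)
  have "integrable M (\<lambda>x. (norm (f i x + (\<Sum>i\<in>I. f i x)))\<^sup>2)"
    by (rule integrable_square_add) (use insert in auto)
  then show ?case using insert by simp
qed auto

lemma L2_norm_nonneg: "0 \<le> L2_norm M g"
  by (simp add: L2_norm_def integral_nonneg_AE)

lemma L2_norm_square: "(L2_norm M g)\<^sup>2 = (\<integral>x. (g x)\<^sup>2 \<partial>M)"
  by (simp add: L2_norm_def integral_nonneg_AE)

lemma sum_inverse_sqrt_le: "(\<Sum>k=1..n. 1 / sqrt (real k)) \<le> 2 * sqrt (real n)"
proof (induction n)
  case (Suc n)
  have "1 / sqrt (Suc n) \<le> 2 * sqrt (Suc n) - 2 * sqrt n"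
  proof -
    have "(sqrt (Suc n) - sqrt n) * (sqrt (Suc n) + sqrt n) = 1"
      by (simp add: algebra_simps)
    moreover have "sqrt (Suc n) + sqrt n \<le> 2 * sqrt (Suc n)" by simp
    moreover have "sqrt (Suc n) - sqrt n \<ge> 0" by simp
    ultimately have "1 \<le> (sqrt (Suc n) - sqrt n) * (2 * sqrt (Suc n))"
      by (metis mult_left_mono)
    then show ?thesis by (simp add: field_simps)
  qed
  then show ?case using Suc by simp
qed simp

lemma borel_measurable_cnj [measurable (raw)]:
  "f \<in> borel_measurable M \<Longrightarrow> (\<lambda>x. cnj (f x)) \<in> borel_measurable M"
  by (rule borel_measurable_continuous_on[OF continuous_on_cnj[OF continuous_on_id], simplified])

lemma harm_le: "n \<ge> 1 \<Longrightarrow> harm n \<le> ln (real n) + 1"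
  using euler_mascheroni_sequence_decreasing[of 1 n] by (simp add: harm_def)

lemma ln_le_harm': "n \<ge> 1 \<Longrightarrow> ln (real n) \<le> harm n"
  using euler_mascheroni_sequence_nonneg[of n] by simp

context prob_space
begin

lemma integrable_of_square:
  fixes f :: "'a \<Rightarrow> 'b::{banach, second_countable_topology}"
  assumes [measurable]: "f \<in> borel_measurable M" and "integrable M (\<lambda>x. (norm (f x))\<^sup>2)"
  shows "integrable M f"
proof (rule Bochner_Integration.integrable_bound)
  show "integrable M (\<lambda>x. 1 + (norm (f x))\<^sup>2)" using assms by auto
  have "norm (f x) \<le> 1 + (norm (f x))\<^sup>2" for x
    using sum_squares_bound[of 1 "norm (f x)"] by (simp, smt (verit) norm_ge_zero)
  then show "AE x in M. norm (f x) \<le> norm (1 + (norm (f x))\<^sup>2)" by auto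
qed measurable

lemma integral_abs_le_L2_norm:
  assumes [measurable]: "g \<in> borel_measurable M" and sq: "integrable M (\<lambda>x. (g x)\<^sup>2)"
  shows "(\<integral>x. \<bar>g x\<bar> \<partial>M) \<le> L2_norm M g"
proof (rule power2_le_imp_le)
  let ?A = "\<integral>x. \<bar>g x\<bar> \<partial>M"
  have i: "integrable M (\<lambda>x. \<bar>g x\<bar>)"
    using integrable_of_square[of g] sq by auto
  have "0 \<le> (\<integral>x. (\<bar>g x\<bar> - ?A)\<^sup>2 \<partial>M)" by (intro integral_nonneg_AE) auto
  also have "\<dots> = (\<integral>x. (g x)\<^sup>2 + (?A\<^sup>2 - 2 * ?A * \<bar>g x\<bar>) \<partial>M)"
    by (intro Bochner_Integration.integral_cong) (auto simp: power2_diff)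
  also have "\<dots> = (\<integral>x. (g x)\<^sup>2 \<partial>M) + (?A\<^sup>2 - 2 * ?A * ?A)"
    using i sq by (simp add: prob_space)
  finally show "?A\<^sup>2 \<le> (L2_norm M g)\<^sup>2" unfolding L2_norm_square unfolding power2_eq_square by simp
qed (rule L2_norm_nonneg)

text \<open>Adding term \<open>n\<close> costs at most \<open>2 / n * (2 * K)\<close> in cross
  terms, because the factor \<open>1 / sqrt n\<close> of the covariance cancels the growth of the
  sum of \<open>1 / sqrt k\<close>, and at most \<open>K / n\<close> on the diagonal. Hence the
  constant 5 and a merely logarithmic growth.\<close>

lemma second_moment_harmonic_sum:
  fixes D :: "nat \<Rightarrow> 'a \<Rightarrow> complex"
  assumes [measurable]: "\<And>k. D k \<in> borel_measurable M"
    and sq: "\<And>k. integrable M (\<lambda>x. (norm (D k x))\<^sup>2)"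
    and cov: "\<And>k l. 1 \<le> k \<Longrightarrow> k \<le> l \<Longrightarrow> norm (\<integral>x. D k x * cnj (D l x) \<partial>M) \<le> K * sqrt (k / l)"
  shows "(\<integral>x. (norm (\<Sum>k=1..N. D k x / of_nat k))\<^sup>2 \<partial>M) \<le> 5 * K * harm N"
proof (induction N)
  case 0
  then show ?case by (simp add: harm_def)
next
  case (Suc N)
  define V where "V x = (\<Sum>k=1..N. D k x / of_nat k)" for x
  define n where "n = Suc N"
  have n: "n \<ge> 1" "real n > 0" by (auto simp: n_def)
  have K: "K \<ge> 0" using order_trans[OF norm_ge_zero cov[of 1 1]] by simp
  have [measurable]: "V \<in> borel_measurable M" unfolding V_def by measurable
  have iDD: "integrable M (\<lambda>x. D k x * cnj (D n x))" for k
    by (rule integrable_mult_of_squares) (use sq in auto)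
  have V_D: "V x * cnj (D n x) = (\<Sum>k=1..N. D k x * cnj (D n x) / of_nat k)" for x
    by (simp add: V_def sum_distrib_right)
  have iVD: "integrable M (\<lambda>x. V x * cnj (D n x))"
    unfolding V_D using iDD by (intro Bochner_Integration.integrable_sum integrable_divide) auto
  have iV: "integrable M (\<lambda>x. (norm (V x))\<^sup>2)"
    unfolding V_def using sq by (intro integrable_square_sum) (auto simp: norm_divide power_divide)
  have cross: "norm (\<integral>x. V x * cnj (D n x) \<partial>M) \<le> 2 * K"
  proof -
    have "(\<integral>x. V x * cnj (D n x) \<partial>M) = (\<Sum>k=1..N. (\<integral>x. D k x * cnj (D n x) \<partial>M) / of_nat k)"
      unfolding V_D using iDD by (subst Bochner_Integration.integral_sum) auto
    also have "norm \<dots> \<le> (\<Sum>k=1..N. K / sqrt n * (1 / sqrt k))"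
    proof (intro sum_norm_le)
      fix k assume k: "k \<in> {1..N}"
      have "norm ((\<integral>x. D k x * cnj (D n x) \<partial>M) / of_nat k) \<le> K * sqrt (k / n) / k"
        using cov[of k n] k by (auto simp: norm_divide n_def intro!: divide_right_mono)
      also have "\<dots> = K / sqrt n * (sqrt k / k)"
        by (simp add: real_sqrt_divide)
      also have "sqrt k / k = 1 / sqrt k"
        by (simp add: sqrt_divide_self_eq inverse_eq_divide)
      finally show "norm ((\<integral>x. D k x * cnj (D n x) \<partial>M) / of_nat k) \<le> K / sqrt n * (1 / sqrt k)" .
    qed
    also have "\<dots> = K / sqrt n * (\<Sum>k=1..N. 1 / sqrt k)" by (simp add: sum_distrib_left)
    also have "\<dots> \<le> K / sqrt n * (2 * sqrt N)"
      using K by (intro mult_left_mono sum_inverse_sqrt_le) auto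
    also have "\<dots> = 2 * K * (sqrt N / sqrt n)" by simp
    also have "\<dots> \<le> 2 * K * 1"
      using K n by (intro mult_left_mono) (auto simp: n_def)
    finally show ?thesis by simp
  qed
  have sq_expand: "(norm (V x + D n x / of_nat n))\<^sup>2 =
      (norm (V x))\<^sup>2 + 2 / n * Re (V x * cnj (D n x)) + (norm (D n x))\<^sup>2 / n\<^sup>2" for x
  proof -
    have "Re (V x * cnj (D n x / of_nat n)) = Re (V x * cnj (D n x)) / n"
      by (simp add: Re_divide_of_nat add_divide_distrib)
    moreover have "(norm (z + w))\<^sup>2 = (norm z)\<^sup>2 + 2 * Re (z * cnj w) + (norm w)\<^sup>2" for z w
      by (simp add: cmod_power2 power2_sum)
    ultimately show ?thesis
      by (simp add: norm_divide power_divide add_divide_distrib)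
  qed
  have DD: "(\<integral>x. (norm (D n x))\<^sup>2 \<partial>M) \<le> K"
  proof -
    have "(\<integral>x. D n x * cnj (D n x) \<partial>M) = of_real (\<integral>x. (norm (D n x))\<^sup>2 \<partial>M)"
      by (simp only: complex_norm_square[symmetric] integral_complex_of_real)
    then have "\<bar>\<integral>x. (norm (D n x))\<^sup>2 \<partial>M\<bar> \<le> K"
      using cov[of n n] n by simp
    then show ?thesis by linarith
  qed
  have "(\<integral>x. (norm (\<Sum>k=1..Suc N. D k x / of_nat k))\<^sup>2 \<partial>M) = (\<integral>x. (norm (V x + D n x / of_nat n))\<^sup>2 \<partial>M)"
    by (simp add: V_def n_def)
  also have "\<dots> = (\<integral>x. (norm (V x))\<^sup>2 \<partial>M) + 2 / n * (\<integral>x. Re (V x * cnj (D n x)) \<partial>M)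
      + (\<integral>x. (norm (D n x))\<^sup>2 \<partial>M) / n\<^sup>2"
    unfolding sq_expand using iV iVD sq by (simp del: times_complex.simps)
  also have "(\<integral>x. Re (V x * cnj (D n x)) \<partial>M) = Re (\<integral>x. V x * cnj (D n x) \<partial>M)"
    using iVD by (rule Bochner_Integration.integral_Re)
  also have "(\<integral>x. (norm (V x))\<^sup>2 \<partial>M) + 2 / n * Re (\<integral>x. V x * cnj (D n x) \<partial>M)
      + (\<integral>x. (norm (D n x))\<^sup>2 \<partial>M) / n\<^sup>2 \<le> 5 * K * harm N + 2 / n * (2 * K) + K / n"
  proof (intro add_mono mult_left_mono)
    show "(\<integral>x. (norm (V x))\<^sup>2 \<partial>M) \<le> 5 * K * harm N" using Suc by (simp add: V_def)
    show "Re (\<integral>x. V x * cnj (D n x) \<partial>M) \<le> 2 * K"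
      using cross complex_Re_le_cmod order_trans by blast
    have "(\<integral>x. (norm (D n x))\<^sup>2 \<partial>M) / n\<^sup>2 \<le> K / n\<^sup>2"
      using DD by (intro divide_right_mono) auto
    also have "\<dots> \<le> K / n"
      using K n by (intro divide_left_mono) (auto simp: power2_eq_square)
    finally show "(\<integral>x. (norm (D n x))\<^sup>2 \<partial>M) / n\<^sup>2 \<le> K / n" .
  qed auto
  also have "\<dots> = 5 * K * harm (Suc N)"
    unfolding harm_Suc unfolding n_def[symmetric] using n by (simp add: field_simps)
  finally show ?case .
qed

text \<open>Gal--Koksma type argument: the second moment bound gives convergence along
  \<open>N = 2 ^ j\<^sup>2\<close>, and boundedness fills the gaps.\<close>

lemma AE_log_average_tendsto_0:
  fixes D :: "nat \<Rightarrow> 'a \<Rightarrow> complex"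
  assumes [measurable]: "\<And>k. D k \<in> borel_measurable M"
    and sq: "\<And>k. integrable M (\<lambda>x. (norm (D k x))\<^sup>2)"
    and cov: "\<And>k l. 1 \<le> k \<Longrightarrow> k \<le> l \<Longrightarrow> norm (\<integral>x. D k x * cnj (D l x) \<partial>M) \<le> K * sqrt (k / l)"
    and bdd: "AE x in M. Bseq (\<lambda>k. D k x)"
  shows "AE x in M. (\<lambda>N. (\<Sum>k=1..N. D k x / of_nat k) / of_real (ln N)) \<longlonglongrightarrow> 0"
proof -
  define V where "V N x = (\<Sum>k=1..N. D k x / of_nat k)" for N x
  have [measurable]: "V N \<in> borel_measurable M" for N unfolding V_def by measurable
  have iV: "integrable M (\<lambda>x. (norm (V N x))\<^sup>2)" for N
    unfolding V_def using sq by (intro integrable_square_sum) (auto simp: norm_divide power_divide)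
  have K: "K \<ge> 0" using order_trans[OF norm_ge_zero cov[of 1 1]] by simp
  \<comment> \<open>Sparse enough for the normalised variances, of order \<open>1 / ln (p j)\<close>
    and so of order 1 / j^2, to be summable; dense enough for
    \<open>ln (p (Suc j)) / ln (p j)\<close> to tend to 1.\<close>
  define p :: "nat \<Rightarrow> nat" where "p j = 2 ^ (j\<^sup>2)" for j
  have ln_p: "ln (p j) = j\<^sup>2 * ln 2" for j
    by (simp add: p_def ln_realpow)
  have p_ge: "1 \<le> p j" for j by (simp add: p_def)
  have "summable (\<lambda>j. \<integral>x. (norm (V (p j) x))\<^sup>2 / (ln (p j))\<^sup>2 \<partial>M)"
  proof (rule summable_comparison_test')
    show "summable (\<lambda>j. 10 * K / ln 2 * (1 / real j ^ 2))"
      using inverse_power_summable[of 2, where 'a=real] by (intro summable_mult) (simp add: inverse_eq_divide)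
    \<comment> \<open>From \<open>j = 2\<close> on, \<open>ln (p j)\<close> is at least 1, so that
      \<open>harm (p j)\<close> is at most \<open>2 * ln (p j)\<close>.\<close>
    fix j :: nat assume j: "j \<ge> 2"
    let ?L = "ln (p j)"
    have "ln 2 > 1 / (2::real)" using ln2_ge_two_thirds by simp
    moreover have "4 \<le> (real j)\<^sup>2" using power_mono[of 2 "real j" 2] j by simp
    ultimately have L: "?L \<ge> 1" unfolding ln_p
      using mult_mono[of 4 "(real j)\<^sup>2" "1/2" "ln 2 :: real"] by simp
    have "(\<integral>x. (norm (V (p j) x))\<^sup>2 / ?L\<^sup>2 \<partial>M) \<le> 5 * K * harm (p j) / ?L\<^sup>2"
      using second_moment_harmonic_sum[of D K "p j"] assms(1) sq cov
      by (auto simp: V_def intro!: divide_right_mono)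
    also have "\<dots> \<le> 5 * K * (2 * ?L) / ?L\<^sup>2"
      using harm_le[of "p j"] p_ge[of j] K L by (intro divide_right_mono mult_left_mono) auto
    also have "\<dots> = 10 * K / ln 2 * (1 / real j ^ 2)"
      using L by (simp add: power2_eq_square ln_p)
    finally show "norm (\<integral>x. (norm (V (p j) x))\<^sup>2 / ?L\<^sup>2 \<partial>M) \<le> 10 * K / ln 2 * (1 / real j ^ 2)"
      by (simp add: integral_nonneg_AE)
  qed
  then have "AE x in M. summable (\<lambda>j. norm ((norm (V (p j) x))\<^sup>2 / (ln (p j))\<^sup>2))"
    by (intro AE_summable_of_integral_norm) (auto intro!: iV)
  with bdd show ?thesis
  proof eventually_elim
    case (elim x)
    obtain B where B: "B > 0" "\<And>k. norm (D k x) \<le> B"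
      using elim(1) by (auto simp: Bseq_def)
    have "(\<lambda>j. sqrt (norm ((norm (V (p j) x))\<^sup>2 / (ln (p j))\<^sup>2))) \<longlonglongrightarrow> sqrt 0"
      by (intro tendsto_intros summable_LIMSEQ_zero elim(2))
    then have "(\<lambda>j. norm (V (p j) x) / ln (p j)) \<longlonglongrightarrow> 0"
      by (simp add: real_sqrt_divide ln_p)
    moreover have "(\<lambda>j. B * (5 * (1 / real j))) \<longlonglongrightarrow> B * (5 * 0)"
      by (intro tendsto_intros lim_1_over_n)
    ultimately have lim: "(\<lambda>j. norm (V (p j) x) / ln (p j) + B * (5 * (1 / real j))) \<longlonglongrightarrow> 0"
      using tendsto_add by fastforce
    show "(\<lambda>N. (\<Sum>k=1..N. D k x / of_nat k) / of_real (ln N)) \<longlonglongrightarrow> 0"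
    proof (rule LIMSEQ_I)
      fix e :: real assume "e > 0"
      then obtain J0 where J0: "\<And>j. j \<ge> J0 \<Longrightarrow> norm (V (p j) x) / ln (p j) + B * (5 * (1 / real j)) < e"
        using LIMSEQ_D[OF lim] by fastforce
      define J where "J = Suc J0"
      have "norm ((\<Sum>k=1..N. D k x / of_nat k) / of_real (ln N) - 0) < e" if N: "N \<ge> p J" for N
      proof -
        have "N < 2 ^ N" by (rule less_exp)
        also have "(2::nat) ^ N \<le> p N"
          unfolding p_def by (intro power_increasing) (auto simp: power2_eq_square)
        finally have "\<exists>j. \<not> p j \<le> N" by (auto simp: not_le)
        \<comment> \<open>The least index with \<open>p j'\<close> beyond \<open>N\<close>; its
          predecessor \<open>j\<close> brackets \<open>N\<close> between \<open>p j\<close> and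
          \<open>p (Suc j)\<close>.\<close>
        then obtain j' where j': "\<not> p j' \<le> N" "\<And>i. i < j' \<Longrightarrow> p i \<le> N"
          using exists_least_iff[of "\<lambda>j. \<not> p j \<le> N"] by blast
        have p_mono: "i \<le> j \<Longrightarrow> p i \<le> p j" for i j
          by (simp add: p_def power_increasing power_mono)
        have "J < j'" using j'(1) N p_mono[of j' J] by (meson linorder_not_le order_trans)
        then obtain j where j: "j' = Suc j" "J \<le> j" by (cases j') auto
        have j1: "j \<ge> 1" "real j \<ge> 1" using j by (auto simp: J_def)
        have pN: "p j \<le> N" "N \<le> p (Suc j)" using j' j by auto
        have lnp: "0 < ln (p j)" unfolding ln_p using j1 by auto
        have lnN: "ln (p j) \<le> ln N" using pN p_ge[of j] by simp
        have "V N x = V (p j) x + (\<Sum>k=Suc (p j)..N. D k x / of_nat k)"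
          unfolding V_def using sum.ub_add_nat[of 1 "p j" "\<lambda>k. D k x / of_nat k" "N - p j"] pN by simp
        then have "norm (V N x) \<le> norm (V (p j) x) + (\<Sum>k=Suc (p j)..N. norm (D k x / of_nat k))"
          by (auto intro!: norm_triangle_le norm_sum)
        also have "(\<Sum>k=Suc (p j)..N. norm (D k x / of_nat k)) \<le> (\<Sum>k=Suc (p j)..p (Suc j). B / k)"
          using pN B by (intro order_trans[OF sum_mono sum_mono2]) (auto simp: norm_divide intro!: divide_right_mono)
        also have "\<dots> = B * (harm (p (Suc j)) - harm (p j))"
        proof -
          have "harm (p (Suc j)) = harm (p j) + (\<Sum>k=Suc (p j)..p (Suc j). inverse (real k))"
            unfolding harm_def using sum.ub_add_nat[of 1 "p j" "\<lambda>k. inverse (real k)" "p (Suc j) - p j"]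
              p_mono[of j "Suc j"] by simp
          then show ?thesis by (simp add: sum_distrib_left divide_inverse)
        qed
        also have "\<dots> \<le> B * (ln (p (Suc j)) + 1 - ln (p j))"
          using B harm_le[of "p (Suc j)"] ln_le_harm'[OF p_ge[of j]] p_ge[of "Suc j"]
          by (intro mult_left_mono) auto
        also have "ln (p (Suc j)) + 1 - ln (p j) = (2 * real j + 1) * ln 2 + 1"
          by (simp add: ln_p power2_eq_square algebra_simps)
        \<comment> \<open>Here 1 is at most \<open>2 * ln 2\<close>, and the resulting three copies
          of \<open>ln 2\<close> are absorbed by \<open>j \<ge> 1\<close>. Divided by
          \<open>ln (p j)\<close>, which is quadratic in \<open>j\<close>, the gap is of order 1 /
          j.\<close>
        also have "\<dots> \<le> (5 * real j) * ln 2"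
        proof -
          have "1 \<le> 2 * (ln 2 :: real)" using ln2_ge_two_thirds by simp
          moreover have "ln 2 \<le> real j * ln 2" using j1 by simp
          ultimately show ?thesis by (simp only: distrib_right mult.assoc mult_1)
        qed
        finally have "norm (V N x) \<le> norm (V (p j) x) + B * (5 * real j * ln 2)"
          using B by simp
        then have "norm (V N x) / ln N \<le> (norm (V (p j) x) + B * (5 * real j * ln 2)) / ln (p j)"
          using lnp lnN B by (intro frac_le) auto
        also have "\<dots> = norm (V (p j) x) / ln (p j) + B * (5 * (1 / real j))"
          using j1 by (simp add: ln_p add_divide_distrib power2_eq_square)
        also have "\<dots> < e" using J0[of j] j by (auto simp: J_def)
        finally show ?thesis using lnp lnN by (simp add: norm_divide V_def)
      qed
      then show "\<exists>no. \<forall>n\<ge>no. norm ((\<Sum>k=1..n. D k x / of_nat k) / of_real (ln n) - 0) < e" by blast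
    qed
  qed
qed

end

section \<open>Stopped McLeish products of reverse martingale differences\<close>

text \<open>The product is built from the far end of the orbit. The indicator sees the squares at
  \<open>T x\<close>, ..., \<open>(T ^^ n) x\<close> only, so it is a function of
  \<open>T x\<close>; as these squares accumulate towards \<open>x\<close>, a factor once switched
  off stays off.\<close>

primrec stopped_prod :: "('a \<Rightarrow> 'a) \<Rightarrow> ('a \<Rightarrow> real) \<Rightarrow> real \<Rightarrow> real \<Rightarrow> nat \<Rightarrow> 'a \<Rightarrow> complex" where
  "stopped_prod T m s c 0 x = 1"
| "stopped_prod T m s c (Suc n) x =
     (1 + \<i> * of_real (s * m x * of_bool (birkhoff_sum T (\<lambda>y. (m y)\<^sup>2) n (T x) \<le> c))) *
     stopped_prod T m s c n (T x)"

lemma norm_one_plus_i_square: "(norm (1 + \<i> * of_real y))\<^sup>2 = 1 + y\<^sup>2"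
  by (simp add: cmod_power2)

lemma birkhoff_sum_nonneg: "(\<And>x. f x \<ge> 0) \<Longrightarrow> birkhoff_sum T f n x \<ge> 0"
  by (simp add: birkhoff_sum_def sum_nonneg)

lemma norm_stopped_prod_square_le:
  "(norm (stopped_prod T m s c n x))\<^sup>2 \<le> exp (s\<^sup>2 * birkhoff_sum T (\<lambda>y. (m y)\<^sup>2) n x)"
proof (induction n arbitrary: x)
  case (Suc n)
  let ?Q = "birkhoff_sum T (\<lambda>y. (m y)\<^sup>2)"
  let ?b = "of_bool (?Q n (T x) \<le> c) :: real"
  have "(norm (stopped_prod T m s c (Suc n) x))\<^sup>2 =
      (1 + (s * m x * ?b)\<^sup>2) * (norm (stopped_prod T m s c n (T x)))\<^sup>2"
    by (simp only: stopped_prod.simps norm_mult power_mult_distrib norm_one_plus_i_square)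
  also have "\<dots> \<le> exp (s\<^sup>2 * (m x)\<^sup>2) * exp (s\<^sup>2 * ?Q n (T x))"
  proof (intro mult_mono Suc)
    have "1 + (s * m x * ?b)\<^sup>2 \<le> 1 + s\<^sup>2 * (m x)\<^sup>2"
      by (auto simp: power_mult_distrib)
    also have "\<dots> \<le> exp (s\<^sup>2 * (m x)\<^sup>2)" by (rule exp_ge_add_one_self)
    finally show "1 + (s * m x * ?b)\<^sup>2 \<le> exp (s\<^sup>2 * (m x)\<^sup>2)" .
  qed auto
  also have "\<dots> = exp (s\<^sup>2 * ?Q (Suc n) x)"
    by (simp add: birkhoff_sum_Suc' distrib_left exp_add)
  finally show ?case .
qed simp

text \<open>In the recursion the new term carries the indicator of exactly this hypothesis, so the
  product is uniformly bounded wherever it meets \<open>m x\<close>.\<close>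

lemma norm_stopped_prod_le:
  assumes "birkhoff_sum T (\<lambda>y. (m y)\<^sup>2) n x \<le> c"
  shows "norm (stopped_prod T m s c n x) \<le> exp (s\<^sup>2 * c / 2)"
proof (rule power2_le_imp_le)
  have "(norm (stopped_prod T m s c n x))\<^sup>2 \<le> exp (s\<^sup>2 * c)"
    using norm_stopped_prod_square_le[of T m s c n x] assms
    by (elim order_trans) (auto intro!: mult_left_mono)
  then show "(norm (stopped_prod T m s c n x))\<^sup>2 \<le> (exp (s\<^sup>2 * c / 2))\<^sup>2"
    by (simp add: exp_double[symmetric])
qed simp

text \<open>The factor that exceeds the threshold \<open>c\<close> enters the product, so that the bound is not uniform.\<close>

lemma norm_stopped_prod_square_le':
  assumes "c \<ge> 0"
  shows "(norm (stopped_prod T m s c n x))\<^sup>2 \<le> exp (s\<^sup>2 * c) * (1 + s\<^sup>2 * birkhoff_sum T (\<lambda>y. (m y)\<^sup>2) n x)"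
proof (induction n arbitrary: x)
  case 0
  show ?case using assms by simp
next
  case (Suc n)
  let ?Q = "birkhoff_sum T (\<lambda>y. (m y)\<^sup>2)"
  have Q: "?Q n (T x) \<ge> 0" by (intro birkhoff_sum_nonneg) auto
  show ?case
  proof (cases "?Q n (T x) \<le> c")
    case True
    then have "(norm (stopped_prod T m s c (Suc n) x))\<^sup>2 =
        (1 + (s * m x)\<^sup>2) * (norm (stopped_prod T m s c n (T x)))\<^sup>2"
      by (simp only: stopped_prod.simps norm_mult power_mult_distrib norm_one_plus_i_square) simp
    also have "\<dots> \<le> (1 + (s * m x)\<^sup>2) * (exp (s\<^sup>2 * c / 2))\<^sup>2"
      using norm_stopped_prod_le[OF True, of s] by (intro mult_left_mono power_mono) auto
    also have "\<dots> \<le> exp (s\<^sup>2 * c) * (1 + s\<^sup>2 * ?Q (Suc n) x)"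
    proof -
      have "0 \<le> exp (s\<^sup>2 * c) * (s\<^sup>2 * ?Q n (T x))" using Q by simp
      then show ?thesis
        by (simp add: exp_double[symmetric] birkhoff_sum_Suc' power_mult_distrib algebra_simps)
    qed
    finally show ?thesis .
  next
    case False
    then have "(norm (stopped_prod T m s c (Suc n) x))\<^sup>2 = (norm (stopped_prod T m s c n (T x)))\<^sup>2"
      by simp
    also have "\<dots> \<le> exp (s\<^sup>2 * c) * (1 + s\<^sup>2 * ?Q n (T x))" by (rule Suc)
    also have "\<dots> \<le> exp (s\<^sup>2 * c) * (1 + s\<^sup>2 * ?Q (Suc n) x)"
      by (auto simp: birkhoff_sum_Suc' intro!: mult_left_mono)
    finally show ?thesis .
  qed
qed

text \<open>Every threshold test involves only some of the nonnegative terms of the full sum, so all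
  indicators equal 1.\<close>

lemma stopped_prod_eq_prod:
  assumes "birkhoff_sum T (\<lambda>y. (m y)\<^sup>2) n x \<le> c"
  shows "stopped_prod T m s c n x = (\<Prod>k<n. 1 + \<i> * of_real (s * m ((T ^^ k) x)))"
  using assms
proof (induction n arbitrary: x)
  case (Suc n)
  have "birkhoff_sum T (\<lambda>y. (m y)\<^sup>2) n (T x) \<le> c"
    using Suc.prems by (simp add: birkhoff_sum_Suc') (smt (verit) zero_le_power2)
  with Suc.IH[OF this] show ?case
    by (simp add: prod.lessThan_Suc_shift funpow_swap1 del: prod.lessThan_Suc)
qed simp

text \<open>The orthogonality encodes E(m | T^-1 G) = 0 through bounded test functions. With
  \<open>T\<close> measurable from \<open>G\<close> to \<open>G\<close>, the functions m o T^k form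
  reverse martingale differences for the decreasing family T^-k G.\<close>

locale reverse_martingale_difference = ergodic_system M T for M :: "'a measure" and T +
  fixes G :: "'a measure" and m :: "'a \<Rightarrow> real"
  assumes subalg_G: "subalgebra M G" and T_G [measurable]: "T \<in> measurable G G"
    and m_G [measurable]: "m \<in> borel_measurable G" and m_sq: "integrable M (\<lambda>x. (m x)\<^sup>2)"
    and orth: "\<And>\<phi> :: 'a \<Rightarrow> real. \<phi> \<in> borel_measurable G \<Longrightarrow> bounded (range \<phi>) \<Longrightarrow>
      (\<integral>x. m x * \<phi> (T x) \<partial>M) = 0"
begin

lemma G_imp_M: "h \<in> measurable G N \<Longrightarrow> h \<in> measurable M N"
  using measurable_from_subalg[OF subalg_G] .

lemma m_M [measurable]: "m \<in> borel_measurable M"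
  by (rule G_imp_M) measurable

abbreviation Q :: "nat \<Rightarrow> 'a \<Rightarrow> real" where "Q \<equiv> birkhoff_sum T (\<lambda>y. (m y)\<^sup>2)"
abbreviation P :: "real \<Rightarrow> real \<Rightarrow> nat \<Rightarrow> 'a \<Rightarrow> complex" where "P \<equiv> stopped_prod T m"
abbreviation \<sigma>2 :: real where "\<sigma>2 \<equiv> \<integral>x. (m x)\<^sup>2 \<partial>M"

lemma T_pow_G [measurable]: "T ^^ n \<in> measurable G G"
  using measurable_compose_n[OF T_G] .

lemma Q_G [measurable]: "Q n \<in> borel_measurable G"
  unfolding birkhoff_sum_def by measurable

lemma P_G [measurable]: "P s c n \<in> borel_measurable G"
proof (induction n)
  case (Suc n)
  note [measurable] = Suc
  show ?case unfolding stopped_prod.simps by measurable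
qed (simp add: stopped_prod.simps(1)[abs_def])

lemma P_M [measurable]: "P s c n \<in> borel_measurable M"
  by (rule G_imp_M) measurable

lemma P_sq: "c \<ge> 0 \<Longrightarrow> integrable M (\<lambda>x. (norm (P s c n x))\<^sup>2)"
  by (rule Bochner_Integration.integrable_bound[of _ "\<lambda>x. exp (s\<^sup>2 * c) * (1 + s\<^sup>2 * Q n x)"])
     (auto intro!: AE_I2 integrable_birkhoff_sum m_sq order_trans[OF norm_stopped_prod_square_le'])

text \<open>Truncations of \<open>\<phi>\<close> are admissible test functions, and the untruncated
  product dominates. The extension is needed because stopped products and stopped sums are
  unbounded.\<close>

lemma orth_real:
  fixes \<phi> :: "'a \<Rightarrow> real"
  assumes [measurable]: "\<phi> \<in> borel_measurable G" and int: "integrable M (\<lambda>x. m x * \<phi> (T x))"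
  shows "(\<integral>x. m x * \<phi> (T x) \<partial>M) = 0"
proof (rule LIMSEQ_unique)
  define \<psi> where "\<psi> n y = \<phi> y * of_bool (\<bar>\<phi> y\<bar> \<le> real n)" for n :: nat and y
  have [measurable]: "\<psi> n \<in> borel_measurable G" for n unfolding \<psi>_def by measurable
  have [measurable]: "\<psi> n \<in> borel_measurable M" "\<phi> \<in> borel_measurable M" for n
    by (auto intro: G_imp_M)
  have "bounded (range (\<psi> n))" for n
    by (rule boundedI[of _ n]) (auto simp: \<psi>_def)
  then have "(\<integral>x. m x * \<psi> n (T x) \<partial>M) = 0" for n by (intro orth) auto
  then show "(\<lambda>n. \<integral>x. m x * \<psi> n (T x) \<partial>M) \<longlonglongrightarrow> 0" by simp
  show "(\<lambda>n. \<integral>x. m x * \<psi> n (T x) \<partial>M) \<longlonglongrightarrow> (\<integral>x. m x * \<phi> (T x) \<partial>M)"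
  proof (rule integral_dominated_convergence[of _ _ _ "\<lambda>x. \<bar>m x * \<phi> (T x)\<bar>"])
    show "AE x in M. (\<lambda>n. m x * \<psi> n (T x)) \<longlonglongrightarrow> m x * \<phi> (T x)"
    proof (rule AE_I2)
      fix x
      obtain N :: nat where "\<bar>\<phi> (T x)\<bar> \<le> N" using real_arch_simple by blast
      then have "m x * \<psi> n (T x) = m x * \<phi> (T x)" if "n \<ge> N" for n
        using that by (simp add: \<psi>_def)
      then show "(\<lambda>n. m x * \<psi> n (T x)) \<longlonglongrightarrow> m x * \<phi> (T x)"
        by (intro tendsto_eventually) (auto simp: eventually_sequentially)
    qed
  qed (use int in \<open>auto simp: \<psi>_def\<close>)
qed

lemma orth_complex:
  fixes \<phi> :: "'a \<Rightarrow> complex"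
  assumes [measurable]: "\<phi> \<in> borel_measurable G" and int: "integrable M (\<lambda>x. of_real (m x) * \<phi> (T x))"
  shows "(\<integral>x. of_real (m x) * \<phi> (T x) \<partial>M) = 0"
proof (rule complex_eqI)
  have "integrable M (\<lambda>x. Re (of_real (m x) * \<phi> (T x)))" "integrable M (\<lambda>x. Im (of_real (m x) * \<phi> (T x)))"
    using int by (intro integrable_Re integrable_Im; assumption)+
  then have "(\<integral>x. Re (of_real (m x) * \<phi> (T x)) \<partial>M) = 0" "(\<integral>x. Im (of_real (m x) * \<phi> (T x)) \<partial>M) = 0"
    using orth_real[of "\<lambda>x. Re (\<phi> x)"] orth_real[of "\<lambda>x. Im (\<phi> x)"] by simp_all
  then show "Re (\<integral>x. of_real (m x) * \<phi> (T x) \<partial>M) = Re 0" "Im (\<integral>x. of_real (m x) * \<phi> (T x) \<partial>M) = Im 0"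
    using int by (simp_all only: Bochner_Integration.integral_Re[symmetric] Bochner_Integration.integral_Im[symmetric] zero_complex.simps)
qed

text \<open>One step of the recursion composes with \<open>T\<close>, which keeps the integral, and
  adds \<open>m\<close> times a function of \<open>T x\<close>, which integrates to zero.\<close>

lemma integral_P:
  assumes "c \<ge> 0"
  shows "(\<integral>x. P s c n x \<partial>M) = 1"
proof (induction n)
  case 0
  show ?case by (simp add: prob_space)
next
  case (Suc n)
  define \<phi> where "\<phi> y = \<i> * of_real (s * of_bool (Q n y \<le> c)) * P s c n y" for y
  have [measurable]: "\<phi> \<in> borel_measurable G" unfolding \<phi>_def by measurable
  have [measurable]: "\<phi> \<in> borel_measurable M" by (rule G_imp_M) measurable
  have iP: "integrable M (P s c n)"
    by (rule integrable_of_square) (auto intro: P_sq assms)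
  have "integrable M (\<lambda>x. (norm (\<phi> x))\<^sup>2)"
    by (rule Bochner_Integration.integrable_bound[of _ "\<lambda>x. s\<^sup>2 * (norm (P s c n x))\<^sup>2"])
       (auto simp: \<phi>_def norm_mult power_mult_distrib intro!: P_sq assms)
  then have i\<phi>: "integrable M (\<lambda>x. of_real (m x) * \<phi> (T x))"
    using m_sq by (intro integrable_mult_of_squares) (auto intro: integrable_T)
  have "(\<integral>x. P s c (Suc n) x \<partial>M) = (\<integral>x. P s c n (T x) + of_real (m x) * \<phi> (T x) \<partial>M)"
    by (intro Bochner_Integration.integral_cong) (auto simp: \<phi>_def algebra_simps)
  also have "\<dots> = (\<integral>x. P s c n (T x) \<partial>M) + (\<integral>x. of_real (m x) * \<phi> (T x) \<partial>M)"
    by (intro Bochner_Integration.integral_add i\<phi> integrable_T iP)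
  also have "\<dots> = 1"
    using Suc by (simp add: orth_complex[OF _ i\<phi>] integral_T)
  finally show ?case .
qed

text \<open>Both products lose their factor at the same point \<open>x\<close>. The product of the
  two factors is 1 plus a linear and a quadratic term in \<open>m x\<close>: the linear one
  integrates to zero, the quadratic one has a bounded cofactor. Each of the \<open>n\<close> common
  points thus costs one constant, and after them a single product of mean 1 is left.\<close>

lemma integral_P_mult_cnj_P:
  assumes c: "c \<ge> 0" "c' \<ge> 0"
  shows "norm ((\<integral>x. P s c n x * cnj (P s' c' (n + d) x) \<partial>M) - 1)
    \<le> n * (\<bar>s * s'\<bar> * \<sigma>2 * (exp (s\<^sup>2 * c / 2) * exp (s'\<^sup>2 * c' / 2)))"
proof (induction n)
  case 0
  have "(\<integral>x. P s c 0 x * cnj (P s' c' (0 + d) x) \<partial>M) = 1"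
    using integral_P[OF c(2), of s' d] by simp
  then show ?case by simp
next
  case (Suc n)
  let ?E = "exp (s\<^sup>2 * c / 2) * exp (s'\<^sup>2 * c' / 2)"
  define W where "W y = P s c n y * cnj (P s' c' (n + d) y)" for y
  define a where "a y = s * of_bool (Q n y \<le> c)" for y
  define b where "b y = s' * of_bool (Q (n + d) y \<le> c')" for y
  have [measurable]: "W \<in> borel_measurable G" "a \<in> borel_measurable G" "b \<in> borel_measurable G"
    unfolding W_def a_def b_def by measurable
  have [measurable]: "W \<in> borel_measurable M" "a \<in> borel_measurable M" "b \<in> borel_measurable M"
    by (auto intro: G_imp_M)
  have aP: "norm (of_real (a y) * P s c n y) \<le> \<bar>s\<bar> * exp (s\<^sup>2 * c / 2)" for y
    using norm_stopped_prod_le[of T m n y c s] by (auto simp: a_def norm_mult intro!: mult_left_mono)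
  have bP: "norm (of_real (b y) * P s' c' (n + d) y) \<le> \<bar>s'\<bar> * exp (s'\<^sup>2 * c' / 2)" for y
    using norm_stopped_prod_le[of T m "n + d" y c' s'] by (auto simp: b_def norm_mult intro!: mult_left_mono)
  have bP': "norm (cnj (of_real (b y) * P s' c' (n + d) y)) \<le> \<bar>s'\<bar> * exp (s'\<^sup>2 * c' / 2)" for y
    unfolding complex_mod_cnj by (rule bP)
  have iW: "integrable M W"
    unfolding W_def using c by (intro integrable_mult_of_squares) (auto intro: P_sq)
  have m_sq': "integrable M (\<lambda>x. (norm (of_real (m x) :: complex))\<^sup>2)" using m_sq by simp
  \<comment> \<open>The indicator in \<open>a\<close> or \<open>b\<close> bounds one of the two
    products, so \<open>m\<close> times that product is square integrable and can be paired with the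
    other one.\<close>
  have bd: "integrable M (\<lambda>x. of_real (m x) * h (T x) * k (T x))"
    if [measurable]: "h \<in> borel_measurable M" "k \<in> borel_measurable M"
      and h: "\<And>y. norm (h y) \<le> B" and k: "integrable M (\<lambda>x. (norm (k x))\<^sup>2)"
    for h k :: "'a \<Rightarrow> complex" and B
  proof (rule integrable_mult_of_squares)
    show "integrable M (\<lambda>x. (norm (of_real (m x) * h (T x)))\<^sup>2)"
    proof (rule Bochner_Integration.integrable_bound[of _ "\<lambda>x. B\<^sup>2 * (m x)\<^sup>2"])
      have "(norm (of_real (m x) * h (T x)))\<^sup>2 \<le> B\<^sup>2 * (m x)\<^sup>2" for x
      proof -
        have "(norm (h (T x)))\<^sup>2 \<le> B\<^sup>2" by (intro power_mono h) auto
        then show ?thesis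
          by (simp add: norm_mult power_mult_distrib mult.commute[of "B\<^sup>2"] mult_left_mono)
      qed
      then show "AE x in M. norm ((norm (of_real (m x) * h (T x)))\<^sup>2) \<le> norm (B\<^sup>2 * (m x)\<^sup>2)" by auto
    qed (use m_sq in auto)
    show "integrable M (\<lambda>x. (norm (k (T x)))\<^sup>2)"
      using integrable_T[OF k] .
  qed auto
  have ia: "integrable M (\<lambda>x. of_real (m x) * (of_real (a (T x)) * P s c n (T x)) * cnj (P s' c' (n + d) (T x)))"
    by (rule bd[OF _ _ aP]) (auto intro: P_sq c)
  have ib: "integrable M (\<lambda>x. of_real (m x) * cnj (of_real (b (T x)) * P s' c' (n + d) (T x)) * P s c n (T x))"
    by (rule bd[OF _ _ bP']) (auto intro: P_sq c)
  \<comment> \<open>The difference \<open>a - b\<close> is split because its two halves tame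
    different factors of \<open>W\<close>.\<close>
  have i1: "integrable M (\<lambda>x. of_real (m x) * (\<i> * of_real (a (T x) - b (T x)) * W (T x)))"
  proof -
    have "integrable M (\<lambda>x. \<i> * (of_real (m x) * (of_real (a (T x)) * P s c n (T x)) * cnj (P s' c' (n + d) (T x)))
      - \<i> * (of_real (m x) * cnj (of_real (b (T x)) * P s' c' (n + d) (T x)) * P s c n (T x)))"
      by (intro Bochner_Integration.integrable_diff integrable_mult_right ia ib)
    then show ?thesis by (simp add: W_def algebra_simps)
  qed
  have le: "norm (of_real (m x ^ 2 * (a (T x) * b (T x))) * W (T x)) \<le> (m x)\<^sup>2 * (\<bar>s * s'\<bar> * ?E)" for x
  proof -
    have "norm (of_real (m x ^ 2 * (a (T x) * b (T x))) * W (T x)) =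
        (m x)\<^sup>2 * (norm (of_real (a (T x)) * P s c n (T x)) * norm (of_real (b (T x)) * P s' c' (n + d) (T x)))"
      by (simp add: W_def norm_mult norm_power)
    also have "\<dots> \<le> (m x)\<^sup>2 * ((\<bar>s\<bar> * exp (s\<^sup>2 * c / 2)) * (\<bar>s'\<bar> * exp (s'\<^sup>2 * c' / 2)))"
      by (intro mult_left_mono mult_mono aP bP) auto
    finally show ?thesis by (simp add: abs_mult mult_ac)
  qed
  have i2: "integrable M (\<lambda>x. of_real (m x ^ 2 * (a (T x) * b (T x))) * W (T x))"
    by (rule Bochner_Integration.integrable_bound[of _ "\<lambda>x. (m x)\<^sup>2 * (\<bar>s * s'\<bar> * ?E)"])
       (use m_sq le in \<open>auto intro!: AE_I2 intro: order_trans[OF _ abs_ge_self]\<close>)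
  have "(\<integral>x. P s c (Suc n) x * cnj (P s' c' (Suc n + d) x) \<partial>M) =
    (\<integral>x. W (T x) + of_real (m x) * (\<i> * of_real (a (T x) - b (T x)) * W (T x))
       + of_real (m x ^ 2 * (a (T x) * b (T x))) * W (T x) \<partial>M)"
    by (intro Bochner_Integration.integral_cong refl)
       (simp add: W_def a_def b_def algebra_simps power2_eq_square)
  also have "\<dots> = (\<integral>x. W (T x) \<partial>M) + (\<integral>x. of_real (m x) * (\<i> * of_real (a (T x) - b (T x)) * W (T x)) \<partial>M)
       + (\<integral>x. of_real (m x ^ 2 * (a (T x) * b (T x))) * W (T x) \<partial>M)"
    by (simp only: Bochner_Integration.integral_add Bochner_Integration.integrable_add i1 i2 integrable_T[OF iW])
  also have "(\<integral>x. W (T x) \<partial>M) = (\<integral>x. W x \<partial>M)"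
    by (simp add: integral_T)
  also have "(\<integral>x. of_real (m x) * (\<i> * of_real (a (T x) - b (T x)) * W (T x)) \<partial>M) = 0"
    using i1 by (rule orth_complex[rotated]) measurable
  finally have eq: "(\<integral>x. P s c (Suc n) x * cnj (P s' c' (Suc n + d) x) \<partial>M) - 1 =
     ((\<integral>x. W x \<partial>M) - 1) + (\<integral>x. of_real (m x ^ 2 * (a (T x) * b (T x))) * W (T x) \<partial>M)"
    by simp
  have "norm (\<integral>x. of_real (m x ^ 2 * (a (T x) * b (T x))) * W (T x) \<partial>M) \<le> (\<integral>x. (m x)\<^sup>2 * (\<bar>s * s'\<bar> * ?E) \<partial>M)"
    using m_sq le by (intro norm_integral_le i2) auto
  also have "\<dots> = \<bar>s * s'\<bar> * \<sigma>2 * ?E" by simp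
  finally have le2: "norm (\<integral>x. of_real (m x ^ 2 * (a (T x) * b (T x))) * W (T x) \<partial>M) \<le> \<bar>s * s'\<bar> * \<sigma>2 * ?E" .
  have "norm ((\<integral>x. W x \<partial>M) - 1) \<le> n * (\<bar>s * s'\<bar> * \<sigma>2 * ?E)"
    unfolding W_def by (rule Suc)
  with le2 have "norm ((\<integral>x. P s c (Suc n) x * cnj (P s' c' (Suc n + d) x) \<partial>M) - 1)
      \<le> n * (\<bar>s * s'\<bar> * \<sigma>2 * ?E) + \<bar>s * s'\<bar> * \<sigma>2 * ?E"
    unfolding eq by (intro norm_triangle_le add_mono)
  then show ?case by (simp add: algebra_simps)
qed

text \<open>Since \<open>Q k x / k\<close> tends to \<open>\<sigma>2\<close>, the stopping threshold \<open>\<sigma>2 + 1\<close> is almost surely inactive for large \<open>k\<close>.\<close>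

definition mcleish :: "real \<Rightarrow> nat \<Rightarrow> 'a \<Rightarrow> complex" where
  "mcleish \<theta> k = P (\<theta> / sqrt k) ((\<sigma>2 + 1) * k) k"

lemma \<sigma>2_nonneg: "\<sigma>2 \<ge> 0"
  by (simp add: integral_nonneg_AE)

lemma mcleish_M [measurable]: "mcleish \<theta> k \<in> borel_measurable M"
  unfolding mcleish_def by measurable

lemma mcleish_sq: "integrable M (\<lambda>x. (norm (mcleish \<theta> k x))\<^sup>2)"
  unfolding mcleish_def using \<sigma>2_nonneg by (intro P_sq) auto

lemma integral_mcleish: "(\<integral>x. mcleish \<theta> k x \<partial>M) = 1"
  unfolding mcleish_def using \<sigma>2_nonneg by (intro integral_P) auto

text \<open>The \<open>k\<close> common points at scales \<open>\<theta> / sqrt k\<close> and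
  \<open>\<theta> / sqrt l\<close> contribute \<open>k / (sqrt k * sqrt l) = sqrt (k / l)\<close>,
  while thresholds proportional to \<open>k\<close> and \<open>l\<close> make the exponential bounds
  independent of both.\<close>

lemma integral_mcleish_cov:
  assumes "1 \<le> k" "k \<le> l"
  shows "norm ((\<integral>x. mcleish \<theta> k x * cnj (mcleish \<theta> l x) \<partial>M) - 1)
    \<le> (\<theta>\<^sup>2 * \<sigma>2 * exp (\<theta>\<^sup>2 * (\<sigma>2 + 1))) * sqrt (k / l)"
proof -
  have kl: "k > 0" "l > 0" using assms by auto
  define E where "E = exp (\<theta>\<^sup>2 * (\<sigma>2 + 1) / 2)"
  have *: "(\<theta> / sqrt (real n))\<^sup>2 * ((\<sigma>2 + 1) * real n) / 2 = \<theta>\<^sup>2 * (\<sigma>2 + 1) / 2" if "n > 0" for n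
    using that by (simp add: power_divide)
  have "norm ((\<integral>x. mcleish \<theta> k x * cnj (mcleish \<theta> l x) \<partial>M) - 1) \<le>
      k * (\<bar>\<theta> / sqrt k * (\<theta> / sqrt l)\<bar> * \<sigma>2 * (E * E))"
    using integral_P_mult_cnj_P[of "(\<sigma>2 + 1) * k" "(\<sigma>2 + 1) * l" "\<theta> / sqrt k" k "\<theta> / sqrt l" "l - k"]
      \<sigma>2_nonneg assms kl unfolding *[OF kl(1)] *[OF kl(2)] by (simp add: mcleish_def E_def)
  also have "E * E = exp (\<theta>\<^sup>2 * (\<sigma>2 + 1))"
    unfolding E_def exp_add[symmetric] by simp
  also have "k * (\<bar>\<theta> / sqrt k * (\<theta> / sqrt l)\<bar> * \<sigma>2 * exp (\<theta>\<^sup>2 * (\<sigma>2 + 1))) =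
      (\<theta>\<^sup>2 * \<sigma>2 * exp (\<theta>\<^sup>2 * (\<sigma>2 + 1))) * ((k / sqrt k) / sqrt l)"
    by (simp add: abs_mult power2_eq_square)
  also have "k / sqrt k = sqrt k" by (rule real_div_sqrt) simp
  finally show ?thesis by (simp add: real_sqrt_divide)
qed

end

section \<open>Characteristic functions of the normalised sums\<close>

text \<open>Because 1 + y^2 is at most exp (y^2). Factors of norm at most 1 allow two products to be
  compared factor by factor.\<close>

lemma norm_gaussian_factor_le_1: "norm ((1 + \<i> * of_real y) * of_real (exp (- y\<^sup>2 / 2))) \<le> 1"
proof (rule power2_le_imp_le)
  have "(norm ((1 + \<i> * of_real y) * of_real (exp (- y\<^sup>2 / 2))))\<^sup>2 = (1 + y\<^sup>2) * exp (- y\<^sup>2)"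
    unfolding norm_mult power_mult_distrib norm_one_plus_i_square by (simp flip: exp_double)
  also have "\<dots> \<le> exp (y\<^sup>2) * exp (- y\<^sup>2)" by (intro mult_right_mono exp_ge_add_one_self) auto
  finally show "(norm ((1 + \<i> * of_real y) * of_real (exp (- y\<^sup>2 / 2))))\<^sup>2 \<le> 1\<^sup>2"
    by (simp add: exp_minus_inverse)
qed simp

text \<open>The two expressions agree to second order at 0: the Gaussian factor supplies the
  quadratic term that 1 + i y lacks. For large \<open>y\<close> the trivial bound 2 is
  enough.\<close>

lemma iexp_minus_product_bound:
  "norm (exp (\<i> * of_real y) - (1 + \<i> * of_real y) * of_real (exp (- y\<^sup>2 / 2))) \<le> 2 * \<bar>y\<bar> ^ 3"
proof (cases "\<bar>y\<bar> \<le> 1")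
  case True
  let ?u = "y\<^sup>2 / 2"
  have pow: "\<bar>y\<bar> ^ 4 \<le> \<bar>y\<bar> ^ 3" using True by (intro power_decreasing) auto
  \<comment> \<open>An upper bound for exp (- u) from a lower bound for exp u:
    \<open>(1 - u + u\<^sup>2) * (1 + u)\<close> equals 1 + u^3, which is at least 1 for nonnegative
    u.\<close>
  have e: "exp (- ?u) \<le> 1 - ?u + ?u\<^sup>2"
  proof -
    have nn: "0 \<le> 1 - u + u\<^sup>2" for u :: real
      using zero_le_power2[of "u - 1"] zero_le_power2[of u] unfolding power2_diff by (simp, linarith)
    have "(1 - u + u\<^sup>2) * (1 + u) = 1 + u ^ 3" for u :: real
      by (simp add: algebra_simps power2_eq_square power3_eq_cube)
    then have "1 \<le> (1 - ?u + ?u\<^sup>2) * (1 + ?u)" by simp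
    also have "\<dots> \<le> (1 - ?u + ?u\<^sup>2) * exp ?u"
      using nn[of ?u] by (intro mult_left_mono exp_ge_add_one_self)
    finally have "1 * exp (- ?u) \<le> (1 - ?u + ?u\<^sup>2) * exp ?u * exp (- ?u)"
      by (intro mult_right_mono) auto
    then show ?thesis by (simp add: mult.assoc exp_minus_inverse)
  qed
  have e': "1 - ?u \<le> exp (- ?u)" using exp_ge_add_one_self[of "- ?u"] by simp
  have "norm (exp (\<i> * of_real y) - (\<Sum>k\<le>2. (\<i> * of_real y)^k / fact k)) \<le> \<bar>y\<bar>^(Suc 2) / fact (Suc 2)"
    using iexp_approx1[of y 2] by simp
  also have "(\<Sum>k\<le>2. (\<i> * of_real y)^k / fact k) = 1 + \<i> * of_real y - of_real ?u"
  proof -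
    have "(\<Sum>k\<le>2. g k) = g 0 + g 1 + g 2" for g :: "nat \<Rightarrow> complex"
      by (simp add: numeral_2_eq_2)
    then show ?thesis by (simp add: power_mult_distrib)
  qed
  finally have 1: "norm (exp (\<i> * of_real y) - (1 + \<i> * of_real y - of_real ?u)) \<le> \<bar>y\<bar>^3 / 6"
    by (simp add: numeral_3_eq_3)
  have 2: "norm ((1 + \<i> * of_real y) * of_real (exp (- ?u) - (1 - ?u))) \<le> \<bar>y\<bar>^3"
  proof -
    have "norm (1 + \<i> * of_real y) \<le> 2"
      using norm_triangle_ineq[of 1 "\<i> * of_real y"] True by (simp add: norm_mult)
    moreover have "norm (of_real (exp (- ?u) - (1 - ?u)) :: complex) \<le> ?u\<^sup>2"
      unfolding norm_of_real using e e' by linarith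
    ultimately have "norm ((1 + \<i> * of_real y) * of_real (exp (- ?u) - (1 - ?u))) \<le> 2 * ?u\<^sup>2"
      unfolding norm_mult by (intro mult_mono) auto
    also have "\<dots> = \<bar>y\<bar> ^ 4 / 2" by (simp add: power_divide power_even_abs flip: power_mult)
    also have "\<dots> \<le> \<bar>y\<bar> ^ 3" using pow zero_le_power[of "\<bar>y\<bar>" 3] by linarith
    finally show ?thesis .
  qed
  have 3: "norm (\<i> * of_real y * of_real ?u) \<le> \<bar>y\<bar> ^ 3 / 2"
    by (simp add: norm_mult norm_power norm_divide power3_eq_cube power2_eq_square)
  have "exp (\<i> * of_real y) - (1 + \<i> * of_real y) * of_real (exp (- y\<^sup>2 / 2)) =
     (exp (\<i> * of_real y) - (1 + \<i> * of_real y - of_real ?u)) + \<i> * of_real y * of_real ?u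
     - (1 + \<i> * of_real y) * of_real (exp (- ?u) - (1 - ?u))"
    by (simp add: algebra_simps)
  also have "norm \<dots> \<le> (\<bar>y\<bar>^3 / 6 + \<bar>y\<bar> ^ 3 / 2) + \<bar>y\<bar>^3"
    by (intro order_trans[OF norm_triangle_ineq4] add_mono order_trans[OF norm_triangle_ineq] 1 2 3)
  \<comment> \<open>The sum of the constants is 5/3; the value 2 also covers the case of large
    \<open>y\<close>.\<close>
  also have "\<dots> \<le> 2 * \<bar>y\<bar> ^ 3" using zero_le_power[of "\<bar>y\<bar>" 3] by linarith
  finally show ?thesis .
next
  case False
  have "norm (exp (\<i> * of_real y) - (1 + \<i> * of_real y) * of_real (exp (- y\<^sup>2 / 2))) \<le> 1 + 1"
    by (intro order_trans[OF norm_triangle_ineq4] add_mono norm_gaussian_factor_le_1) auto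
  also have "\<dots> \<le> 2 * \<bar>y\<bar> ^ 3" using False by simp
  finally show ?thesis .
qed

text \<open>Replacing the factors one at a time, the errors merely add up, since all remaining
  factors have norm at most 1.\<close>

lemma iexp_sum_minus_product_bound:
  fixes y :: "nat \<Rightarrow> real"
  shows "norm (exp (\<i> * of_real (\<Sum>k<n. y k)) -
      (\<Prod>k<n. 1 + \<i> * of_real (y k)) * of_real (exp (- (\<Sum>k<n. (y k)\<^sup>2) / 2))) \<le> 2 * (\<Sum>k<n. \<bar>y k\<bar> ^ 3)"
proof -
  have "exp (\<i> * of_real (\<Sum>k<n. y k)) = (\<Prod>k<n. exp (\<i> * of_real (y k)))"
    by (subst exp_sum[symmetric]) (simp_all add: sum_distrib_left)
  moreover have "exp (- (\<Sum>k<n. (y k)\<^sup>2) / 2) = (\<Prod>k<n. exp (- (y k)\<^sup>2 / 2))"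
    by (subst exp_sum[symmetric]) (simp_all add: sum_negf sum_divide_distrib)
  ultimately have "norm (exp (\<i> * of_real (\<Sum>k<n. y k)) -
      (\<Prod>k<n. 1 + \<i> * of_real (y k)) * of_real (exp (- (\<Sum>k<n. (y k)\<^sup>2) / 2))) =
    norm ((\<Prod>k<n. exp (\<i> * of_real (y k))) - (\<Prod>k<n. (1 + \<i> * of_real (y k)) * of_real (exp (- (y k)\<^sup>2 / 2))))"
    by (simp only: prod.distrib of_real_prod)
  also have "\<dots> \<le> (\<Sum>k<n. norm (exp (\<i> * of_real (y k)) - (1 + \<i> * of_real (y k)) * of_real (exp (- (y k)\<^sup>2 / 2))))"
    by (intro norm_prod_diff norm_gaussian_factor_le_1) auto
  also have "\<dots> \<le> (\<Sum>k<n. 2 * \<bar>y k\<bar> ^ 3)"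
    by (intro sum_mono iexp_minus_product_bound)
  finally show ?thesis by (simp add: sum_distrib_left)
qed

text \<open>A late term obeys the bound with its own, smaller root; the finitely many early ones are
  absorbed once \<open>sqrt k\<close> is large. This is the Lindeberg-type input: no single term of
  a normalised sum matters.\<close>

lemma eventually_max_le_sqrt:
  fixes a :: "nat \<Rightarrow> real"
  assumes lim: "(\<lambda>n. a n / sqrt n) \<longlonglongrightarrow> 0" and e: "e > 0"
  shows "eventually (\<lambda>k. \<forall>j<k. \<bar>a j\<bar> \<le> e * sqrt k) sequentially"
proof -
  obtain N where N: "\<And>n. n \<ge> N \<Longrightarrow> \<bar>a n / sqrt n\<bar> < e"
    using LIMSEQ_D[OF lim e] by auto
  define B where "B = (\<Sum>j\<le>N. \<bar>a j\<bar>)"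
  have "filterlim (\<lambda>k. e * sqrt (real k)) at_top sequentially"
    using e by (intro filterlim_tendsto_pos_mult_at_top[OF tendsto_const] filterlim_compose[OF sqrt_at_top filterlim_real_sequentially])
  then have "eventually (\<lambda>k. B \<le> e * sqrt k) sequentially"
    by (simp add: filterlim_at_top)
  then show ?thesis
  proof eventually_elim
    case (elim k)
    show ?case
    proof (intro allI impI)
      fix j assume j: "j < k"
      show "\<bar>a j\<bar> \<le> e * sqrt k"
      proof (cases "j \<le> N")
        case True
        then have "\<bar>a j\<bar> \<le> B" unfolding B_def by (intro member_le_sum) auto
        then show ?thesis using elim by simp
      next
        case False
        then have "\<bar>a j\<bar> / sqrt j < e" using N[of j] by (simp add: abs_div)
        then have "\<bar>a j\<bar> \<le> e * sqrt j" using False by (simp add: field_simps)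
        also have "\<dots> \<le> e * sqrt k" using j e by simp
        finally show ?thesis .
      qed
    qed
  qed
qed

lemma harm_over_ln_tendsto_1: "(\<lambda>N. harm N / ln (real N)) \<longlonglongrightarrow> (1::real)"
proof (rule tendsto_sandwich[where f="\<lambda>_. 1" and h="\<lambda>N. 1 + inverse (ln (real N))"])
  have ln_top: "filterlim (\<lambda>N. ln (real N)) at_top sequentially"
    by (rule filterlim_compose[OF ln_at_top filterlim_real_sequentially])
  have "(\<lambda>N. 1 + inverse (ln (real N))) \<longlonglongrightarrow> 1 + 0"
    by (intro tendsto_intros tendsto_inverse_0_at_top ln_top)
  then show "(\<lambda>N. 1 + inverse (ln (real N))) \<longlonglongrightarrow> 1" by simp
  show "eventually (\<lambda>N. harm N / ln (real N) \<le> 1 + inverse (ln (real N))) sequentially"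
    using eventually_ge_at_top[of 2]
  proof eventually_elim
    case (elim N)
    then have "ln (real N) > 0" by simp
    then show ?case using harm_le[of N] elim by (simp add: field_simps)
  qed
  show "eventually (\<lambda>N. 1 \<le> harm N / ln (real N)) sequentially"
    using eventually_ge_at_top[of 2]
  proof eventually_elim
    case (elim N)
    then have "ln (real N) > 0" by simp
    then show ?case using ln_le_harm'[of N] elim by (simp add: field_simps)
  qed
qed auto

text \<open>Toeplitz's argument for the weights \<open>1 / k\<close>: their mass
  \<open>harm N\<close> is asymptotic to \<open>ln N\<close>, and any fixed initial block disappears
  under the normalisation.\<close>

lemma log_average_null:
  fixes z :: "nat \<Rightarrow> 'b::real_normed_field"
  assumes z: "z \<longlonglongrightarrow> 0"
  shows "(\<lambda>N. (\<Sum>k=1..N. z k / of_nat k) / of_real (ln N)) \<longlonglongrightarrow> 0"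
proof (rule tendstoI)
  fix e :: real assume e: "e > 0"
  obtain K where K: "\<And>k. k \<ge> K \<Longrightarrow> norm (z k) < e / 2"
    using LIMSEQ_D[OF z, of "e / 2"] e by auto
  define A where "A = (\<Sum>k\<le>K. norm (z k))"
  have ln_top: "filterlim (\<lambda>N. ln (real N)) at_top sequentially"
    by (rule filterlim_compose[OF ln_at_top filterlim_real_sequentially])
  have "(\<lambda>N. A * inverse (ln (real N)) + e / 2 * (harm N / ln (real N))) \<longlonglongrightarrow> A * 0 + e / 2 * 1"
    by (intro tendsto_intros tendsto_inverse_0_at_top ln_top harm_over_ln_tendsto_1)
  then have "eventually (\<lambda>N. A * inverse (ln (real N)) + e / 2 * (harm N / ln (real N)) < e) sequentially"
    by (rule order_tendstoD) (use e in auto)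
  then show "eventually (\<lambda>N. dist ((\<Sum>k=1..N. z k / of_nat k) / of_real (ln N)) 0 < e) sequentially"
    using eventually_ge_at_top[of 2]
  proof eventually_elim
    case (elim N)
    then have ln: "ln (real N) > 0" by simp
    have "norm (\<Sum>k=1..N. z k / of_nat k) \<le> (\<Sum>k=1..N. (if k \<le> K then norm (z k) else 0) + e / 2 * inverse (real k))"
    proof (intro sum_norm_le)
      fix k assume k: "k \<in> {1..N}"
      have "norm (z k) / k \<le> (if k \<le> K then norm (z k) else 0) + e / 2 * inverse (real k)"
      proof (cases "k \<le> K")
        case True
        have "norm (z k) / k \<le> norm (z k) / 1" using k by (intro divide_left_mono) auto
        then show ?thesis using True e by (simp add: add_increasing2)
      next
        case False
        have "norm (z k) \<le> e / 2" using K[of k] False by simp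
        then have "norm (z k) / k \<le> (e / 2) / k" by (rule divide_right_mono) simp
        then show ?thesis using False by (simp only: divide_inverse if_False add_0)
      qed
      then show "norm (z k / of_nat k) \<le> (if k \<le> K then norm (z k) else 0) + e / 2 * inverse (real k)"
        by (simp add: norm_divide)
    qed
    also have "\<dots> = (\<Sum>k\<in>{1..N} \<inter> {..K}. norm (z k)) + e / 2 * harm N"
      unfolding sum.distrib harm_def sum_distrib_left[symmetric]
      by (simp only: sum.inter_restrict[OF finite_atLeastAtMost] atMost_iff)
    also have "\<dots> \<le> A + e / 2 * harm N"
    proof -
      have "(\<Sum>k\<in>{1..N} \<inter> {..K}. norm (z k)) \<le> A"
        unfolding A_def by (rule sum_mono2) auto
      then show ?thesis by simp
    qed
    finally have "norm (\<Sum>k=1..N. z k / of_nat k) / ln N \<le> (A + e / 2 * harm N) / ln N"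
      using ln by (intro divide_right_mono) auto
    also have "(A + e / 2 * harm N) / ln N = A * inverse (ln (real N)) + e / 2 * (harm N / ln (real N))"
      by (simp add: add_divide_distrib inverse_eq_divide)
    also have "\<dots> < e" by (rule elim(1))
    finally show ?case using ln by (simp add: norm_divide)
  qed
qed

text \<open>Bounded second moments give uniform integrability: a norm is at most its truncation at
  \<open>L\<close> plus its square over \<open>L\<close>, and the truncated part converges by
  domination.\<close>

lemma (in prob_space) integral_tendsto_0_of_bounded_second_moment:
  fixes Z :: "nat \<Rightarrow> 'a \<Rightarrow> 'b::{banach, second_countable_topology}"
  assumes [measurable]: "\<And>k. Z k \<in> borel_measurable M"
    and sq: "\<And>k. integrable M (\<lambda>x. (norm (Z k x))\<^sup>2)" and K: "\<And>k. (\<integral>x. (norm (Z k x))\<^sup>2 \<partial>M) \<le> K"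
    and lim: "AE x in M. (\<lambda>k. Z k x) \<longlonglongrightarrow> 0"
  shows "(\<lambda>k. \<integral>x. Z k x \<partial>M) \<longlonglongrightarrow> 0"
proof (rule tendstoI)
  fix e :: real assume e: "e > 0"
  have K0: "K \<ge> 0" using order_trans[OF _ K[of 0]] by (simp add: integral_nonneg_AE)
  \<comment> \<open>\<open>K + 1\<close> is positive and makes the tail \<open>K / L\<close>
    strictly smaller than \<open>q / L\<close>, which is \<open>e / 2\<close>.\<close>
  define q where "q = K + 1"
  define L where "L = 2 * q / e"
  have q: "q > 0" using K0 by (simp add: q_def)
  have L: "L > 0" using e q by (simp add: L_def)
  have "(\<lambda>k. \<integral>x. min (norm (Z k x)) L \<partial>M) \<longlonglongrightarrow> (\<integral>x. 0 \<partial>M)"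
  proof (rule integral_dominated_convergence[of _ _ _ "\<lambda>x. L"])
    show "AE x in M. (\<lambda>k. min (norm (Z k x)) L) \<longlonglongrightarrow> 0"
      using lim
    proof eventually_elim
      case (elim x)
      have "(\<lambda>k. min (norm (Z k x)) L) \<longlonglongrightarrow> min (norm (0::'b)) L"
        by (intro tendsto_intros elim)
      then show ?case using L by simp
    qed
  qed (use L in \<open>auto simp: min_def\<close>)
  then have "eventually (\<lambda>k. (\<integral>x. min (norm (Z k x)) L \<partial>M) < e / 2) sequentially"
    using e by (intro order_tendstoD) auto
  then show "eventually (\<lambda>k. dist (\<integral>x. Z k x \<partial>M) 0 < e) sequentially"
  proof eventually_elim
    case (elim k)
    have imin: "integrable M (\<lambda>x. min (norm (Z k x)) L)"
      using L by (intro integrable_const_bound[of _ L]) (auto simp: min_def)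
    have "norm (Z k x) \<le> min (norm (Z k x)) L + (norm (Z k x))\<^sup>2 / L" for x
    proof (cases "norm (Z k x) \<le> L")
      case True
      then show ?thesis using L by simp
    next
      case False
      then have "norm (Z k x) * L \<le> (norm (Z k x))\<^sup>2"
        unfolding power2_eq_square by (intro mult_left_mono) auto
      then have "norm (Z k x) \<le> (norm (Z k x))\<^sup>2 / L" using L by (simp add: field_simps)
      then show ?thesis using L by (simp add: min_def)
    qed
    moreover have "integrable M (Z k)"
      by (rule integrable_of_square[OF assms(1) sq])
    moreover have "integrable M (\<lambda>x. min (norm (Z k x)) L + (norm (Z k x))\<^sup>2 / L)"
      by (intro Bochner_Integration.integrable_add imin integrable_divide sq)
    ultimately have "norm (\<integral>x. Z k x \<partial>M) \<le> (\<integral>x. min (norm (Z k x)) L + (norm (Z k x))\<^sup>2 / L \<partial>M)"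
      by (intro norm_integral_le)
    also have "\<dots> = (\<integral>x. min (norm (Z k x)) L \<partial>M) + (\<integral>x. (norm (Z k x))\<^sup>2 \<partial>M) / L"
      using sq imin by simp
    also have "\<dots> < e / 2 + q / L"
    proof (rule add_strict_mono)
      show "(\<integral>x. (norm (Z k x))\<^sup>2 \<partial>M) / L < q / L"
        using K[of k] L unfolding q_def by (intro divide_strict_right_mono) auto
    qed (rule elim)
    also have "\<dots> = e" using e q by (simp add: L_def)
    finally show ?case by simp
  qed
qed

context reverse_martingale_difference
begin

abbreviation S :: "nat \<Rightarrow> 'a \<Rightarrow> real" where "S \<equiv> birkhoff_sum T m"

text \<open>Birkhoff's theorem for the square of \<open>m\<close> does everything: convergence of
  \<open>Q k x / k\<close> deactivates the stopping and fixes the Gaussian factor, and smallness of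
  the largest term makes the sum of cubes vanish. Both null sets are independent of
  \<open>\<theta>\<close>.\<close>

lemma AE_mcleish:
  "AE x in M. \<forall>\<theta>. (\<lambda>k. exp (\<i> * of_real (\<theta> * (S k x / sqrt k))) -
      of_real (exp (- \<theta>\<^sup>2 * \<sigma>2 / 2)) * mcleish \<theta> k x) \<longlonglongrightarrow> 0 \<and> Bseq (\<lambda>k. mcleish \<theta> k x)"
  using birkhoff[OF m_sq] AE_sqrt_orbit_tendsto_0[OF m_sq]
proof eventually_elim
  case (elim x)
  note lim_Q = elim(1) and lim_m = elim(2)
  show ?case
  proof (intro allI)
    fix \<theta> :: real
    define c where "c = exp (- \<theta>\<^sup>2 * \<sigma>2 / 2)"
    define y where "y k j = \<theta> / sqrt k * m ((T ^^ j) x)" for k j :: nat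
    define q where "q k = Q k x / k" for k
    have sum_y: "(\<Sum>j<k. y k j) = \<theta> * (S k x / sqrt k)" for k
      unfolding y_def birkhoff_sum_def sum_distrib_left[symmetric] by simp
    have sum_y2: "(\<Sum>j<k. (y k j)\<^sup>2) = \<theta>\<^sup>2 * q k" for k
      by (simp add: y_def q_def birkhoff_sum_def sum_distrib_left power_mult_distrib power_divide sum_divide_distrib)
    have ev_q: "eventually (\<lambda>k. q k \<le> \<sigma>2 + 1 \<and> k > 0) sequentially"
      using order_tendstoD(2)[OF lim_Q less_add_one] eventually_gt_at_top[of 0]
      by eventually_elim (auto simp: q_def)
    have ev_bdd: "eventually (\<lambda>k. norm (mcleish \<theta> k x) \<le> exp (\<theta>\<^sup>2 * (\<sigma>2 + 1) / 2)) sequentially"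
      using ev_q
    proof eventually_elim
      case (elim k)
      then have "Q k x \<le> (\<sigma>2 + 1) * k" by (auto simp: q_def pos_divide_le_eq)
      from norm_stopped_prod_le[OF this, of "\<theta> / sqrt k"] elim show ?case
        by (simp add: mcleish_def power_divide)
    qed
    have Bseq: "Bseq (\<lambda>k. mcleish \<theta> k x)"
      using ev_bdd by (rule BfunI)
    have lim3: "(\<lambda>k. \<Sum>j<k. \<bar>y k j\<bar> ^ 3) \<longlonglongrightarrow> 0"
    proof (rule tendstoI)
      fix e :: real assume e: "e > 0"
      \<comment> \<open>The summand 1 keeps \<open>C\<close> positive for
        \<open>\<theta> = 0\<close> and makes the final inequality strict.\<close>
      define C where "C = \<bar>\<theta>\<bar> * (\<theta>\<^sup>2 * (\<sigma>2 + 1)) + 1"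
      have C: "C > 0" using \<sigma>2_nonneg by (simp add: C_def add_nonneg_pos)
      show "eventually (\<lambda>k. dist (\<Sum>j<k. \<bar>y k j\<bar> ^ 3) 0 < e) sequentially"
        using eventually_max_le_sqrt[OF lim_m divide_pos_pos[OF e C]] ev_q
      proof eventually_elim
        case (elim k)
        have k: "sqrt k > 0" using elim by simp
        have "(\<Sum>j<k. \<bar>y k j\<bar> ^ 3) \<le> (\<Sum>j<k. (\<bar>\<theta>\<bar> * (e / C)) * (y k j)\<^sup>2)"
        proof (rule sum_mono)
          fix j assume "j \<in> {..<k}"
          then have "\<bar>m ((T ^^ j) x)\<bar> \<le> e / C * sqrt k" using elim by auto
          then have "\<bar>m ((T ^^ j) x)\<bar> / sqrt k \<le> e / C" using k by (simp add: pos_divide_le_eq)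
          then have "\<bar>y k j\<bar> \<le> \<bar>\<theta>\<bar> * (e / C)"
            unfolding y_def abs_mult using mult_left_mono[of _ _ "\<bar>\<theta>\<bar>"] k by fastforce
          then have "\<bar>y k j\<bar> * (y k j)\<^sup>2 \<le> (\<bar>\<theta>\<bar> * (e / C)) * (y k j)\<^sup>2"
            by (intro mult_right_mono) auto
          then show "\<bar>y k j\<bar> ^ 3 \<le> (\<bar>\<theta>\<bar> * (e / C)) * (y k j)\<^sup>2"
            by (simp add: power3_eq_cube power2_eq_square mult.assoc)
        qed
        also have "\<dots> = (\<bar>\<theta>\<bar> * (e / C)) * (\<theta>\<^sup>2 * q k)"
          unfolding sum_y2[symmetric] by (simp add: sum_distrib_left)
        also have "\<dots> \<le> (\<bar>\<theta>\<bar> * (e / C)) * (\<theta>\<^sup>2 * (\<sigma>2 + 1))"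
          using elim e C by (intro mult_left_mono) auto
        also have "\<dots> = (e / C) * (C - 1)" by (simp add: C_def)
        also have "\<dots> < e" using e C by (simp add: field_simps)
        finally show ?case by (simp add: sum_nonneg)
      qed
    qed
    have lim_e: "(\<lambda>k. exp (- (\<theta>\<^sup>2 * q k) / 2) - c) \<longlonglongrightarrow> c - c"
    proof -
      have "q \<longlonglongrightarrow> \<sigma>2" using lim_Q by (simp add: q_def[abs_def])
      then have "(\<lambda>k. exp (- (\<theta>\<^sup>2 * q k) / 2) - c) \<longlonglongrightarrow> exp (- (\<theta>\<^sup>2 * \<sigma>2) / 2) - c"
        by (intro tendsto_intros) auto
      then show ?thesis by (simp add: c_def)
    qed
    \<comment> \<open>The error of replacing the random variance
      \<open>\<theta>\<^sup>2 * q k\<close> by its limit: a bounded sequence times a null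
      sequence.\<close>
    define r where "r k = mcleish \<theta> k x * of_real (exp (- (\<theta>\<^sup>2 * q k) / 2) - c)" for k
    have lim_r: "r \<longlonglongrightarrow> 0"
    proof -
      have "(\<lambda>k. of_real (exp (- (\<theta>\<^sup>2 * q k) / 2) - c) :: complex) \<longlonglongrightarrow> of_real (c - c)"
        by (rule tendsto_of_real[OF lim_e])
      then have "Zfun (\<lambda>k. of_real (exp (- (\<theta>\<^sup>2 * q k) / 2) - c) :: complex) sequentially"
        by (simp add: tendsto_Zfun_iff)
      from bounded_bilinear.Bfun_prod_Zfun[OF bounded_bilinear_mult Bseq this]
      show ?thesis by (simp add: r_def tendsto_Zfun_iff)
    qed
    have main: "eventually (\<lambda>k. norm (exp (\<i> * of_real (\<theta> * (S k x / sqrt k))) - of_real c * mcleish \<theta> k x)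
        \<le> 2 * (\<Sum>j<k. \<bar>y k j\<bar> ^ 3) + norm (r k)) sequentially"
      using ev_q
    proof eventually_elim
      case (elim k)
      then have "Q k x \<le> (\<sigma>2 + 1) * k" by (auto simp: q_def pos_divide_le_eq)
      then have P_eq: "mcleish \<theta> k x = (\<Prod>j<k. 1 + \<i> * of_real (y k j))"
        unfolding mcleish_def y_def by (rule stopped_prod_eq_prod)
      have "exp (\<i> * of_real (\<theta> * (S k x / sqrt k))) - of_real c * mcleish \<theta> k x =
        (exp (\<i> * of_real (\<Sum>j<k. y k j)) - mcleish \<theta> k x * of_real (exp (- (\<Sum>j<k. (y k j)\<^sup>2) / 2))) + r k"
        unfolding sum_y sum_y2 r_def by (simp add: algebra_simps)
      then show ?case
        using iexp_sum_minus_product_bound[where y="y k" and n=k] unfolding P_eq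
        by (auto intro!: norm_triangle_le)
    qed
    have "(\<lambda>k. 2 * (\<Sum>j<k. \<bar>y k j\<bar> ^ 3) + norm (r k)) \<longlonglongrightarrow> 2 * 0 + norm (0 :: complex)"
      by (intro tendsto_intros lim3 lim_r)
    then have "(\<lambda>k. 2 * (\<Sum>j<k. \<bar>y k j\<bar> ^ 3) + norm (r k)) \<longlonglongrightarrow> 0" by simp
    then have "(\<lambda>k. exp (\<i> * of_real (\<theta> * (S k x / sqrt k))) - of_real c * mcleish \<theta> k x) \<longlonglongrightarrow> 0"
      using main by (rule Lim_null_comparison[rotated])
    then show "(\<lambda>k. exp (\<i> * of_real (\<theta> * (S k x / sqrt k))) -
        of_real (exp (- \<theta>\<^sup>2 * \<sigma>2 / 2)) * mcleish \<theta> k x) \<longlonglongrightarrow> 0 \<and> Bseq (\<lambda>k. mcleish \<theta> k x)"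
      using Bseq by (simp add: c_def)
  qed
qed

lemma norm_iexp_diff_le: "norm (exp (\<i> * of_real a) - exp (\<i> * of_real b)) \<le> \<bar>a - b\<bar>"
proof -
  have "exp (\<i> * of_real a) - exp (\<i> * of_real b) = exp (\<i> * of_real b) * (exp (\<i> * of_real (a - b)) - 1)"
    by (simp add: algebra_simps flip: exp_add)
  then have "norm (exp (\<i> * of_real a) - exp (\<i> * of_real b)) = norm (exp (\<i> * of_real (a - b)) - 1)"
    by (simp add: norm_mult)
  also have "\<dots> \<le> \<bar>a - b\<bar>"
    using iexp_approx1[of "a - b" 0] by simp
  finally show ?thesis .
qed

text \<open>The map a -> exp (i a) is 1-Lipschitz, so passing from \<open>m\<close> to
  \<open>f\<close> costs at most the normalised difference of the sums times the absolute value of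
  \<open>\<theta>\<close>.\<close>

lemma AE_mcleish':
  assumes near: "AE x in M. (\<lambda>k. (birkhoff_sum T f k x - S k x) / sqrt k) \<longlonglongrightarrow> 0"
  shows "AE x in M. (\<lambda>k. exp (\<i> * of_real (\<theta> * (birkhoff_sum T f k x / sqrt k))) -
      of_real (exp (- \<theta>\<^sup>2 * \<sigma>2 / 2)) * mcleish \<theta> k x) \<longlonglongrightarrow> 0"
  using near AE_mcleish
proof eventually_elim
  case (elim x)
  let ?e = "\<lambda>g k. exp (\<i> * of_real (\<theta> * (birkhoff_sum T g k x / sqrt k)))"
  have "(\<lambda>k. ?e f k - ?e m k) \<longlonglongrightarrow> 0"
  proof (rule Lim_null_comparison)
    show "eventually (\<lambda>k. norm (?e f k - ?e m k) \<le> \<bar>\<theta> * ((birkhoff_sum T f k x - S k x) / sqrt k)\<bar>) sequentially"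
    proof (intro always_eventually allI)
      fix k
      have "\<theta> * ((birkhoff_sum T f k x - S k x) / sqrt k) = \<theta> * (birkhoff_sum T f k x / sqrt k) - \<theta> * (S k x / sqrt k)"
        by (simp add: right_diff_distrib diff_divide_distrib)
      then show "norm (?e f k - ?e m k) \<le> \<bar>\<theta> * ((birkhoff_sum T f k x - S k x) / sqrt k)\<bar>"
        using norm_iexp_diff_le by metis
    qed
    have "(\<lambda>k. \<bar>\<theta> * ((birkhoff_sum T f k x - S k x) / sqrt k)\<bar>) \<longlonglongrightarrow> \<bar>\<theta> * 0\<bar>"
      by (intro tendsto_intros elim(1))
    then show "(\<lambda>k. \<bar>\<theta> * ((birkhoff_sum T f k x - S k x) / sqrt k)\<bar>) \<longlonglongrightarrow> 0" by simp
  qed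
  from tendsto_add[OF this elim(2)[THEN spec, of \<theta>, THEN conjunct1]]
  show ?case by (simp add: algebra_simps)
qed

text \<open>The almost sure approximation can be integrated since the products are bounded in L2. As
  they have mean exactly 1, only the Gaussian factor survives.\<close>

lemma char_birkhoff_sum_tendsto:
  assumes [measurable]: "f \<in> borel_measurable M"
    and near: "AE x in M. (\<lambda>k. (birkhoff_sum T f k x - S k x) / sqrt k) \<longlonglongrightarrow> 0"
  shows "(\<lambda>k. \<integral>x. exp (\<i> * of_real (\<theta> * (birkhoff_sum T f k x / sqrt k))) \<partial>M) \<longlonglongrightarrow> of_real (exp (- \<theta>\<^sup>2 * \<sigma>2 / 2))"
proof -
  define c where "c = exp (- \<theta>\<^sup>2 * \<sigma>2 / 2)"
  have c: "0 \<le> c" "c \<le> 1" using \<sigma>2_nonneg by (auto simp: c_def)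
  define Z where "Z k x = exp (\<i> * of_real (\<theta> * (birkhoff_sum T f k x / sqrt k))) - of_real c * mcleish \<theta> k x" for k x
  have [measurable]: "Z k \<in> borel_measurable M" for k unfolding Z_def by measurable
  define K where "K = \<theta>\<^sup>2 * \<sigma>2 * exp (\<theta>\<^sup>2 * (\<sigma>2 + 1))"
  \<comment> \<open>The covariance estimate on the diagonal; it starts at index 1, and at index 0
    the product is the constant 1.\<close>
  have mcleish_bound: "(\<integral>x. (norm (mcleish \<theta> k x))\<^sup>2 \<partial>M) \<le> 1 + K" for k
  proof (cases "k = 0")
    case True
    then show ?thesis using \<sigma>2_nonneg by (simp add: mcleish_def K_def prob_space)
  next
    case False
    let ?I = "\<integral>x. (norm (mcleish \<theta> k x))\<^sup>2 \<partial>M"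
    have "(\<integral>x. mcleish \<theta> k x * cnj (mcleish \<theta> k x) \<partial>M) = of_real ?I"
      by (simp only: complex_norm_square[symmetric] integral_complex_of_real)
    with integral_mcleish_cov[of k k \<theta>] False have "norm (of_real ?I - 1 :: complex) \<le> K"
      by (simp add: K_def)
    then have "\<bar>?I - 1\<bar> \<le> K"
      by (metis norm_of_real of_real_1 of_real_diff)
    then show ?thesis by linarith
  qed
  have Z_le: "(norm (Z k x))\<^sup>2 \<le> 2 + 2 * (norm (mcleish \<theta> k x))\<^sup>2" for k x
  proof -
    have "norm (Z k x) \<le> 1 + norm (mcleish \<theta> k x)"
      unfolding Z_def using c
      by (intro order_trans[OF norm_triangle_ineq4] add_mono) (auto simp: norm_mult intro: mult_left_le_one_le)
    then have "(norm (Z k x))\<^sup>2 \<le> (1 + norm (mcleish \<theta> k x))\<^sup>2" by (intro power_mono) auto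
    also have "\<dots> \<le> 2 + 2 * (norm (mcleish \<theta> k x))\<^sup>2"
      using sum_squares_bound[of 1 "norm (mcleish \<theta> k x)"] by (simp add: power2_sum)
    finally show ?thesis .
  qed
  have Z_sq: "integrable M (\<lambda>x. (norm (Z k x))\<^sup>2)" for k
    by (rule Bochner_Integration.integrable_bound[of _ "\<lambda>x. 2 + 2 * (norm (mcleish \<theta> k x))\<^sup>2"])
       (use Z_le mcleish_sq in auto)
  have "(\<lambda>k. \<integral>x. Z k x \<partial>M) \<longlonglongrightarrow> 0"
  proof (rule integral_tendsto_0_of_bounded_second_moment[OF _ Z_sq])
    show "(\<integral>x. (norm (Z k x))\<^sup>2 \<partial>M) \<le> 2 + 2 * (1 + K)" for k
    proof -
      have "(\<integral>x. (norm (Z k x))\<^sup>2 \<partial>M) \<le> (\<integral>x. 2 + 2 * (norm (mcleish \<theta> k x))\<^sup>2 \<partial>M)"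
        using Z_le mcleish_sq Z_sq by (intro integral_mono) auto
      also have "\<dots> = 2 + 2 * (\<integral>x. (norm (mcleish \<theta> k x))\<^sup>2 \<partial>M)"
        using mcleish_sq by (simp add: prob_space)
      finally show ?thesis using mcleish_bound[of k] by simp
    qed
    show "AE x in M. (\<lambda>k. Z k x) \<longlonglongrightarrow> 0"
      unfolding Z_def c_def by (rule AE_mcleish'[OF near])
  qed auto
  moreover have "(\<integral>x. Z k x \<partial>M) = (\<integral>x. exp (\<i> * of_real (\<theta> * (birkhoff_sum T f k x / sqrt k))) \<partial>M) - of_real c" for k
  proof -
    have "integrable M (\<lambda>x. exp (\<i> * of_real (\<theta> * (birkhoff_sum T f k x / sqrt k))))"
      by (rule integrable_const_bound[of _ 1]) auto
    moreover have "integrable M (mcleish \<theta> k)"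
      by (rule integrable_of_square) (auto intro: mcleish_sq)
    ultimately show ?thesis
      unfolding Z_def by (simp add: integral_mcleish)
  qed
  ultimately have "(\<lambda>k. (\<integral>x. exp (\<i> * of_real (\<theta> * (birkhoff_sum T f k x / sqrt k))) \<partial>M) - of_real c) \<longlonglongrightarrow> 0"
    by simp
  then show ?thesis unfolding c_def by (rule LIM_zero_cancel)
qed

text \<open>Up to a null sequence the exponential is the constant \<open>c\<close> times
  \<open>1 + D k x\<close>. The 1 averages to 1 because \<open>harm N\<close> is asymptotic to
  \<open>ln N\<close>, and the centred products average to 0 by their weak correlation. That last
  step makes the null set depend on \<open>\<theta>\<close>.\<close>

lemma AE_log_average_iexp_tendsto:
  assumes [measurable]: "f \<in> borel_measurable M"
    and near: "AE x in M. (\<lambda>k. (birkhoff_sum T f k x - S k x) / sqrt k) \<longlonglongrightarrow> 0"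
  shows "AE x in M. (\<lambda>N. (\<Sum>k=1..N. exp (\<i> * of_real (\<theta> * (birkhoff_sum T f k x / sqrt k))) / of_nat k) / of_real (ln N))
    \<longlonglongrightarrow> of_real (exp (- \<theta>\<^sup>2 * \<sigma>2 / 2))"
proof -
  define D where "D k x = mcleish \<theta> k x - 1" for k x
  have [measurable]: "D k \<in> borel_measurable M" for k unfolding D_def by measurable
  have D_sq: "integrable M (\<lambda>x. (norm (D k x))\<^sup>2)" for k
    using integrable_square_add[of "mcleish \<theta> k" M "\<lambda>_. - 1"] mcleish_sq by (simp add: D_def)
  have D_cov: "norm (\<integral>x. D k x * cnj (D l x) \<partial>M) \<le> (\<theta>\<^sup>2 * \<sigma>2 * exp (\<theta>\<^sup>2 * (\<sigma>2 + 1))) * sqrt (k / l)"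
    if "1 \<le> k" "k \<le> l" for k l
  proof -
    have i: "integrable M (mcleish \<theta> k)" for k
      by (rule integrable_of_square) (auto intro: mcleish_sq)
    have i2: "integrable M (\<lambda>x. mcleish \<theta> k x * cnj (mcleish \<theta> l x))"
      by (rule integrable_mult_of_squares) (auto intro: mcleish_sq)
    have "(\<integral>x. D k x * cnj (D l x) \<partial>M) =
        (\<integral>x. mcleish \<theta> k x * cnj (mcleish \<theta> l x) - mcleish \<theta> k x - cnj (mcleish \<theta> l x) + 1 \<partial>M)"
      by (intro Bochner_Integration.integral_cong) (auto simp: D_def algebra_simps)
    also have "\<dots> = (\<integral>x. mcleish \<theta> k x * cnj (mcleish \<theta> l x) \<partial>M) - 1"
      using i i2 by (simp add: integral_mcleish prob_space)
    finally show ?thesis using integral_mcleish_cov[OF that] by simp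
  qed
  have bdd: "AE x in M. Bseq (\<lambda>k. D k x)"
    using AE_mcleish
  proof eventually_elim
    case (elim x)
    then have "Bseq (\<lambda>k. mcleish \<theta> k x)" by blast
    then show ?case unfolding D_def by (rule Bseq_add[of _ "- 1", simplified])
  qed
  have "AE x in M. (\<lambda>N. (\<Sum>k=1..N. D k x / of_nat k) / of_real (ln N)) \<longlonglongrightarrow> 0"
    by (rule AE_log_average_tendsto_0[OF _ D_sq D_cov bdd]) auto
  with AE_mcleish'[OF near, of \<theta>] show ?thesis
  proof eventually_elim
    case (elim x)
    define c where "c = (of_real (exp (- \<theta>\<^sup>2 * \<sigma>2 / 2)) :: complex)"
    define z where "z k = exp (\<i> * of_real (\<theta> * (birkhoff_sum T f k x / sqrt k))) - c * mcleish \<theta> k x" for k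
    let ?A = "\<lambda>w N. (\<Sum>k=1..N. w k / of_nat k) / of_real (ln (real N)) :: complex"
    have "z \<longlonglongrightarrow> 0" unfolding z_def c_def by (rule elim(1))
    from log_average_null[OF this] have z: "?A z \<longlonglongrightarrow> 0" .
    have h: "(\<lambda>N. of_real (harm N / ln (real N)) :: complex) \<longlonglongrightarrow> of_real 1"
      by (intro tendsto_of_real harm_over_ln_tendsto_1)
    have "?A (\<lambda>k. exp (\<i> * of_real (\<theta> * (birkhoff_sum T f k x / sqrt k)))) N =
        ?A z N + c * ?A (\<lambda>k. D k x) N + c * of_real (harm N / ln (real N))" for N
    proof -
      have "exp (\<i> * of_real (\<theta> * (birkhoff_sum T f k x / sqrt k))) / of_nat k =
          z k / of_nat k + c * (D k x / of_nat k) + c * of_real (inverse (real k))" for k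
        by (cases "k = 0") (simp_all add: z_def D_def field_simps)
      then have "(\<Sum>k=1..N. exp (\<i> * of_real (\<theta> * (birkhoff_sum T f k x / sqrt k))) / of_nat k) =
          (\<Sum>k=1..N. z k / of_nat k) + c * (\<Sum>k=1..N. D k x / of_nat k) + c * of_real (harm N)"
        by (simp only: sum.distrib sum_distrib_left harm_def of_real_sum)
      then show ?thesis
        by (simp only: add_divide_distrib of_real_divide times_divide_eq_right)
    qed
    moreover have "(\<lambda>N. ?A z N + c * ?A (\<lambda>k. D k x) N + c * of_real (harm N / ln (real N))) \<longlonglongrightarrow> 0 + c * 0 + c * of_real 1"
      by (intro tendsto_intros z elim(2) h)
    ultimately show ?case by (simp add: c_def)
  qed
qed

end

section \<open>Maximal inequality\<close>

text \<open>The martingale here is the tail sum, read from the end of the orbit towards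
  \<open>x\<close> and frozen once its absolute value reaches \<open>c\<close>. Each new summand is
  \<open>m x\<close> times a function of \<open>T x\<close>, which preserves orthogonality.\<close>

primrec stopped_sum :: "('a \<Rightarrow> 'a) \<Rightarrow> ('a \<Rightarrow> real) \<Rightarrow> real \<Rightarrow> nat \<Rightarrow> 'a \<Rightarrow> real" where
  "stopped_sum T m c 0 x = 0"
| "stopped_sum T m c (Suc n) x =
     m x * of_bool (\<bar>stopped_sum T m c n (T x)\<bar> < c) + stopped_sum T m c n (T x)"

lemma birkhoff_sum_split:
  "k \<le> n \<Longrightarrow> birkhoff_sum T f n x = birkhoff_sum T f k x + birkhoff_sum T f (n - k) ((T ^^ k) x)"
proof (induction k arbitrary: n x)
  case (Suc k)
  then obtain n' where n': "n = Suc n'" "k \<le> n'" by (cases n) auto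
  show ?case
    using Suc.IH[OF n'(2), of "T x"] by (simp add: n' birkhoff_sum_Suc' funpow_swap1)
qed simp

text \<open>A frozen sum keeps a value of size at least \<open>c\<close>; a sum that was never
  frozen is the true one, and all tails met on the way were below \<open>c\<close>.\<close>

lemma stopped_sum_cases:
  "\<bar>stopped_sum T m c n x\<bar> \<ge> c \<or>
    stopped_sum T m c n x = birkhoff_sum T m n x \<and>
    (\<forall>k\<le>n. \<bar>birkhoff_sum T m (n - k) ((T ^^ k) x)\<bar> < c)"
proof (induction n arbitrary: x)
  case (Suc n)
  show ?case
  proof (cases "\<bar>stopped_sum T m c n (T x)\<bar> < c")
    case True
    with Suc[of "T x"] have *: "stopped_sum T m c n (T x) = birkhoff_sum T m n (T x)"
      "\<And>k. k \<le> n \<Longrightarrow> \<bar>birkhoff_sum T m (n - k) ((T ^^ k) (T x))\<bar> < c" by auto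
    have eq: "stopped_sum T m c (Suc n) x = birkhoff_sum T m (Suc n) x"
      using True by (simp add: * birkhoff_sum_Suc')
    have "\<bar>birkhoff_sum T m (Suc n - k) ((T ^^ k) x)\<bar> < c"
      if "\<bar>birkhoff_sum T m (Suc n) x\<bar> < c" "k \<le> Suc n" for k
      using that *(2)[of "k - 1"] by (cases k) (auto simp: funpow_swap1)
    then show ?thesis using eq by (auto simp: not_le)
  qed auto
qed auto

context reverse_martingale_difference
begin

abbreviation R :: "real \<Rightarrow> nat \<Rightarrow> 'a \<Rightarrow> real" where "R \<equiv> stopped_sum T m"

lemma R_G [measurable]: "R c n \<in> borel_measurable G"
proof (induction n)
  case (Suc n)
  note [measurable] = Suc
  show ?case unfolding stopped_sum.simps by measurable
qed (simp add: stopped_sum.simps(1)[abs_def])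

lemma R_M [measurable]: "R c n \<in> borel_measurable M"
  by (rule G_imp_M) measurable

text \<open>The cross term vanishes by orthogonality, and the indicator can only reduce the square
  of \<open>m\<close>, so each step adds at most \<open>\<sigma>2\<close>.\<close>

lemma R_second_moment:
  "integrable M (\<lambda>x. (R c n x)\<^sup>2) \<and> (\<integral>x. (R c n x)\<^sup>2 \<partial>M) \<le> n * \<sigma>2"
proof (induction n)
  case 0
  show ?case by simp
next
  case (Suc n)
  define b where "b y = (of_bool (\<bar>R c n y\<bar> < c) :: real)" for y
  have [measurable]: "b \<in> borel_measurable G" unfolding b_def by measurable
  have [measurable]: "b \<in> borel_measurable M" by (rule G_imp_M) measurable
  have i_mb: "integrable M (\<lambda>x. (m x * b (T x))\<^sup>2)"
    by (rule Bochner_Integration.integrable_bound[OF m_sq]) (auto simp: b_def)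
  have i_R: "integrable M (\<lambda>x. (R c n (T x))\<^sup>2)"
    using Suc by (auto intro: integrable_T)
  have i_bR: "integrable M (\<lambda>x. (b (T x) * R c n (T x))\<^sup>2)"
    by (rule Bochner_Integration.integrable_bound[OF i_R]) (auto simp: b_def)
  have i_cross: "integrable M (\<lambda>x. m x * (b (T x) * R c n (T x)))"
    using m_sq i_bR by (intro integrable_mult_of_squares) auto
  have eq: "(R c (Suc n) x)\<^sup>2 = (m x * b (T x))\<^sup>2 + 2 * (m x * (b (T x) * R c n (T x))) + (R c n (T x))\<^sup>2" for x
    by (simp add: b_def power2_sum)
  have cross: "(\<integral>x. m x * (b (T x) * R c n (T x)) \<partial>M) = 0"
    by (rule orth_real[OF _ i_cross]) measurable
  have "(\<integral>x. (R c (Suc n) x)\<^sup>2 \<partial>M) = (\<integral>x. (m x * b (T x))\<^sup>2 \<partial>M) + (\<integral>x. (R c n (T x))\<^sup>2 \<partial>M)"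
    unfolding eq using i_mb i_cross i_R cross by simp
  also have "(\<integral>x. (R c n (T x))\<^sup>2 \<partial>M) = (\<integral>x. (R c n x)\<^sup>2 \<partial>M)"
    using integral_T[of "\<lambda>x. (R c n x)\<^sup>2"] by simp
  also have "(\<integral>x. (m x * b (T x))\<^sup>2 \<partial>M) \<le> \<sigma>2"
    by (intro integral_mono i_mb m_sq) (auto simp: b_def)
  finally have "(\<integral>x. (R c (Suc n) x)\<^sup>2 \<partial>M) \<le> Suc n * \<sigma>2"
    using Suc by (simp add: algebra_simps)
  moreover have "integrable M (\<lambda>x. (R c (Suc n) x)\<^sup>2)"
    unfolding eq using i_mb i_cross i_R by auto
  ultimately show ?case by simp
qed

text \<open>Stopping controls the tails \<open>S (n - k)\<close> at \<open>(T ^^ k) x\<close> and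
  not the initial sums. Since \<open>S k\<close> is \<open>S n\<close> minus such a tail, both below
  \<open>c\<close>, the threshold doubles.\<close>

lemma kolmogorov_maximal_inequality:
  fixes n :: nat
  assumes c: "c > 0"
  shows "measure M {x \<in> space M. \<exists>k\<le>n. \<bar>S k x\<bar> \<ge> 2 * c} \<le> n * \<sigma>2 / c\<^sup>2"
proof -
  have "{x \<in> space M. \<exists>k\<le>n. \<bar>S k x\<bar> \<ge> 2 * c} \<subseteq> {x \<in> space M. (R c n x)\<^sup>2 \<ge> c\<^sup>2}"
  proof safe
    fix x k assume k: "k \<le> n" and S: "2 * c \<le> \<bar>S k x\<bar>"
    have "\<bar>R c n x\<bar> \<ge> c"
    proof (rule ccontr)
      assume "\<not> \<bar>R c n x\<bar> \<ge> c"
      with stopped_sum_cases[of c T m n x]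
      have *: "\<And>k. k \<le> n \<Longrightarrow> \<bar>S (n - k) ((T ^^ k) x)\<bar> < c" by auto
      show False
        using *[of 0] *[OF k] birkhoff_sum_split[OF k, of T m x] S by simp
    qed
    then show "c\<^sup>2 \<le> (R c n x)\<^sup>2" using c by (metis abs_le_square_iff abs_of_pos)
  qed
  then have "measure M {x \<in> space M. \<exists>k\<le>n. \<bar>S k x\<bar> \<ge> 2 * c} \<le> measure M {x \<in> space M. (R c n x)\<^sup>2 \<ge> c\<^sup>2}"
    by (intro finite_measure_mono) measurable
  also have "\<dots> \<le> (\<integral>x. (R c n x)\<^sup>2 \<partial>M) / c\<^sup>2"
    using R_second_moment[of c n] c by (intro integral_Markov_inequality_measure[where A="{}"]) auto
  also have "\<dots> \<le> n * \<sigma>2 / c\<^sup>2"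
    using R_second_moment[of c n] by (intro divide_right_mono) auto
  finally show ?thesis .
qed

text \<open>The threshold is \<open>4 * c\<close>, shared out as \<open>2 * c\<close> for the
  martingale and \<open>c\<close> for each of the two values of \<open>v\<close>. A plain union
  bound over \<open>n + 1 \<le> 2 * n\<close> values of \<open>v\<close> suffices, because
  \<open>c\<^sup>2\<close> is \<open>B\<^sup>2 * n / 16\<close>; this is the origin of 16 and
  32.\<close>

lemma maximal_inequality_coboundary:
  assumes [measurable]: "f \<in> borel_measurable M" "v \<in> borel_measurable M"
    and v_sq: "integrable M (\<lambda>x. (v x)\<^sup>2)"
    and cob: "AE x in M. \<forall>k. birkhoff_sum T f k x = S k x + v x - v ((T ^^ k) x)"
    and B: "B > 0" and n: "n > 0"
  shows "measure M {x \<in> space M. \<exists>k\<le>n. \<bar>birkhoff_sum T f k x\<bar> \<ge> B * sqrt n}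
    \<le> (16 * \<sigma>2 + 32 * (\<integral>x. (v x)\<^sup>2 \<partial>M)) / B\<^sup>2"
proof -
  define c where "c = B / 4 * sqrt n"
  have c: "c > 0" "c\<^sup>2 = B\<^sup>2 / 16 * n" using B n by (auto simp: c_def power_mult_distrib power_divide)
  let ?V = "\<integral>x. (v x)\<^sup>2 \<partial>M"
  let ?A = "{x \<in> space M. \<exists>k\<le>n. \<bar>S k x\<bar> \<ge> 2 * c}"
  let ?D = "\<lambda>k. {x \<in> space M. (v ((T ^^ k) x))\<^sup>2 \<ge> c\<^sup>2}"
  have D: "measure M (?D k) \<le> ?V / c\<^sup>2" for k
  proof -
    have "measure M (?D k) \<le> (\<integral>x. (v ((T ^^ k) x))\<^sup>2 \<partial>M) / c\<^sup>2"
      using integrable_T_pow[OF v_sq, of k] c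
      by (intro integral_Markov_inequality_measure[where A="{}"]) auto
    also have "(\<integral>x. (v ((T ^^ k) x))\<^sup>2 \<partial>M) = ?V"
      using integral_T_pow[of "\<lambda>x. (v x)\<^sup>2" k] by simp
    finally show ?thesis .
  qed
  have "measure M {x \<in> space M. \<exists>k\<le>n. \<bar>birkhoff_sum T f k x\<bar> \<ge> B * sqrt n} \<le> measure M (?A \<union> (\<Union>k\<in>{..n}. ?D k))"
  proof (rule finite_measure_mono_AE)
    show "AE x in M. x \<in> {x \<in> space M. \<exists>k\<le>n. \<bar>birkhoff_sum T f k x\<bar> \<ge> B * sqrt n} \<longrightarrow> x \<in> ?A \<union> (\<Union>k\<in>{..n}. ?D k)"
      using cob
    proof eventually_elim
      case (elim x)
      show ?case
      proof (intro impI, rule ccontr)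
        assume x: "x \<in> {x \<in> space M. \<exists>k\<le>n. \<bar>birkhoff_sum T f k x\<bar> \<ge> B * sqrt n}"
          and nin: "x \<notin> ?A \<union> (\<Union>k\<in>{..n}. ?D k)"
        then obtain k where k: "k \<le> n" "\<bar>birkhoff_sum T f k x\<bar> \<ge> 4 * c" by (auto simp: c_def)
        have v: "\<bar>v ((T ^^ j) x)\<bar> < c" if "j \<le> n" for j
        proof -
          have "\<bar>v ((T ^^ j) x)\<bar>\<^sup>2 < c\<^sup>2" using nin x that by (auto simp: not_le)
          then show ?thesis using c(1) by (rule power_less_imp_less_base[OF _ less_imp_le])
        qed
        have "\<bar>S k x\<bar> < 2 * c" using nin x k by auto
        then show False using k(2) v[OF k(1)] v[of 0] elim[THEN spec, of k] by simp
      qed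
    qed
  qed measurable
  also have "\<dots> \<le> measure M ?A + measure M (\<Union>k\<in>{..n}. ?D k)"
    by (intro measure_Un_le) measurable
  also have "measure M (\<Union>k\<in>{..n}. ?D k) \<le> (\<Sum>k\<le>n. measure M (?D k))"
    by (intro finite_measure_subadditive_finite) auto
  also have "\<dots> \<le> (\<Sum>k\<le>n. ?V / c\<^sup>2)" by (intro sum_mono D)
  also have "\<dots> = (n + 1) * ?V / c\<^sup>2" by simp
  also have "\<dots> \<le> 2 * n * ?V / c\<^sup>2"
    using n by (intro divide_right_mono mult_right_mono) (auto simp: integral_nonneg_AE)
  also have "measure M ?A \<le> n * \<sigma>2 / c\<^sup>2" by (rule kolmogorov_maximal_inequality[OF c(1)])
  also have "n * \<sigma>2 / c\<^sup>2 + 2 * n * ?V / c\<^sup>2 = (16 * \<sigma>2 + 32 * ?V) / B\<^sup>2"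
    unfolding c(2) using n B by (simp add: field_simps)
  finally show ?thesis by simp
qed

end

section \<open>Centred normal laws and increments of characteristic functions\<close>

lemma real_distribution_centred_normal_law:
  assumes "v \<ge> 0"
  shows "real_distribution (centred_normal_law v)"
proof (cases "v = 0")
  case True
  then show ?thesis
    by (auto simp: centred_normal_law_def real_distribution_def real_distribution_axioms_def intro!: prob_space_return)
next
  case False
  then show ?thesis using assms prob_space_normal_density[of "sqrt v" 0]
    by (auto simp: centred_normal_law_def real_distribution_def real_distribution_axioms_def)
qed

lemma char_centred_normal_law:
  assumes "v \<ge> 0"
  shows "char (centred_normal_law v) t = of_real (exp (- t\<^sup>2 * v / 2))"
proof (cases "v = 0")
  case True
  then show ?thesis
    by (simp add: centred_normal_law_def char_def integral_return)
next
  case False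
  then have sd: "sqrt v > 0" using assms by simp
  define N where "N = centred_normal_law v"
  have N: "N = density lborel (normal_density 0 (sqrt v))" using False by (simp add: N_def centred_normal_law_def)
  interpret prob_space N unfolding N using sd by (rule prob_space_normal_density)
  have [measurable_cong]: "sets N = sets borel" by (simp add: N)
  have "distributed N lborel (\<lambda>x. x) (normal_density 0 (sqrt v))"
    unfolding distributed_def by (auto simp: N distr_id2)
  then have "distributed N lborel (\<lambda>x. (x - 0) / sqrt v) std_normal_density"
    using normal_standard_normal_convert[OF sd] by simp
  then have std: "distr N lborel (\<lambda>x. x / sqrt v) = std_normal_distribution"
    by (simp add: distributed_def)
  have "char (centred_normal_law v) t = (\<integral>x. iexp ((t * sqrt v) * (x / sqrt v)) \<partial>N)"
    using sd by (simp add: char_def N_def)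
  also have "\<dots> = (\<integral>x. iexp ((t * sqrt v) * x) \<partial>distr N lborel (\<lambda>x. x / sqrt v))"
    by (subst integral_distr) auto
  also have "\<dots> = char std_normal_distribution (t * sqrt v)"
    unfolding std char_def ..
  also have "\<dots> = of_real (exp (- t\<^sup>2 * v / 2))"
    using assms by (simp add: char_std_normal_distribution power_mult_distrib)
  finally show ?thesis .
qed

text \<open>Cauchy-Schwarz for the difference of the two exponentials, whose squared modulus is 2 -
  2 cos ((t - s) x). Increments anywhere are thus governed by values near 0.\<close>

lemma (in real_distribution) norm_char_diff_square_le:
  "(norm (char M t - char M s))\<^sup>2 \<le> 2 * (1 - Re (char M (t - s)))"
proof -
  have int: "integrable M (\<lambda>x. iexp (a * x))" for a
    by (rule integrable_const_bound[of _ 1]) auto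
  have meas: "(\<lambda>x. norm (iexp (t * x) - iexp (s * x))) \<in> borel_measurable M" by measurable
  have eq: "(norm (iexp (t * x) - iexp (s * x)))\<^sup>2 = 2 - 2 * Re (iexp ((t - s) * x))" for x
  proof -
    have "(norm (iexp (t * x) - iexp (s * x)))\<^sup>2 = (cos (t * x) - cos (s * x))\<^sup>2 + (sin (t * x) - sin (s * x))\<^sup>2"
      by (simp add: cmod_power2 Re_exp Im_exp)
    also have "\<dots> = ((cos (t * x))\<^sup>2 + (sin (t * x))\<^sup>2) + ((cos (s * x))\<^sup>2 + (sin (s * x))\<^sup>2)
        - 2 * (cos (t * x) * cos (s * x) + sin (t * x) * sin (s * x))"
      by (simp only: power2_eq_square) (simp add: algebra_simps)
    also have "\<dots> = 2 - 2 * cos (t * x - s * x)" 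
      unfolding cos_diff using sin_cos_squared_add[of "t * x"] sin_cos_squared_add[of "s * x"] by linarith
    finally show ?thesis by (simp add: Re_exp left_diff_distrib)
  qed
  have i2: "integrable M (\<lambda>x. (norm (iexp (t * x) - iexp (s * x)))\<^sup>2)"
    unfolding eq using int[of "t - s"] by (intro Bochner_Integration.integrable_diff integrable_mult_right integrable_Re) auto
  have "norm (char M t - char M s) = norm (\<integral>x. iexp (t * x) - iexp (s * x) \<partial>M)"
    unfolding char_def using int by (subst Bochner_Integration.integral_diff) auto
  also have "\<dots> \<le> (\<integral>x. norm (iexp (t * x) - iexp (s * x)) \<partial>M)" by (rule integral_norm_bound)
  finally have "(norm (char M t - char M s))\<^sup>2 \<le> (\<integral>x. norm (iexp (t * x) - iexp (s * x)) \<partial>M)\<^sup>2"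
    by (intro power_mono) auto
  also have "\<dots> \<le> (L2_norm M (\<lambda>x. norm (iexp (t * x) - iexp (s * x))))\<^sup>2"
    using integral_abs_le_L2_norm[OF meas i2] by (intro power_mono) (auto simp: integral_nonneg_AE)
  also have "\<dots> = (\<integral>x. (norm (iexp (t * x) - iexp (s * x)))\<^sup>2 \<partial>M)"
    by (rule L2_norm_square)
  also have "\<dots> = 2 - 2 * Re (char M (t - s))"
    unfolding eq char_def using int[of "t - s"]
    by (simp add: prob_space[unfolded space_eq_univ] integrable_Re Bochner_Integration.integral_Re[symmetric] del: Bochner_Integration.integral_Re)
  finally show ?thesis by simp
qed

text \<open>The map s -> t - s preserves null sets, so almost every \<open>h\<close> is good
  together with \<open>t - h\<close>, and the interval from 0 to \<open>e\<close> has positive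
  measure.\<close>

lemma exists_small_decomposition:
  assumes "AE s in lborel. P (s :: real)" and e: "e > 0"
  shows "\<exists>h. 0 < h \<and> h < e \<and> P h \<and> P (t - h)"
proof -
  from assms(1) obtain N where N: "\<And>s. s \<in> space lborel - N \<Longrightarrow> P s" "N \<in> null_sets lborel"
    using AE_E3[OF assms(1)] by metis
  have [measurable]: "N \<in> sets borel" using N(2) by auto
  have "AE s in lborel. t + (- 1) * s \<notin> N"
    by (rule AE_borel_affine[of "- 1" "\<lambda>s. s \<notin> N"]) (auto intro: AE_not_in N)
  then have ae2: "AE s in lborel. P (t - s)"
    by eventually_elim (use N(1) in auto)
  have ae3: "AE s in lborel. P s \<and> P (t - s)" using assms(1) ae2 by eventually_elim auto
  obtain K where K: "\<And>s. s \<in> space lborel - K \<Longrightarrow> P s \<and> P (t - s)" "K \<in> null_sets lborel"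
    using AE_E3[OF ae3] by metis
  have "\<not> {0<..<e} \<subseteq> K"
  proof
    assume "{0<..<e} \<subseteq> K"
    then have "emeasure lborel {0<..<e} \<le> emeasure lborel K" using K by (intro emeasure_mono) auto
    then show False using K e by (simp add: null_sets_def)
  qed
  then show ?thesis using K by auto
qed

section \<open>Weak convergence from characteristic functions\<close>

text \<open>Convergence at almost every \<open>s\<close> suffices: every \<open>t\<close> is a sum \<open>(t - h) + h\<close> of two
  good points with \<open>h\<close> small, and positive definiteness controls the increment by the value at \<open>h\<close>.\<close>

lemma char_tendsto_of_AE:
  fixes \<mu> :: "nat \<Rightarrow> real measure"
  assumes \<mu>: "\<And>n. real_distribution (\<mu> n)" and \<nu>: "real_distribution \<nu>"
    and lim: "AE s in lborel. (\<lambda>n. char (\<mu> n) s) \<longlonglongrightarrow> char \<nu> s"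
  shows "(\<lambda>n. char (\<mu> n) t) \<longlonglongrightarrow> char \<nu> t"
proof (rule tendstoI)
  fix e :: real assume e: "e > 0"
  interpret \<nu>: real_distribution \<nu> by fact
  have "isCont (\<lambda>h. 2 * (1 - Re (char \<nu> h))) 0"
    by (intro continuous_intros isCont_Re \<nu>.isCont_char)
  then have "((\<lambda>h. 2 * (1 - Re (char \<nu> h))) \<longlongrightarrow> 0) (at 0)"
    by (simp add: isCont_def \<nu>.char_zero)
  then have "eventually (\<lambda>h. 2 * (1 - Re (char \<nu> h)) < (e / 3)\<^sup>2) (at 0)"
    using e by (intro order_tendstoD) auto
  then obtain d where d: "d > 0" "\<And>h. 0 < h \<Longrightarrow> h < d \<Longrightarrow> 2 * (1 - Re (char \<nu> h)) < (e / 3)\<^sup>2"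
    by (auto simp: eventually_at dist_real_def)
  obtain h where h: "0 < h" "h < d" "(\<lambda>n. char (\<mu> n) h) \<longlonglongrightarrow> char \<nu> h"
      "(\<lambda>n. char (\<mu> n) (t - h)) \<longlonglongrightarrow> char \<nu> (t - h)"
    using exists_small_decomposition[OF lim d(1), of t] by blast
  \<comment> \<open>Used for the limit law and, for large \<open>n\<close>, for
    \<open>\<mu> n\<close>, whose characteristic function converges at \<open>h\<close>.\<close>
  have small: "norm (char \<rho> t - char \<rho> (t - h)) < e / 3"
    if "real_distribution \<rho>" "2 * (1 - Re (char \<rho> h)) < (e / 3)\<^sup>2" for \<rho>
  proof -
    have "(norm (char \<rho> t - char \<rho> (t - h)))\<^sup>2 < (e / 3)\<^sup>2"
      using real_distribution.norm_char_diff_square_le[OF that(1), of t "t - h"] that(2) by simp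
    then show ?thesis by (rule power_less_imp_less_base) (use e in simp)
  qed
  have "(\<lambda>n. 2 * (1 - Re (char (\<mu> n) h))) \<longlonglongrightarrow> 2 * (1 - Re (char \<nu> h))"
    by (intro tendsto_intros h)
  then have ev: "eventually (\<lambda>n. 2 * (1 - Re (char (\<mu> n) h)) < (e / 3)\<^sup>2) sequentially"
    by (rule order_tendstoD) (rule d(2)[OF h(1,2)])
  have "eventually (\<lambda>n. dist (char (\<mu> n) (t - h)) (char \<nu> (t - h)) < e / 3) sequentially"
    using e by (intro tendstoD h) auto
  with ev show "eventually (\<lambda>n. dist (char (\<mu> n) t) (char \<nu> t) < e) sequentially"
  proof eventually_elim
    case (elim n)
    have "char (\<mu> n) t - char \<nu> t = (char (\<mu> n) t - char (\<mu> n) (t - h)) +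
        (char (\<mu> n) (t - h) - char \<nu> (t - h)) - (char \<nu> t - char \<nu> (t - h))" by simp
    also have "norm \<dots> \<le> norm (char (\<mu> n) t - char (\<mu> n) (t - h)) +
        norm (char (\<mu> n) (t - h) - char \<nu> (t - h)) + norm (char \<nu> t - char \<nu> (t - h))"
      by (rule order_trans[OF norm_triangle_ineq4 add_right_mono[OF norm_triangle_ineq]])
    also have "\<dots> < e / 3 + e / 3 + e / 3"
      using elim small[OF \<mu> elim(1)] small[OF \<nu> d(2)[OF h(1,2)]]
      by (intro add_strict_mono) (auto simp: dist_norm)
    finally show ?case by (simp add: dist_norm)
  qed
qed

lemma integral_point_measure_distr:
  fixes \<phi> :: "real \<Rightarrow> 'b::{banach, second_countable_topology}" and N :: nat
  assumes [measurable]: "\<phi> \<in> borel_measurable borel" and w: "\<And>k. w k \<ge> 0"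
  shows "(\<integral>x. \<phi> x \<partial>distr (point_measure {1..N} (\<lambda>k. ennreal (w k))) borel u) = (\<Sum>k=1..N. w k *\<^sub>R \<phi> (u k))"
proof -
  have "(\<integral>x. \<phi> x \<partial>distr (point_measure {1..N} (\<lambda>k. ennreal (w k))) borel u) =
      (\<integral>k. \<phi> (u k) \<partial>point_measure {1..N} (\<lambda>k. ennreal (w k)))"
    by (rule integral_distr) auto
  also have "\<dots> = (\<Sum>k=1..N. w k *\<^sub>R \<phi> (u k))"
    using w by (intro lebesgue_integral_point_measure_finite) auto
  finally show ?thesis .
qed

text \<open>Renormalising by the exact mass \<open>harm\<close> instead of \<open>ln\<close> gives
  probability measures, to which Levy's continuity theorem applies; the ratio of the two masses
  tends to 1. Almost every \<open>t\<close> is what Fubini delivers on a fixed orbit.\<close>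

lemma weakly_converges_log_average_measure:
  assumes v: "v \<ge> 0"
    and lim: "AE t in lborel. (\<lambda>N. (\<Sum>k=1..N. exp (\<i> * of_real (t * u k)) / of_nat k) / of_real (ln N))
      \<longlonglongrightarrow> of_real (exp (- t\<^sup>2 * v / 2))"
  shows "weakly_converges (log_average_measure u) (centred_normal_law v)"
proof -
  \<comment> \<open>The shift to \<open>Suc N\<close> avoids the empty sum, which cannot be
    normalised.\<close>
  define \<rho> where "\<rho> N = distr (point_measure {1..Suc N} (\<lambda>k. ennreal (1 / (harm (Suc N) * real k)))) borel u" for N
  have harm_gt: "harm (Suc N) > (0::real)" for N by simp
  have harm_neq: "harm (Suc N) \<noteq> (0::real)" for N by (rule less_imp_neq[OF harm_gt, symmetric])
  have \<rho>: "real_distribution (\<rho> N)" for N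
  proof -
    have "emeasure (point_measure {1..Suc N} (\<lambda>k. ennreal (1 / (harm (Suc N) * real k)))) {1..Suc N} = 1"
    proof -
      have "(\<Sum>k=1..Suc N. 1 / (harm (Suc N) * real k)) = (\<Sum>k=1..Suc N. inverse (real k)) / harm (Suc N)"
        unfolding sum_divide_distrib by (intro sum.cong) (auto simp: field_simps)
      also have "\<dots> = 1" using harm_gt[of N] by (simp add: harm_def)
      finally show ?thesis
        using harm_gt[of N] by (subst emeasure_point_measure_finite) (auto simp: sum_ennreal harm_nonneg simp del: sum.cl_ivl_Suc)
    qed
    then have "prob_space (point_measure {1..Suc N} (\<lambda>k. ennreal (1 / (harm (Suc N) * real k))))"
      by (intro prob_spaceI) (simp add: space_point_measure)
    then have "prob_space (\<rho> N)" unfolding \<rho>_def by (rule prob_space.prob_space_distr) simp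
    then show ?thesis
      by (simp add: real_distribution_def real_distribution_axioms_def \<rho>_def)
  qed
  have \<nu>: "real_distribution (centred_normal_law v)" using v by (rule real_distribution_centred_normal_law)
  have log_eq: "(\<integral>x. \<phi> x \<partial>log_average_measure u N) = (\<Sum>k=1..N. (1 / real k) *\<^sub>R \<phi> (u k)) /\<^sub>R ln N"
    if [measurable]: "\<phi> \<in> borel_measurable borel" for \<phi> :: "real \<Rightarrow> 'b::{banach, second_countable_topology}" and N
  proof -
    have "0 \<le> ln (real N)" by (cases "N = 0") auto
    then show ?thesis
      unfolding log_average_measure_def
      by (subst integral_point_measure_distr) (auto simp: scaleR_right.sum divide_inverse mult.commute intro!: sum.cong)
  qed
  have \<rho>_eq: "(\<integral>x. \<phi> x \<partial>\<rho> N) = (\<Sum>k=1..Suc N. (1 / real k) *\<^sub>R \<phi> (u k)) /\<^sub>R harm (Suc N)"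
    if [measurable]: "\<phi> \<in> borel_measurable borel" for \<phi> :: "real \<Rightarrow> 'b::{banach, second_countable_topology}" and N
    unfolding \<rho>_def
    by (subst integral_point_measure_distr)
       (auto simp: scaleR_right.sum divide_inverse mult.commute harm_nonneg intro!: sum.cong simp del: sum.cl_ivl_Suc)
  \<comment> \<open>True also for \<open>N = 0\<close>: as \<open>ln 1\<close> is 0 and division by
    0 yields 0, both sides vanish.\<close>
  have conv_eq: "(\<integral>x. \<phi> x \<partial>log_average_measure u (Suc N)) = (harm (Suc N) / ln (Suc N)) *\<^sub>R (\<integral>x. \<phi> x \<partial>\<rho> N)"
    if [measurable]: "\<phi> \<in> borel_measurable borel" for \<phi> :: "real \<Rightarrow> 'b::{banach, second_countable_topology}" and N
    using harm_neq[of N] by (simp add: log_eq \<rho>_eq divide_inverse del: sum.cl_ivl_Suc)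
  have ratio: "(\<lambda>N. harm (Suc N) / ln (real (Suc N))) \<longlonglongrightarrow> (1::real)"
    using harm_over_ln_tendsto_1 by (rule LIMSEQ_Suc)
  have "AE t in lborel. (\<lambda>N. char (\<rho> N) t) \<longlonglongrightarrow> char (centred_normal_law v) t"
    using lim
  proof eventually_elim
    case (elim t)
    have "(\<lambda>N. \<integral>x. iexp (t * x) \<partial>log_average_measure u (Suc N)) \<longlonglongrightarrow> of_real (exp (- t\<^sup>2 * v / 2))"
    proof -
      have "(1 / real k) *\<^sub>R z = z / of_nat k" "z /\<^sub>R a = z / of_real a" for k :: nat and a :: real and z :: complex
        by (simp_all add: scaleR_conv_of_real divide_inverse)
      then have "(\<integral>x. iexp (t * x) \<partial>log_average_measure u N) =
          (\<Sum>k=1..N. exp (\<i> * of_real (t * u k)) / of_nat k) / of_real (ln N)" for N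
        using log_eq[of "\<lambda>x. iexp (t * x)" N] by simp
      then show ?thesis using LIMSEQ_Suc[OF elim] by simp
    qed
    then have "(\<lambda>N. inverse (harm (Suc N) / ln (real (Suc N))) *\<^sub>R (\<integral>x. iexp (t * x) \<partial>log_average_measure u (Suc N)))
        \<longlonglongrightarrow> inverse 1 *\<^sub>R of_real (exp (- t\<^sup>2 * v / 2))"
      by (intro tendsto_intros ratio) auto
    moreover have "eventually (\<lambda>N. inverse (harm (Suc N) / ln (real (Suc N))) *\<^sub>R (\<integral>x. iexp (t * x) \<partial>log_average_measure u (Suc N))
        = char (\<rho> N) t) sequentially"
      using eventually_gt_at_top[of 0]
    proof eventually_elim
      case (elim N)
      then have "ln (real (Suc N)) > 0" by simp
      then show ?case using harm_neq[of N] by (simp add: conv_eq char_def del: of_nat_Suc)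
    qed
    ultimately have "(\<lambda>N. char (\<rho> N) t) \<longlonglongrightarrow> inverse 1 *\<^sub>R of_real (exp (- t\<^sup>2 * v / 2))"
      by (rule Lim_transform_eventually)
    then show ?case by (simp add: char_centred_normal_law[OF v])
  qed
  then have wc: "weak_conv_m \<rho> (centred_normal_law v)"
    by (intro levy_continuity \<rho> \<nu> char_tendsto_of_AE)
  show ?thesis
    unfolding weakly_converges_def
  proof (intro allI impI, elim conjE)
    fix \<phi> :: "real \<Rightarrow> real" assume cont: "continuous_on UNIV \<phi>" and bdd: "bounded (range \<phi>)"
    obtain B where B: "\<And>x. norm (\<phi> x) \<le> B" using bdd by (auto simp: bounded_iff)
    have [measurable]: "\<phi> \<in> borel_measurable borel" using cont by (rule borel_measurable_continuous_onI)
    have "(\<lambda>N. \<integral>x. \<phi> x \<partial>\<rho> N) \<longlonglongrightarrow> (\<integral>x. \<phi> x \<partial>centred_normal_law v)"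
      using \<rho> \<nu> wc by (rule weak_conv_imp_integral_bdd_continuous_conv)
        (use cont B in \<open>auto simp: continuous_on_eq_continuous_at\<close>)
    from tendsto_scaleR[OF ratio this]
    have "(\<lambda>N. \<integral>x. \<phi> x \<partial>log_average_measure u (Suc N)) \<longlonglongrightarrow> (\<integral>x. \<phi> x \<partial>centred_normal_law v)"
      by (simp add: conv_eq)
    then show "(\<lambda>N. \<integral>x. \<phi> x \<partial>log_average_measure u N) \<longlonglongrightarrow> (\<integral>x. \<phi> x \<partial>centred_normal_law v)"
      by (rule LIMSEQ_imp_Suc)
  qed
qed

text \<open>The radii \<open>1 / Suc j\<close> reduce convergence to countably many quantifiers.
  Joint measurability in orbit and frequency is what the exchange of null sets requires.\<close>

lemma pred_tendsto_sequentially: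
  fixes X :: "nat \<Rightarrow> 'a \<Rightarrow> 'b::{second_countable_topology, metric_space}"
  assumes [measurable]: "\<And>n. X n \<in> borel_measurable M" "L \<in> borel_measurable M"
  shows "Measurable.pred M (\<lambda>x. (\<lambda>n. X n x) \<longlonglongrightarrow> L x)"
proof -
  have "(\<lambda>n. X n x) \<longlonglongrightarrow> L x \<longleftrightarrow> (\<forall>j::nat. \<exists>n0. \<forall>n\<ge>n0. dist (X n x) (L x) < 1 / Suc j)" for x
    unfolding lim_sequentially
  proof safe
    fix e :: real assume *: "\<forall>j::nat. \<exists>n0. \<forall>n\<ge>n0. dist (X n x) (L x) < 1 / Suc j" and "e > 0"
    then obtain j where "1 / real (Suc j) < e" using nat_approx_posE by blast
    with * show "\<exists>n0. \<forall>n\<ge>n0. dist (X n x) (L x) < e" by (meson less_trans)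
  qed (simp del: of_nat_Suc)
  then show ?thesis by simp
qed

lemma tight_of_scaled_tail_bound:
  assumes X: "\<And>n. real_distribution (\<mu> n)" and nonneg: "\<And>n. measure (\<mu> n) {x. x < 0} = 0"
    and tail: "\<And>n B. B > 0 \<Longrightarrow> measure (\<mu> n) {x. x \<ge> B} \<le> C / B\<^sup>2"
  shows "tight \<mu>"
  unfolding tight_def
proof (intro conjI allI impI X)
  fix e :: real assume e: "e > 0"
  have C: "C \<ge> 0" using order_trans[OF measure_nonneg tail[of 1 0]] by simp
  \<comment> \<open>The excess 1 makes \<open>C / B\<^sup>2\<close> strictly smaller than
    \<open>e\<close>, and keeps \<open>B\<close> positive when \<open>C\<close> is 0.\<close>
  define B where "B = sqrt ((C + 1) / e)"
  have B: "B > 0" "B\<^sup>2 = (C + 1) / e" using C e by (auto simp: B_def)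
  \<comment> \<open>The predicate \<open>tight\<close> uses intervals open on the left; starting at
    -1 keeps a possible atom at 0 inside.\<close>
  have "1 - e < measure (\<mu> n) {-1<..B}" for n
  proof -
    interpret real_distribution "\<mu> n" by (rule X)
    have "UNIV = {-1<..B} \<union> ({x. x < 0} \<union> {x. x \<ge> B})" by auto
    then have "1 = measure (\<mu> n) ({-1<..B} \<union> ({x. x < 0} \<union> {x. x \<ge> B}))"
      using prob_space by simp
    also have "\<dots> \<le> measure (\<mu> n) {-1<..B} + (measure (\<mu> n) {x. x < 0} + measure (\<mu> n) {x. x \<ge> B})"
      by (intro order_trans[OF measure_Un_le] add_left_mono measure_Un_le) auto
    also have "\<dots> \<le> measure (\<mu> n) {-1<..B} + C / B\<^sup>2"
      using nonneg[of n] tail[OF B(1), of n] by simp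
    also have "C / B\<^sup>2 < e" unfolding B(2) using C e by (simp add: field_simps)
    finally show ?thesis by simp
  qed
  then show "\<exists>a b. a < b \<and> (\<forall>n. 1 - e < measure (\<mu> n) {a<..b})"
    using B by (intro exI[of _ "-1"] exI[of _ B]) auto
qed

section \<open>Limit theorems for functions cohomologous to a reverse martingale difference\<close>

context reverse_martingale_difference
begin

lemma limit_theorems_of_cohomologous:
  assumes f [measurable]: "f \<in> borel_measurable M" and v [measurable]: "v \<in> borel_measurable M"
    and v_sq: "integrable M (\<lambda>x. (v x)\<^sup>2)"
    and cob: "AE x in M. \<forall>k. birkhoff_sum T f k x = S k x + v x - v ((T ^^ k) x)"
  shows "converges_with_tight_maxima M (birkhoff_sum T f) (\<lambda>n. sqrt (real n)) (centred_normal_law \<sigma>2)"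
    and "almost_sure_limit_theorem M (birkhoff_sum T f) (\<lambda>n. sqrt (real n)) (centred_normal_law \<sigma>2)"
proof -
  let ?f = "birkhoff_sum T f"
  have near: "AE x in M. (\<lambda>k. (?f k x - S k x) / sqrt k) \<longlonglongrightarrow> 0"
    using cob AE_sqrt_orbit_tendsto_0[OF v_sq]
  proof eventually_elim
    case (elim x)
    have "filterlim (\<lambda>k. sqrt (real k)) at_top sequentially"
      by (rule filterlim_compose[OF sqrt_at_top filterlim_real_sequentially])
    then have "(\<lambda>k. v x / sqrt (real k)) \<longlonglongrightarrow> 0"
      by (rule real_tendsto_divide_at_top[OF tendsto_const])
    from tendsto_diff[OF this elim(2)] show ?case
      by (simp add: elim(1) diff_divide_distrib)
  qed
  have law: "real_distribution (centred_normal_law \<sigma>2)"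
    using \<sigma>2_nonneg by (rule real_distribution_centred_normal_law)
  have "weak_conv_m (\<lambda>n. distr M borel (\<lambda>\<omega>. ?f n \<omega> / sqrt (real n))) (centred_normal_law \<sigma>2)"
  proof (rule levy_continuity[OF _ law])
    show "real_distribution (distr M borel (\<lambda>\<omega>. ?f n \<omega> / sqrt (real n)))" for n
      by (rule real_distribution_distr) measurable
    fix t
    have "char (distr M borel (\<lambda>\<omega>. ?f n \<omega> / sqrt (real n))) t =
        (\<integral>x. exp (\<i> * of_real (t * (?f n x / sqrt n))) \<partial>M)" for n
      unfolding char_def by (subst integral_distr) auto
    then show "(\<lambda>n. char (distr M borel (\<lambda>\<omega>. ?f n \<omega> / sqrt (real n))) t) \<longlonglongrightarrow> char (centred_normal_law \<sigma>2) t"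
      using char_birkhoff_sum_tendsto[OF f near, of t] by (simp add: char_centred_normal_law[OF \<sigma>2_nonneg])
  qed
  moreover have "tight (\<lambda>n. distr M borel (\<lambda>\<omega>. Max ((\<lambda>k. \<bar>?f k \<omega>\<bar>) ` {1..Suc n}) / sqrt (Suc n)))"
  proof (rule tight_of_scaled_tail_bound)
    fix n :: nat
    let ?X = "\<lambda>\<omega>. Max ((\<lambda>k. \<bar>?f k \<omega>\<bar>) ` {1..Suc n}) / sqrt (Suc n)"
    have [measurable]: "?X \<in> borel_measurable M" by measurable
    show "real_distribution (distr M borel ?X)"
      by (rule real_distribution_distr) measurable
    have pos: "0 \<le> Max ((\<lambda>k. \<bar>?f k x\<bar>) ` {1..Suc n})" for x
    proof -
      have "\<bar>?f 1 x\<bar> \<in> (\<lambda>k. \<bar>?f k x\<bar>) ` {1..Suc n}" by (rule image_eqI[of _ _ 1]) auto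
      then show ?thesis by (intro order_trans[OF abs_ge_zero Max_ge]) auto
    qed
    have "?X -` {x. x < 0} \<inter> space M = {}"
      using pos by (auto simp: not_less divide_less_0_iff)
    then show "measure (distr M borel ?X) {x. x < 0} = 0"
      by (subst measure_distr) auto
    fix B :: real assume B: "B > 0"
    have "measure (distr M borel ?X) {x. x \<ge> B} = measure M (?X -` {x. x \<ge> B} \<inter> space M)"
      by (rule measure_distr) auto
    also have "\<dots> \<le> measure M {x \<in> space M. \<exists>k\<le>Suc n. \<bar>?f k x\<bar> \<ge> B * sqrt (Suc n)}"
    proof (rule finite_measure_mono)
      show "?X -` {x. x \<ge> B} \<inter> space M \<subseteq> {x \<in> space M. \<exists>k\<le>Suc n. \<bar>?f k x\<bar> \<ge> B * sqrt (Suc n)}"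
      proof safe
        fix x assume "B \<le> ?X x"
        then have "B * sqrt (Suc n) \<le> Max ((\<lambda>k. \<bar>?f k x\<bar>) ` {1..Suc n})"
          by (simp add: pos_le_divide_eq)
        moreover have "Max ((\<lambda>k. \<bar>?f k x\<bar>) ` {1..Suc n}) \<in> (\<lambda>k. \<bar>?f k x\<bar>) ` {1..Suc n}"
          by (intro Max_in) auto
        then obtain k where "k \<in> {1..Suc n}" "Max ((\<lambda>k. \<bar>?f k x\<bar>) ` {1..Suc n}) = \<bar>?f k x\<bar>"
          by (rule imageE)
        ultimately show "\<exists>k\<le>Suc n. \<bar>?f k x\<bar> \<ge> B * sqrt (Suc n)"
          by (intro exI[of _ k]) simp
      qed
    qed measurable
    also have "\<dots> \<le> (16 * \<sigma>2 + 32 * (\<integral>x. (v x)\<^sup>2 \<partial>M)) / B\<^sup>2"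
      by (rule maximal_inequality_coboundary[OF f v v_sq cob B]) simp
    finally show "measure (distr M borel ?X) {x. x \<ge> B} \<le> (16 * \<sigma>2 + 32 * (\<integral>x. (v x)\<^sup>2 \<partial>M)) / B\<^sup>2" .
  qed
  ultimately show "converges_with_tight_maxima M ?f (\<lambda>n. sqrt (real n)) (centred_normal_law \<sigma>2)"
    unfolding converges_with_tight_maxima_def by simp
  interpret pair_sigma_finite M lborel ..
  let ?conv = "\<lambda>x t. (\<lambda>N. (\<Sum>k=1..N. exp (\<i> * of_real (t * (?f k x / sqrt k))) / of_nat k) / of_real (ln N))
      \<longlonglongrightarrow> of_real (exp (- t\<^sup>2 * \<sigma>2 / 2))"
  \<comment> \<open>For each \<open>t\<close> there is a null set of orbits;
    \<open>AE_commute\<close> turns this into a null set of \<open>t\<close> for almost every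
    orbit.\<close>
  have "AE t in lborel. AE x in M. ?conv x t"
    using AE_log_average_iexp_tendsto[OF f near] by simp
  moreover have "Measurable.pred (M \<Otimes>\<^sub>M lborel) (\<lambda>p. ?conv (fst p) (snd p))"
    by (rule pred_tendsto_sequentially) measurable
  then have "{p \<in> space (M \<Otimes>\<^sub>M lborel). ?conv (fst p) (snd p)} \<in> sets (M \<Otimes>\<^sub>M lborel)"
    by (rule predE)
  ultimately have "AE x in M. AE t in lborel. ?conv x t"
    by (subst AE_commute) auto
  then show "almost_sure_limit_theorem M ?f (\<lambda>n. sqrt (real n)) (centred_normal_law \<sigma>2)"
    unfolding almost_sure_limit_theorem_def
    by eventually_elim (rule weakly_converges_log_average_measure[OF \<sigma>2_nonneg])
qed

end

section \<open>Martingale approximation\<close>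

lemma sets_sigma_of_sigma_algebra: "sigma_algebra \<Omega> F \<Longrightarrow> sets (sigma \<Omega> F) = F"
  by (simp add: sigma_algebra.sets_measure_of_eq)

lemma space_sigma_of_sigma_algebra: "sigma_algebra \<Omega> F \<Longrightarrow> space (sigma \<Omega> F) = \<Omega>"
  by (simp add: sigma_algebra.space_measure_of_eq)

lemma subalgebra_sigma:
  "sigma_algebra (space M) F \<Longrightarrow> F \<subseteq> sets M \<Longrightarrow> subalgebra M (sigma (space M) F)"
  by (simp add: subalgebra_def sets_sigma_of_sigma_algebra space_sigma_of_sigma_algebra)

section \<open>Series and projections in L2\<close>

context prob_space
begin

lemma integrable_bounded_square:
  fixes \<phi> :: "'a \<Rightarrow> 'b::{real_normed_vector, second_countable_topology}"
  assumes [measurable]: "\<phi> \<in> borel_measurable M" and b: "\<And>x. norm (\<phi> x) \<le> B"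
  shows "integrable M (\<lambda>x. (norm (\<phi> x))\<^sup>2)"
proof (rule integrable_const_bound[of _ "B\<^sup>2"])
  have "(norm (\<phi> x))\<^sup>2 \<le> B\<^sup>2" for x by (intro power_mono b) auto
  then show "AE x in M. norm ((norm (\<phi> x))\<^sup>2) \<le> B\<^sup>2" by simp
qed measurable

text \<open>Completeness of \<open>L\<^sup>2\<close> in pointwise form, by the weighted Cauchy--Schwarz inequality
  \<open>(\<Sum> \<bar>g\<^sub>i\<bar>)\<^sup>2 \<le> (\<Sum> \<alpha>\<^sub>i) (\<Sum> g\<^sub>i\<^sup>2 / \<alpha>\<^sub>i)\<close> with \<open>\<alpha>\<^sub>i\<close> slightly above the norm of \<open>g\<^sub>i\<close>.\<close>

lemma L2_series:
  fixes g :: "nat \<Rightarrow> 'a \<Rightarrow> real"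
  assumes [measurable]: "\<And>i. g i \<in> borel_measurable M" and sq: "\<And>i. integrable M (\<lambda>x. (g i x)\<^sup>2)"
    and summ: "summable (\<lambda>i. L2_norm M (g i))"
  shows "AE x in M. summable (\<lambda>i. \<bar>g i x\<bar>)" "integrable M (\<lambda>x. (\<Sum>i. g i x)\<^sup>2)"
proof -
  \<comment> \<open>The geometric term keeps \<open>\<alpha> i\<close> positive when
    \<open>g i\<close> vanishes almost everywhere, and preserves summability.\<close>
  define \<alpha> where "\<alpha> i = L2_norm M (g i) + (1 / 2) ^ i" for i
  have \<alpha>: "\<alpha> i > 0" for i using L2_norm_nonneg[of M "g i"] by (simp add: \<alpha>_def add_nonneg_pos)
  have summ_\<alpha>: "summable \<alpha>" unfolding \<alpha>_def by (intro summable_add summ summable_geometric) auto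
  define G where "G i x = (g i x)\<^sup>2 / \<alpha> i" for i x
  have G_nonneg: "0 \<le> G i x" for i x using \<alpha>[of i] by (simp add: G_def)
  have G_int: "integrable M (G i)" for i unfolding G_def using sq by simp
  have G_le: "(\<integral>x. norm (G i x) \<partial>M) \<le> \<alpha> i" for i
  proof -
    have "(\<integral>x. norm (G i x) \<partial>M) = (L2_norm M (g i))\<^sup>2 / \<alpha> i"
      using G_nonneg less_imp_le[OF \<alpha>] by (simp add: G_def L2_norm_square)
    also have "\<dots> \<le> (\<alpha> i)\<^sup>2 / \<alpha> i"
      using \<alpha>[of i] by (intro divide_right_mono power_mono L2_norm_nonneg) (auto simp: \<alpha>_def)
    also have "\<dots> = \<alpha> i" using \<alpha>[of i] by (simp add: power2_eq_square)
    finally show ?thesis .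
  qed
  have G_summ: "summable (\<lambda>i. \<integral>x. norm (G i x) \<partial>M)"
    by (rule summable_comparison_test'[OF summ_\<alpha>, of 0]) (use G_le in \<open>auto simp: integral_nonneg_AE\<close>)
  have AE_G: "AE x in M. summable (\<lambda>i. norm (G i x))"
    by (rule AE_summable_of_integral_norm[OF G_int G_summ])
  have key: "summable (\<lambda>i. \<bar>g i x\<bar>) \<and> (\<Sum>i. g i x)\<^sup>2 \<le> suminf \<alpha> * (\<Sum>i. G i x)"
    if "summable (\<lambda>i. norm (G i x))" for x
  proof -
    have sG: "summable (\<lambda>i. G i x)" using that by (rule summable_norm_cancel)
    have gG: "\<bar>g i x\<bar> = sqrt (\<alpha> i) * sqrt (G i x)" for i
      using \<alpha>[of i] by (simp add: G_def real_sqrt_mult[symmetric])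
    have "norm \<bar>g i x\<bar> \<le> \<alpha> i + G i x" for i
      using arith_geo_mean_sqrt[of "\<alpha> i" "G i x"] \<alpha>[of i] G_nonneg[of i x]
      by (simp add: gG real_sqrt_mult)
    then have s: "summable (\<lambda>i. \<bar>g i x\<bar>)"
      by (intro summable_comparison_test'[OF summable_add[OF summ_\<alpha> sG], of 0]) auto
    have "(\<Sum>i<n. \<bar>g i x\<bar>)\<^sup>2 \<le> suminf \<alpha> * (\<Sum>i. G i x)" for n
    proof -
      have "(\<Sum>i<n. \<bar>g i x\<bar>)\<^sup>2 \<le> (\<Sum>i<n. (sqrt (\<alpha> i))\<^sup>2) * (\<Sum>i<n. (sqrt (G i x))\<^sup>2)"
        unfolding gG by (rule Cauchy_Schwarz_ineq_sum)
      also have "\<dots> = (\<Sum>i<n. \<alpha> i) * (\<Sum>i<n. G i x)"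
        using \<alpha> G_nonneg by (simp add: less_imp_le)
      also have "\<dots> \<le> suminf \<alpha> * (\<Sum>i. G i x)"
        using \<alpha> G_nonneg by (intro mult_mono sum_le_suminf summ_\<alpha> sG sum_nonneg suminf_nonneg) (auto simp: less_imp_le)
      finally show ?thesis .
    qed
    moreover have "(\<lambda>n. (\<Sum>i<n. \<bar>g i x\<bar>)\<^sup>2) \<longlonglongrightarrow> (\<Sum>i. \<bar>g i x\<bar>)\<^sup>2"
      by (intro tendsto_intros summable_LIMSEQ s)
    ultimately have le: "(\<Sum>i. \<bar>g i x\<bar>)\<^sup>2 \<le> suminf \<alpha> * (\<Sum>i. G i x)"
      by (intro LIMSEQ_le_const2) auto
    have "\<bar>\<Sum>i. g i x\<bar> \<le> (\<Sum>i. \<bar>g i x\<bar>)" using s by (rule summable_rabs)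
    then have "(\<Sum>i. g i x)\<^sup>2 \<le> (\<Sum>i. \<bar>g i x\<bar>)\<^sup>2" by (simp add: abs_le_square_iff[symmetric] order_trans[OF _ abs_ge_self])
    with le s show ?thesis by auto
  qed
  show "AE x in M. summable (\<lambda>i. \<bar>g i x\<bar>)"
    using AE_G by eventually_elim (use key in blast)
  have iG: "integrable M (\<lambda>x. \<Sum>i. G i x)"
    by (rule integrable_suminf[OF G_int AE_G G_summ])
  show "integrable M (\<lambda>x. (\<Sum>i. g i x)\<^sup>2)"
  proof (rule Bochner_Integration.integrable_bound[of _ "\<lambda>x. suminf \<alpha> * (\<Sum>i. G i x)"])
    show "integrable M (\<lambda>x. suminf \<alpha> * (\<Sum>i. G i x))" using iG by simp
    show "AE x in M. norm ((\<Sum>i. g i x)\<^sup>2) \<le> norm (suminf \<alpha> * (\<Sum>i. G i x))"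
      using AE_G
    proof eventually_elim
      case (elim x)
      then have "(\<Sum>i. g i x)\<^sup>2 \<le> suminf \<alpha> * (\<Sum>i. G i x)" using key by blast
      then show ?case by (simp add: order_trans[OF _ abs_ge_self])
    qed
  qed measurable
qed

lemma real_cond_exp_square_integrable:
  assumes sub: "subalgebra M G" and [measurable]: "Y \<in> borel_measurable M" and sq: "integrable M (\<lambda>x. (Y x)\<^sup>2)"
  shows "integrable M (\<lambda>x. (real_cond_exp M G Y x)\<^sup>2)"
proof -
  interpret finite_measure_subalgebra M G by unfold_locales (rule sub)
  have "integrable M Y" using integrable_of_square[of Y] sq by auto
  then show ?thesis
    using sq by (intro integrable_convex_cond_exp[where q="\<lambda>x. x\<^sup>2" and I=UNIV]) (auto simp: convex_power2)
qed

text \<open>Pythagoras: the residual of \<open>Y\<close> is orthogonal to the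
  \<open>G\<close>-measurable difference between its conditional expectation and
  \<open>z\<close>.\<close>

lemma L2_norm_minus_real_cond_exp_le:
  assumes sub: "subalgebra M G" and [measurable]: "Y \<in> borel_measurable M" "z \<in> borel_measurable G"
    and Y: "integrable M (\<lambda>x. (Y x)\<^sup>2)" and z: "integrable M (\<lambda>x. (z x)\<^sup>2)"
  shows "L2_norm M (\<lambda>x. Y x - real_cond_exp M G Y x) \<le> L2_norm M (\<lambda>x. z x - Y x)"
proof -
  interpret finite_measure_subalgebra M G by unfold_locales (rule sub)
  let ?p = "real_cond_exp M G Y"
  have [measurable]: "z \<in> borel_measurable M" using measurable_from_subalg[OF sub] assms(3) .
  have p: "integrable M (\<lambda>x. (?p x)\<^sup>2)" by (rule real_cond_exp_square_integrable[OF sub _ Y]) measurable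
  have pz: "integrable M (\<lambda>x. (?p x - z x)\<^sup>2)"
    using integrable_square_add[of ?p M "\<lambda>x. - z x"] p z by simp
  have Yp: "integrable M (\<lambda>x. (Y x - ?p x)\<^sup>2)"
    using integrable_square_add[of Y M "\<lambda>x. - ?p x"] p Y by simp
  have i1: "integrable M (\<lambda>x. (?p x - z x) * Y x)"
    by (rule integrable_mult_of_squares) (use pz Y in auto)
  have i2: "integrable M (\<lambda>x. (?p x - z x) * ?p x)"
    by (rule integrable_mult_of_squares) (use pz p in auto)
  have "(\<integral>x. (?p x - z x) * ?p x \<partial>M) = (\<integral>x. (?p x - z x) * Y x \<partial>M)"
    by (rule real_cond_exp_intg(2)[OF i1]) measurable
  then have cross: "(\<integral>x. (?p x - z x) * Y x - (?p x - z x) * ?p x \<partial>M) = 0"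
    using i1 i2 by simp
  have "(z x - Y x)\<^sup>2 = (Y x - ?p x)\<^sup>2 + (2 * ((?p x - z x) * Y x - (?p x - z x) * ?p x) + (?p x - z x)\<^sup>2)" for x
    by (simp add: power2_eq_square algebra_simps)
  then have "(\<integral>x. (z x - Y x)\<^sup>2 \<partial>M) = (\<integral>x. (Y x - ?p x)\<^sup>2 \<partial>M) + (\<integral>x. (?p x - z x)\<^sup>2 \<partial>M)"
    using Yp pz i1 i2 cross by simp
  then have "(\<integral>x. (Y x - ?p x)\<^sup>2 \<partial>M) \<le> (\<integral>x. (z x - Y x)\<^sup>2 \<partial>M)"
    by (simp add: integral_nonneg_AE)
  then show ?thesis by (simp add: L2_norm_def)
qed

end

text \<open>The sum condition on the future is stated for \<open>E(f \<circ> T\<^sup>i | F)\<close> rather than for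
  \<open>E(f | T\<^sup>iF) \<circ> T\<^sup>i\<close>. The former is the better approximation of \<open>f \<circ> T\<^sup>i\<close>, and with it the
  martingale part of \<open>f\<close> lives on the original space even when \<open>T\<close> is not invertible.\<close>

locale gordin_condition = ergodic_system M T for M :: "'a measure" and T +
  fixes F :: "'a set set" and f :: "'a \<Rightarrow> real"
  assumes F: "sigma_algebra (space M) F" "F \<subseteq> sets M"
    and surj: "T ` space M = space M"
    and vimage_F: "\<And>A. A \<in> F \<Longrightarrow> T -` A \<inter> space M \<in> F"
    and f_M [measurable]: "f \<in> borel_measurable M" and f_sq: "integrable M (\<lambda>x. (f x)\<^sup>2)"
    and future: "summable (\<lambda>i. L2_norm M (\<lambda>x. f ((T ^^ i) x) - cond_exp_on M F (\<lambda>x. f ((T ^^ i) x)) x))"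
    and past: "summable (\<lambda>n. L2_norm M (cond_exp_on M (preimage_family M T n F) f))"
begin

definition G :: "'a measure" where "G = sigma (space M) F"
definition p :: "nat \<Rightarrow> 'a \<Rightarrow> real" where "p i = cond_exp_on M F (\<lambda>x. f ((T ^^ i) x))"
definition a :: "nat \<Rightarrow> 'a \<Rightarrow> real" where "a i x = f ((T ^^ i) x) - p i x"
definition c :: "nat \<Rightarrow> 'a \<Rightarrow> real" where "c k = cond_exp_on M (preimage_family M T k F) f"
text \<open>The Doob-Dynkin factor of \<open>c k\<close> through \<open>T ^^ k\<close>. By
  \<open>c_eq_r\<close> the preimage chosen by \<open>inv_into\<close> does not matter.\<close>

definition r :: "nat \<Rightarrow> 'a \<Rightarrow> real" where "r k y = c k (inv_into (space M) (T ^^ k) y)"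
text \<open>One step of the telescoping from \<open>f\<close> to \<open>m\<close>. Written with
  \<open>p\<close> and \<open>r\<close> alone it is \<open>G\<close>-measurable, which the functions
  \<open>a i\<close> need not be.\<close>

definition d :: "nat \<Rightarrow> 'a \<Rightarrow> real" where "d i x = (p (Suc i) x - p i (T x)) + (r i x - r (Suc i) (T x))"
definition m :: "'a \<Rightarrow> real" where "m x = (\<Sum>i. d i x)"
definition v :: "'a \<Rightarrow> real" where "v x = (\<Sum>i. a i x) - (\<Sum>i. r (Suc i) x)"

lemma sets_G [simp]: "sets G = F" and space_G [simp]: "space G = space M"
  unfolding G_def using F by (simp_all add: sets_sigma_of_sigma_algebra space_sigma_of_sigma_algebra)

lemma subalg: "subalgebra M G"
  unfolding G_def by (rule subalgebra_sigma[OF F])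

lemma meas_M: "h \<in> measurable G N \<Longrightarrow> h \<in> measurable M N"
  using measurable_from_subalg[OF subalg] .

lemma T_G [measurable]: "T \<in> measurable G G"
  using vimage_F by (intro measurableI) auto

lemma T_pow_G [measurable]: "T ^^ n \<in> measurable G G"
  using measurable_compose_n[OF T_G] .

lemma surj_pow: "(T ^^ n) ` space M = space M"
proof (induction n)
  case (Suc n)
  have "(T ^^ Suc n) ` space M = T ` ((T ^^ n) ` space M)" by (simp add: image_image)
  then show ?case by (simp only: Suc surj)
qed simp

lemma preimage_family_eq: "preimage_family M T k F = sets (vimage_algebra (space M) (T ^^ k) G)"
  unfolding preimage_family_def by (subst sets_vimage_algebra2) auto

definition C :: "nat \<Rightarrow> 'a measure" where "C k = sigma (space M) (preimage_family M T k F)"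

lemma sets_C: "sets (C k) = preimage_family M T k F"
  unfolding C_def preimage_family_eq
  using sets.sigma_algebra_axioms[of "vimage_algebra (space M) (T ^^ k) G"]
  by (intro sets_sigma_of_sigma_algebra) simp

lemma space_C [simp]: "space (C k) = space M"
proof -
  have "preimage_family M T k F \<subseteq> Pow (space M)" by (auto simp: preimage_family_def)
  then show ?thesis unfolding C_def by (rule space_measure_of)
qed

lemma subalg_C: "subalgebra M (C k)"
proof -
  have "preimage_family M T k F \<subseteq> sets M"
    using F(2) by (auto simp: preimage_family_def)
  then show ?thesis by (simp add: subalgebra_def sets_C)
qed

lemma T_pow_C [measurable]: "T ^^ k \<in> measurable (C k) G"
proof (rule measurableI)
  fix A assume "A \<in> sets G"
  then show "(T ^^ k) -` A \<inter> space (C k) \<in> sets (C k)"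
    unfolding sets_C preimage_family_def by auto
qed simp

lemma c_C [measurable]: "c k \<in> borel_measurable (C k)"
  unfolding c_def cond_exp_on_def C_def[symmetric] by measurable

lemma c_M [measurable]: "c k \<in> borel_measurable M"
  using measurable_from_subalg[OF subalg_C] c_C .

lemma p_G [measurable]: "p i \<in> borel_measurable G"
  unfolding p_def cond_exp_on_def G_def[symmetric] by measurable

lemma p_M [measurable]: "p i \<in> borel_measurable M"
  by (rule meas_M) measurable

lemma a_M [measurable]: "a i \<in> borel_measurable M"
  unfolding a_def by measurable

lemma c_vimage:
  assumes "S \<in> sets borel"
  obtains A where "A \<in> F" "c k -` S \<inter> space M = (T ^^ k) -` A \<inter> space M"
  using measurable_sets[OF c_C assms, of k] unfolding sets_C preimage_family_def by auto

lemma inv_pow: "y \<in> space M \<Longrightarrow> inv_into (space M) (T ^^ k) y \<in> space M \<and> (T ^^ k) (inv_into (space M) (T ^^ k) y) = y"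
  using surj_pow[of k] by (metis f_inv_into_f inv_into_into)

text \<open>A function measurable for T^-k F is constant on the fibres of T^k: its level set through
  \<open>x\<close> is a full preimage under \<open>T ^^ k\<close>.\<close>

lemma c_eq_r: assumes x: "x \<in> space M" shows "c k x = r k ((T ^^ k) x)"
proof -
  let ?x' = "inv_into (space M) (T ^^ k) ((T ^^ k) x)"
  have x': "?x' \<in> space M" "(T ^^ k) ?x' = (T ^^ k) x" using inv_pow[of "(T ^^ k) x" k] x by auto
  have "{c k x} \<in> sets borel" by simp
  then obtain A where "A \<in> F" and A: "c k -` {c k x} \<inter> space M = (T ^^ k) -` A \<inter> space M"
    by (rule c_vimage)
  then have "(T ^^ k) x \<in> A" using x by auto
  then have "?x' \<in> (T ^^ k) -` A \<inter> space M" using x' by auto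
  then show ?thesis unfolding A[symmetric] r_def by auto
qed

text \<open>An exact identity, not one up to null sets: if \<open>S\<close> has preimage T^-k A
  under \<open>c k\<close>, then it has preimage \<open>A\<close> under \<open>r k\<close>, since
  T^k is onto.\<close>

lemma r_G [measurable]: "r k \<in> borel_measurable G"
proof (rule measurableI)
  fix S :: "real set" assume "S \<in> sets borel"
  then obtain A where A: "A \<in> F" "c k -` S \<inter> space M = (T ^^ k) -` A \<inter> space M" by (rule c_vimage)
  have "y \<in> r k -` S \<longleftrightarrow> y \<in> A" if y: "y \<in> space M" for y
  proof -
    have "y \<in> r k -` S \<longleftrightarrow> inv_into (space M) (T ^^ k) y \<in> c k -` S \<inter> space M"
      using inv_pow[OF y, of k] by (simp add: r_def)
    also have "\<dots> \<longleftrightarrow> y \<in> A" unfolding A(2) using inv_pow[OF y, of k] by simp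
    finally show ?thesis .
  qed
  moreover have "A \<subseteq> space M" using A(1) F(2) sets.sets_into_space by blast
  ultimately have "r k -` S \<inter> space G = A" by auto
  then show "r k -` S \<inter> space G \<in> sets G" using A(1) by simp
qed simp

lemma r_M [measurable]: "r k \<in> borel_measurable M"
  by (rule meas_M) measurable

text \<open>The future series and the past series join at index 0, where both involve E(f | F);
  hence \<open>a 0 + r 0\<close> gives back \<open>f\<close>.\<close>

lemma r_0: "x \<in> space M \<Longrightarrow> r 0 x = p 0 x"
proof -
  assume x: "x \<in> space M"
  have inter: "(T ^^ 0) -` A \<inter> space M = A" if "A \<in> F" for A
    using that F(2) sets.sets_into_space[of A M] by auto
  have "preimage_family M T 0 F = F"
    unfolding preimage_family_def
    by (rule set_eqI, unfold mem_Collect_eq) (metis inter)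
  then show ?thesis using c_eq_r[OF x, of 0] by (simp add: c_def p_def)
qed

lemma f_pow_sq: "integrable M (\<lambda>x. (f ((T ^^ i) x))\<^sup>2)"
  using integrable_T_pow[OF f_sq] .

lemma p_sq: "integrable M (\<lambda>x. (p i x)\<^sup>2)"
  unfolding p_def cond_exp_on_def G_def[symmetric]
  by (rule real_cond_exp_square_integrable[OF subalg _ f_pow_sq]) measurable

lemma a_sq: "integrable M (\<lambda>x. (a i x)\<^sup>2)"
  unfolding a_def using integrable_square_add[of "\<lambda>x. f ((T ^^ i) x)" M "\<lambda>x. - p i x"] f_pow_sq p_sq by simp

lemma c_sq: "integrable M (\<lambda>x. (c k x)\<^sup>2)"
  unfolding c_def cond_exp_on_def C_def[symmetric]
  by (rule real_cond_exp_square_integrable[OF subalg_C _ f_sq]) measurable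

lemma r_sq: "integrable M (\<lambda>x. (r k x)\<^sup>2)" and r_norm: "L2_norm M (r k) = L2_norm M (c k)"
proof -
  have eq: "(r k ((T ^^ k) x))\<^sup>2 = (c k x)\<^sup>2" if "x \<in> space M" for x using c_eq_r[OF that] by simp
  have "integrable M (\<lambda>x. (r k ((T ^^ k) x))\<^sup>2)"
    using c_sq[of k] by (subst Bochner_Integration.integrable_cong[OF refl eq]) auto
  then have "integrable (distr M M (T ^^ k)) (\<lambda>x. (r k x)\<^sup>2)"
    by (subst integrable_distr_eq) auto
  then show "integrable M (\<lambda>x. (r k x)\<^sup>2)" by (simp add: distr_T_pow)
  have "(\<integral>x. (r k x)\<^sup>2 \<partial>M) = (\<integral>x. (r k ((T ^^ k) x))\<^sup>2 \<partial>M)"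
    using integral_T_pow[of "\<lambda>x. (r k x)\<^sup>2" k] by simp
  also have "\<dots> = (\<integral>x. (c k x)\<^sup>2 \<partial>M)" using eq by (intro Bochner_Integration.integral_cong) auto
  finally show "L2_norm M (r k) = L2_norm M (c k)" by (simp add: L2_norm_def)
qed

lemma summable_a: "summable (\<lambda>i. L2_norm M (a i))"
  using future by (simp add: a_def[abs_def] p_def)

lemma summable_r: "summable (\<lambda>i. L2_norm M (r i))"
  using past by (simp add: r_norm c_def)

lemmas a_series = L2_series[OF a_M a_sq summable_a]
lemmas r_series = L2_series[OF r_M r_sq summable_r[THEN summable_Suc_iff[THEN iffD2]]]

text \<open>The values of \<open>f\<close> at \<open>(T ^^ Suc i) x\<close> cancel. This form shows
  the convergence, the defining one shows the measurability.\<close>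

lemma d_eq: "d i x = (a i (T x) - a (Suc i) x) + (r i x - r (Suc i) (T x))"
  by (simp add: d_def a_def funpow_swap1)

lemma d_G [measurable]: "d i \<in> borel_measurable G"
  unfolding d_def by measurable

lemma d_M [measurable]: "d i \<in> borel_measurable M"
  by (rule meas_M) measurable

lemma m_G [measurable]: "m \<in> borel_measurable G"
  unfolding m_def by measurable

lemma m_M [measurable]: "m \<in> borel_measurable M"
  by (rule meas_M) measurable

lemma v_M [measurable]: "v \<in> borel_measurable M"
  unfolding v_def by measurable

lemma v_sq: "integrable M (\<lambda>x. (v x)\<^sup>2)"
  unfolding v_def
  using integrable_square_add[of "\<lambda>x. \<Sum>i. a i x" M "\<lambda>x. - (\<Sum>i. r (Suc i) x)"] a_series(2) r_series(2)
  by simp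

text \<open>Both series telescope after an index shift. The future one leaves \<open>a 0\<close>
  behind, the past one \<open>r 0\<close>, and these add up to \<open>f\<close>.\<close>

lemma AE_decomposition: "AE x in M. f x = m x + v x - v (T x)"
  using a_series(1) r_series(1) AE_T_pow[OF a_series(1), of 1] AE_T_pow[OF r_series(1), of 1] AE_space
proof eventually_elim
  case (elim x)
  have a: "(\<lambda>i. a i x) sums (\<Sum>i. a i x)" "(\<lambda>i. a i (T x)) sums (\<Sum>i. a i (T x))"
    using elim by (auto intro!: summable_sums summable_rabs_cancel)
  have r: "(\<lambda>i. r (Suc i) x) sums (\<Sum>i. r (Suc i) x)" "(\<lambda>i. r (Suc i) (T x)) sums (\<Sum>i. r (Suc i) (T x))"
    using elim by (auto intro!: summable_sums summable_rabs_cancel)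
  have a': "(\<lambda>i. a (Suc i) x) sums ((\<Sum>i. a i x) - a 0 x)"
    using a(1) by (subst sums_Suc_iff) simp
  have r': "(\<lambda>i. r i x) sums ((\<Sum>i. r (Suc i) x) + r 0 x)"
    using r(1) by (subst (asm) sums_Suc_iff)
  have "(\<lambda>i. d i x) sums (((\<Sum>i. a i (T x)) - ((\<Sum>i. a i x) - a 0 x)) +
      ((\<Sum>i. r (Suc i) x) + r 0 x - (\<Sum>i. r (Suc i) (T x))))"
    unfolding d_eq by (intro sums_add sums_diff a a' r r')
  then have "m x = ((\<Sum>i. a i (T x)) - ((\<Sum>i. a i x) - a 0 x)) +
      ((\<Sum>i. r (Suc i) x) + r 0 x - (\<Sum>i. r (Suc i) (T x)))"
    unfolding m_def by (rule sums_unique[symmetric])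
  moreover have "a 0 x + r 0 x = f x" using r_0[OF elim(5)] by (simp add: a_def)
  ultimately show ?case by (simp add: v_def)
qed

text \<open>Inherited from \<open>f\<close> and \<open>v\<close> through the decomposition, so the
  series that defines \<open>m\<close> is spared an L2 estimate of its own.\<close>

lemma m_sq: "integrable M (\<lambda>x. (m x)\<^sup>2)"
proof -
  have "integrable M (\<lambda>x. (f x + (v (T x) + - v x))\<^sup>2)"
    using integrable_square_add[of f M "\<lambda>x. v (T x) + - v x"]
      integrable_square_add[of "\<lambda>x. v (T x)" M "\<lambda>x. - v x"] f_sq v_sq integrable_T[OF v_sq] by simp
  moreover have "AE x in M. (m x)\<^sup>2 = (f x + (v (T x) + - v x))\<^sup>2"
    using AE_decomposition by eventually_elim simp
  ultimately show ?thesis by (subst integrable_cong_AE) auto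
qed

lemma integral_p_mult:
  assumes \<phi> [measurable]: "\<phi> \<in> borel_measurable G" and b: "\<And>x. norm (\<phi> x) \<le> B"
  shows "integrable M (\<lambda>x. \<phi> x * p i x)" "(\<integral>x. \<phi> x * p i x \<partial>M) = (\<integral>x. \<phi> x * f ((T ^^ i) x) \<partial>M)"
proof -
  interpret finite_measure_subalgebra M G by unfold_locales (rule subalg)
  have [measurable]: "\<phi> \<in> borel_measurable M" by (rule meas_M) measurable
  have "integrable M (\<lambda>x. (norm (\<phi> x))\<^sup>2)"
    by (rule integrable_bounded_square[OF _ b]) measurable
  then have i: "integrable M (\<lambda>x. \<phi> x * f ((T ^^ i) x))"
    using f_pow_sq by (intro integrable_mult_of_squares) auto
  show "integrable M (\<lambda>x. \<phi> x * p i x)" "(\<integral>x. \<phi> x * p i x \<partial>M) = (\<integral>x. \<phi> x * f ((T ^^ i) x) \<partial>M)"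
    unfolding p_def cond_exp_on_def G_def[symmetric]
    by (intro real_cond_exp_intg i; measurable)+
qed

text \<open>Against \<open>G\<close>-measurable test functions, \<open>r k\<close> is the image of
  \<open>f\<close> under the adjoint of composition with \<open>T ^^ k\<close>, a transfer operator
  that exists without invertibility.\<close>

lemma integral_r_mult:
  assumes \<phi> [measurable]: "\<phi> \<in> borel_measurable G" and b: "\<And>x. norm (\<phi> x) \<le> B"
  shows "integrable M (\<lambda>x. \<phi> x * r k x)" "(\<integral>x. \<phi> x * r k x \<partial>M) = (\<integral>x. \<phi> ((T ^^ k) x) * f x \<partial>M)"
proof -
  interpret finite_measure_subalgebra M "C k" by unfold_locales (rule subalg_C)
  have [measurable]: "\<phi> \<in> borel_measurable M" by (rule meas_M) measurable
  have \<phi>_sq: "integrable M (\<lambda>x. (norm (\<phi> x))\<^sup>2)"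
    by (rule integrable_bounded_square[OF _ b]) measurable
  then show "integrable M (\<lambda>x. \<phi> x * r k x)"
    using r_sq by (intro integrable_mult_of_squares) auto
  have i: "integrable M (\<lambda>x. \<phi> ((T ^^ k) x) * f x)"
    using f_sq integrable_T_pow[OF \<phi>_sq, of k] by (intro integrable_mult_of_squares) auto
  have "(\<integral>x. \<phi> x * r k x \<partial>M) = (\<integral>x. \<phi> ((T ^^ k) x) * r k ((T ^^ k) x) \<partial>M)"
    using integral_T_pow[of "\<lambda>x. \<phi> x * r k x" k] by simp
  also have "\<dots> = (\<integral>x. \<phi> ((T ^^ k) x) * c k x \<partial>M)"
    by (intro Bochner_Integration.integral_cong) (auto simp: c_eq_r)
  also have "\<dots> = (\<integral>x. \<phi> ((T ^^ k) x) * f x \<partial>M)"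
    unfolding c_def cond_exp_on_def C_def[symmetric]
    by (rule real_cond_exp_intg(2)[OF i]) measurable
  finally show "(\<integral>x. \<phi> x * r k x \<partial>M) = (\<integral>x. \<phi> ((T ^^ k) x) * f x \<partial>M)" .
qed

text \<open>Each bracket of \<open>d i\<close> vanishes separately. Paired with \<phi> o T, both
  \<open>p (Suc i)\<close> and p_i o T give the integral of \<phi> times f o T^i; both
  \<open>r i\<close> and r_(i+1) o T give the integral of \<phi> o T^(i+1) times
  \<open>f\<close>.\<close>

lemma orth_d:
  assumes \<phi> [measurable]: "\<phi> \<in> borel_measurable G" and b: "\<And>x. norm (\<phi> x) \<le> B"
  shows "(\<integral>x. d i x * \<phi> (T x) \<partial>M) = 0"
proof -
  have \<phi>T: "(\<lambda>x. \<phi> (T x)) \<in> borel_measurable G" by measurable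
  have [measurable]: "\<phi> \<in> borel_measurable M" by (rule meas_M) measurable
  note P = integral_p_mult[OF \<phi>T b] integral_p_mult[OF \<phi> b]
  note R = integral_r_mult[OF \<phi>T b] integral_r_mult[OF \<phi> b]
  have "(\<integral>x. d i x * \<phi> (T x) \<partial>M) = (\<integral>x. (\<phi> (T x) * p (Suc i) x - \<phi> (T x) * p i (T x)) +
      (\<phi> (T x) * r i x - \<phi> (T x) * r (Suc i) (T x)) \<partial>M)"
    by (intro Bochner_Integration.integral_cong) (auto simp: d_def algebra_simps)
  also have "\<dots> = ((\<integral>x. \<phi> (T x) * p (Suc i) x \<partial>M) - (\<integral>x. \<phi> (T x) * p i (T x) \<partial>M)) +
      ((\<integral>x. \<phi> (T x) * r i x \<partial>M) - (\<integral>x. \<phi> (T x) * r (Suc i) (T x) \<partial>M))"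
    using P(1) R(1) integrable_T[OF P(3)] integrable_T[OF R(3)] by simp
  also have "(\<integral>x. \<phi> (T x) * p i (T x) \<partial>M) = (\<integral>x. \<phi> x * p i x \<partial>M)"
    using integral_T[of "\<lambda>x. \<phi> x * p i x"] by simp
  also have "(\<integral>x. \<phi> (T x) * r (Suc i) (T x) \<partial>M) = (\<integral>x. \<phi> x * r (Suc i) x \<partial>M)"
    using integral_T[of "\<lambda>x. \<phi> x * r (Suc i) x"] by simp
  also have "(\<integral>x. \<phi> (T x) * p (Suc i) x \<partial>M) = (\<integral>x. \<phi> x * p i x \<partial>M)"
    unfolding P(2) P(4) using integral_T[of "\<lambda>x. \<phi> x * f ((T ^^ i) x)"] by (simp add: funpow_swap1)
  also have "(\<integral>x. \<phi> (T x) * r i x \<partial>M) = (\<integral>x. \<phi> x * r (Suc i) x \<partial>M)"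
    unfolding R(2) R(4) by simp
  finally show ?thesis by simp
qed

lemma d_int: "integrable M (d i)" and summable_d: "summable (\<lambda>i. \<integral>x. \<bar>d i x\<bar> \<partial>M)"
proof -
  have ia: "integrable M (a i)" and ir: "integrable M (r i)" for i
    using integrable_of_square[of "a i"] integrable_of_square[of "r i"] a_sq r_sq by auto
  note iT = integrable_T[OF ia] integrable_T[OF ir]
  show "integrable M (d i)" for i
    unfolding d_eq using ia ir iT by auto
  have le: "(\<integral>x. \<bar>d i x\<bar> \<partial>M) \<le> (L2_norm M (a i) + L2_norm M (a (Suc i))) + (L2_norm M (r i) + L2_norm M (r (Suc i)))" for i
  proof -
    have "(\<integral>x. \<bar>d i x\<bar> \<partial>M) \<le> (\<integral>x. (\<bar>a i (T x)\<bar> + \<bar>a (Suc i) x\<bar>) + (\<bar>r i x\<bar> + \<bar>r (Suc i) (T x)\<bar>) \<partial>M)"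
      unfolding d_eq using ia ir iT by (intro integral_mono) auto
    also have "\<dots> = ((\<integral>x. \<bar>a i (T x)\<bar> \<partial>M) + (\<integral>x. \<bar>a (Suc i) x\<bar> \<partial>M)) + ((\<integral>x. \<bar>r i x\<bar> \<partial>M) + (\<integral>x. \<bar>r (Suc i) (T x)\<bar> \<partial>M))"
      using ia ir iT by simp
    also have "(\<integral>x. \<bar>a i (T x)\<bar> \<partial>M) = (\<integral>x. \<bar>a i x\<bar> \<partial>M)"
      using integral_T[of "\<lambda>x. \<bar>a i x\<bar>"] by simp
    also have "(\<integral>x. \<bar>r (Suc i) (T x)\<bar> \<partial>M) = (\<integral>x. \<bar>r (Suc i) x\<bar> \<partial>M)"
      using integral_T[of "\<lambda>x. \<bar>r (Suc i) x\<bar>"] by simp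
    finally show ?thesis
      by (elim order_trans) (intro add_mono integral_abs_le_L2_norm a_M r_M a_sq r_sq)
  qed
  show "summable (\<lambda>i. \<integral>x. \<bar>d i x\<bar> \<partial>M)"
  proof (rule summable_comparison_test'[of _ 0])
    show "summable (\<lambda>i. (L2_norm M (a i) + L2_norm M (a (Suc i))) + (L2_norm M (r i) + L2_norm M (r (Suc i))))"
      by (intro summable_add summable_a summable_r summable_a[THEN summable_Suc_iff[THEN iffD2]]
          summable_r[THEN summable_Suc_iff[THEN iffD2]])
  qed (use le in \<open>auto simp: integral_nonneg_AE\<close>)
qed

text \<open>Termwise orthogonality survives summation, since the terms are summable in L1 and the
  test function is bounded.\<close>

lemma orth_m:
  assumes \<phi> [measurable]: "\<phi> \<in> borel_measurable G" and "bounded (range \<phi>)"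
  shows "(\<integral>x. m x * \<phi> (T x) \<partial>M) = 0"
proof -
  obtain B where b: "\<And>x. norm (\<phi> x) \<le> B" using assms(2) by (auto simp: bounded_iff)
  have [measurable]: "\<phi> \<in> borel_measurable M" by (rule meas_M) measurable
  have le: "norm (d i x * \<phi> (T x)) \<le> B * \<bar>d i x\<bar>" for i x
    using mult_left_mono[OF b[of "T x"], of "\<bar>d i x\<bar>"] by (simp add: abs_mult mult.commute)
  have int: "integrable M (\<lambda>x. d i x * \<phi> (T x))" for i
    by (rule Bochner_Integration.integrable_bound[of _ "\<lambda>x. B * \<bar>d i x\<bar>"])
       (use le d_int in \<open>auto intro!: AE_I2 order_trans[OF _ abs_ge_self]\<close>)
  have summ: "summable (\<lambda>i. \<integral>x. norm (d i x * \<phi> (T x)) \<partial>M)"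
  proof (rule summable_comparison_test'[of _ 0])
    show "summable (\<lambda>i. B * (\<integral>x. \<bar>d i x\<bar> \<partial>M))" by (intro summable_mult summable_d)
    show "norm (\<integral>x. norm (d i x * \<phi> (T x)) \<partial>M) \<le> B * (\<integral>x. \<bar>d i x\<bar> \<partial>M)" for i
    proof -
      have "norm (\<integral>x. norm (d i x * \<phi> (T x)) \<partial>M) = (\<integral>x. norm (d i x * \<phi> (T x)) \<partial>M)"
        by (simp add: integral_nonneg_AE)
      also have "\<dots> \<le> (\<integral>x. B * \<bar>d i x\<bar> \<partial>M)"
        using int d_int le by (intro integral_mono integrable_norm) auto
      finally show ?thesis by simp
    qed
  qed
  have "AE x in M. summable (\<lambda>i. norm (d i x))"
    by (rule AE_summable_of_integral_norm) (use d_int summable_d in auto)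
  then have eq: "AE x in M. (\<Sum>i. d i x * \<phi> (T x)) = m x * \<phi> (T x)"
    unfolding m_def by eventually_elim (auto intro!: suminf_mult2[symmetric] intro: summable_rabs_cancel)
  have "(\<integral>x. m x * \<phi> (T x) \<partial>M) = (\<integral>x. (\<Sum>i. d i x * \<phi> (T x)) \<partial>M)"
    using eq by (intro integral_cong_AE) auto
  also have "\<dots> = (\<Sum>i. \<integral>x. d i x * \<phi> (T x) \<partial>M)"
    by (rule integral_suminf[OF int AE_summable_of_integral_norm[OF int summ] summ])
  also have "\<dots> = 0" using orth_d[OF \<phi> b] by simp
  finally show ?thesis .
qed

sublocale martingale: reverse_martingale_difference M T G m
  by unfold_locales (fact subalg T_G m_G m_sq orth_m)+

lemma AE_birkhoff_sum_decomposition: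
  "AE x in M. \<forall>k. birkhoff_sum T f k x = birkhoff_sum T m k x + v x - v ((T ^^ k) x)"
proof -
  have "AE x in M. \<forall>j. f ((T ^^ j) x) = m ((T ^^ j) x) + v ((T ^^ j) x) - v (T ((T ^^ j) x))"
    unfolding AE_all_countable using AE_T_pow[OF AE_decomposition] by blast
  then show ?thesis
  proof eventually_elim
    case (elim x)
    show ?case
    proof
      fix k show "birkhoff_sum T f k x = birkhoff_sum T m k x + v x - v ((T ^^ k) x)"
        by (induction k) (simp_all add: birkhoff_sum_Suc elim)
    qed
  qed
qed

lemmas limit_theorems =
  martingale.limit_theorems_of_cohomologous[OF f_M v_M v_sq AE_birkhoff_sum_decomposition]

end

text \<open>The remaining work is to bring the hypotheses into the form of
  \<open>gordin_condition\<close>: surjectivity and invariance of \<open>F\<close> come from the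
  image families, and the future sum is compared after transport along T^i.\<close>

theorem theorem2p16:
  fixes M :: "'a measure" and T :: "'a \<Rightarrow> 'a" and F :: "'a set set" and f :: "'a \<Rightarrow> real"
  assumes "ergodic_endomorphism M T"
    and "sigma_algebra (space M) F" and "F \<subseteq> sets M"
    and "F \<subseteq> image_family T 1 F"
    and "\<And>n. sigma_algebra (space M) (image_family T n F)"
    and "\<And>n. image_family T n F \<subseteq> sets M"
    and "\<And>n. preimage_family M T n (image_family T n F) \<subseteq> F"
    and "f \<in> borel_measurable M" and "integrable M (\<lambda>x. (f x)\<^sup>2)"
    and "(\<integral>x. f x \<partial>M) = 0"
    and "summable (\<lambda>n. L2_norm M (\<lambda>x. cond_exp_on M (image_family T n F) f x - f x))"
    and "summable (\<lambda>n. L2_norm M (cond_exp_on M (preimage_family M T n F) f))"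
  shows "\<exists>\<sigma>2::real. \<sigma>2 \<ge> 0 \<and>
     converges_with_tight_maxima M (birkhoff_sum T f) (\<lambda>n. sqrt (real n)) (centred_normal_law \<sigma>2) \<and>
     almost_sure_limit_theorem M (birkhoff_sum T f) (\<lambda>n. sqrt (real n)) (centred_normal_law \<sigma>2)"
proof -
  interpret prob_space M using assms(1) by (simp add: ergodic_endomorphism_def)
  interpret ergodic_system M T
    using assms(1) by unfold_locales (auto simp: ergodic_endomorphism_def)
  \<comment> \<open>The whole space lies in the sigma-algebra T F, so it is the image of some
    set.\<close>
  have surj: "T ` space M = space M"
  proof -
    interpret sigma_algebra "space M" "image_family T 1 F" by (rule assms(5))
    have "space M \<in> image_family T 1 F" by (rule top)
    then obtain A where "A \<in> F" "space M = T ` A" by (auto simp: image_family_def)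
    moreover have "A \<subseteq> space M" using \<open>A \<in> F\<close> assms(3) sets.sets_into_space by blast
    ultimately have "space M \<subseteq> T ` space M" by blast
    then show ?thesis by (intro subset_antisym) auto
  qed
  \<comment> \<open>A set of \<open>F\<close> also belongs to T F, and preimages of sets of T F
    return to \<open>F\<close>.\<close>
  have vimage: "T -` A \<inter> space M \<in> F" if "A \<in> F" for A
  proof -
    have "T -` A \<inter> space M \<in> preimage_family M T 1 (image_family T 1 F)"
      using that assms(4) by (auto simp: preimage_family_def)
    then show ?thesis using assms(7) by blast
  qed
  have future: "summable (\<lambda>i. L2_norm M (\<lambda>x. f ((T ^^ i) x) - cond_exp_on M F (\<lambda>x. f ((T ^^ i) x)) x))"
  proof (rule summable_comparison_test'[OF assms(11), of 0])
    fix i :: nat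
    let ?G = "sigma (space M) F" and ?H = "sigma (space M) (image_family T i F)"
    let ?z = "cond_exp_on M (image_family T i F) f"
    have sub: "subalgebra M ?G" by (rule subalgebra_sigma[OF assms(2,3)])
    have subH: "subalgebra M ?H" by (rule subalgebra_sigma[OF assms(5,6)])
    \<comment> \<open>Here T^-i (T^i F) being contained in \<open>F\<close> enters: E(f | T^i F) o
      T^i becomes measurable for \<open>F\<close>, hence a competitor for the best approximation of
      f o T^i.\<close>
    have T_GH: "T ^^ i \<in> measurable ?G ?H"
    proof (rule measurableI)
      fix A assume "A \<in> sets ?H"
      then have "A \<in> image_family T i F" by (simp add: sets_sigma_of_sigma_algebra[OF assms(5)])
      then have "(T ^^ i) -` A \<inter> space M \<in> F"
        using assms(7)[of i] by (auto simp: preimage_family_def)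
      then show "(T ^^ i) -` A \<inter> space ?G \<in> sets ?G"
        using sub by (simp add: sets_sigma_of_sigma_algebra[OF assms(2)] subalgebra_def)
    qed (use sub subH in \<open>simp add: subalgebra_def\<close>)
    have [measurable]: "?z \<in> borel_measurable ?H" "f \<in> borel_measurable M"
      unfolding cond_exp_on_def by (auto intro: assms(8))
    have zT: "(\<lambda>x. ?z ((T ^^ i) x)) \<in> borel_measurable ?G"
      using T_GH by measurable
    have z_sq: "integrable M (\<lambda>x. (?z x)\<^sup>2)"
      unfolding cond_exp_on_def by (rule real_cond_exp_square_integrable[OF subH assms(8,9)])
    have [measurable]: "?z \<in> borel_measurable M"
      unfolding cond_exp_on_def by measurable
    have "L2_norm M (\<lambda>x. f ((T ^^ i) x) - cond_exp_on M F (\<lambda>x. f ((T ^^ i) x)) x)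
        \<le> L2_norm M (\<lambda>x. ?z ((T ^^ i) x) - f ((T ^^ i) x))"
      unfolding cond_exp_on_def[of M F]
      by (rule L2_norm_minus_real_cond_exp_le[OF sub _ zT integrable_T_pow[OF assms(9)] integrable_T_pow[OF z_sq]])
         measurable
    also have "\<dots> = L2_norm M (\<lambda>x. ?z x - f x)"
      unfolding L2_norm_def using integral_T_pow[of "\<lambda>x. (?z x - f x)\<^sup>2" i] by simp
    finally show "norm (L2_norm M (\<lambda>x. f ((T ^^ i) x) - cond_exp_on M F (\<lambda>x. f ((T ^^ i) x)) x))
        \<le> L2_norm M (\<lambda>x. ?z x - f x)"
      by (simp add: L2_norm_nonneg)
  qed
  interpret gordin_condition M T F f
    by (intro gordin_condition.intro gordin_condition_axioms.intro ergodic_system_axioms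
        assms(2,3,8,9,12) surj vimage future)
  show ?thesis
    using martingale.\<sigma>2_nonneg limit_theorems by blast
qed

end
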